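(* Let $p$ be a prime and $\frac{p-1}{p}<\delta<1$. Let $\mathbb{K}$ be a finite field, $n$ a positive integer, and $C\subseteq\mathbb{F}_p^{\mathbb{K}^n}$ a single orbit affine invariant code with defining constraint $\underline{e}_0$ of support size $k=|\operatorname{supp}(\underline{e}_0)|$, such that $$|\mathbb{K}|^n\ge k^4\,\frac{128(1+15\delta)}{7(1-\delta)^2}.$$ Then for every $\underline{c}\in\mathbb{F}_p^{\mathbb{K}^n}$, $$\operatorname{rej}(\underline{c})\ge k\cdot\frac{7(1-\delta)^3(\delta-\frac{p-1}{p})}{512(1+15\delta)}\cdot\min\left\{\min_{\underline{c}'\in C}\|\underline{c}-\underline{c}'\|,\ \frac1{k^3}\right\}.$$ (That is, the family of all such codes is amplified locally testable with $r=\frac{7(1-\delta)^3(\delta-\frac{p-1}{p})}{512(1+15\delta)}$ and $t=3$.)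
   Context: The affine group $\operatorname{Aff}(\mathbb{K}^n)$ consists of pairs $(\underline{y},L)$ with $\underline{y}\in\mathbb{K}^n$, $L\in\operatorname{GL}(\mathbb{K}^n)$, acting on $\mathbb{K}^n$ by $(\underline{y},L).\underline{x}=L\underline{x}+\underline{y}$, and on functions $f\in\mathbb{F}_p^{\mathbb{K}^n}$ by $(g.f)(\underline{x})=f(g^{-1}.\underline{x})$. A single orbit affine invariant code is defined by fixing $\underline{e}_0\in\mathbb{F}_p^{\mathbb{K}^n}$ taking values in $\{0,1\}$ with $|\operatorname{supp}(\underline{e}_0)|\ge2$, and setting $C=\{\underline{c}\in\mathbb{F}_p^{\mathbb{K}^n}:(g.\underline{e}_0)\cdot\underline{c}=0\ \forall g\in\operatorname{Aff}(\mathbb{K}^n)\}$, where $\underline{e}\cdot\underline{c}=\sum_{\underline{x}}\underline{e}(\underline{x})\underline{c}(\underline{x})$. Let $\tau_0=\operatorname{supp}(\underline{e}_0)$ and $E=\{g.\tau_0:g\in\operatorname{Aff}(\mathbb{K}^n)\}$ (the set of distinct supports of the constraints). Then $\operatorname{rej}(\underline{c})=\frac{|\{\tau\in E:\sum_{\underline{x}\in\tau}\underline{c}(\underline{x})\neq0\}|}{|E|}$ is the fraction of constraints violated, and $\|\underline{c}-\underline{c}'\|=\frac{|\{\underline{x}\in\mathbb{K}^n:\underline{c}(\underline{x})\ne\underline{c}'(\underline{x})\}|}{|\mathbb{K}|^n}$ is the normalized Hamming distance. *)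

theory Defs
  imports "HOL-Analysis.Analysis" "Berlekamp_Zassenhaus.Finite_Field"
begin

text \<open>Points of K^n are vectors of type 'k ^ 'n (n = CARD('n) >= 1).
  Words are functions 'k^'n => 'p mod_ring, where 'p mod_ring is F_p, p = CARD('p) prime.\<close>

definition aff_group :: "((('k::field) ^ 'n) \<times> ('k ^ 'n ^ 'n)) set" where
  "aff_group = {(y, L). invertible L}"

definition aff_act :: "(('k::field) ^ 'n) \<times> ('k ^ 'n ^ 'n) \<Rightarrow> 'k ^ 'n \<Rightarrow> 'k ^ 'n" where
  "aff_act g x = snd g *v x + fst g"

definition aff_inv_act :: "(('k::field) ^ 'n) \<times> ('k ^ 'n ^ 'n) \<Rightarrow> 'k ^ 'n \<Rightarrow> 'k ^ 'n" where
  "aff_inv_act g x = matrix_inv (snd g) *v (x - fst g)"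

definition fun_act :: "(('k::field) ^ 'n) \<times> ('k ^ 'n ^ 'n) \<Rightarrow> ('k ^ 'n \<Rightarrow> 'a) \<Rightarrow> ('k ^ 'n \<Rightarrow> 'a)" where
  "fun_act g f = (\<lambda>x. f (aff_inv_act g x))"

definition dotp :: "('x::finite \<Rightarrow> 'a::comm_ring_1) \<Rightarrow> ('x \<Rightarrow> 'a) \<Rightarrow> 'a" where
  "dotp e c = (\<Sum>x\<in>UNIV. e x * c x)"

definition supp :: "('x \<Rightarrow> 'a::zero) \<Rightarrow> 'x set" where
  "supp f = {x. f x \<noteq> 0}"

definition aff_code :: "(('k::{field,finite}) ^ ('n::finite) \<Rightarrow> 'a::comm_ring_1) \<Rightarrow> ('k ^ 'n \<Rightarrow> 'a) set" where
  "aff_code e0 = {c. \<forall>g\<in>aff_group. dotp (fun_act g e0) c = 0}"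

definition constraint_supports :: "(('k::{field,finite}) ^ ('n::finite) \<Rightarrow> 'a::comm_ring_1) \<Rightarrow> ('k ^ 'n) set set" where
  "constraint_supports e0 = {supp (fun_act g e0) | g. g \<in> aff_group}"

definition rej :: "(('k::{field,finite}) ^ ('n::finite) \<Rightarrow> 'a::comm_ring_1) \<Rightarrow> ('k ^ 'n \<Rightarrow> 'a) \<Rightarrow> real" where
  "rej e0 c = real (card {\<tau> \<in> constraint_supports e0. (\<Sum>x\<in>\<tau>. c x) \<noteq> 0})
              / real (card (constraint_supports e0))"

definition hdist :: "(('k::finite) ^ ('n::finite) \<Rightarrow> 'a) \<Rightarrow> ('k ^ 'n \<Rightarrow> 'a) \<Rightarrow> real" where
  "hdist c c' = real (card {x. c x \<noteq> c' x}) / real CARD('k) ^ CARD('n)"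

end

theory Submission
  imports Defs "HOL-Algebra.Algebraic_Closure_Type" "HOL-Number_Theory.Residues"
begin

text \<open>
  Write \<open>V = K\<^sup>n\<close>, \<open>N = |V|\<close>, \<open>T = supp e0\<close> and call \<open>L\<close> bad for a word \<open>f\<close> if some constraint with linear part \<open>L\<close>
  is violated by \<open>f\<close>. If \<open>c\<close> is within \<open>1/(2k)\<close> of the code, two-transitivity of the affine group shows that most
  constraints meeting the error set meet it once, so the rejection probability is at least \<open>k/2\<close> times the distance.
  It remains to decode any \<open>c\<close> with rejection probability \<open>O(1/k\<^sup>2)\<close>. Grids of constraints
  \<open>x + A(t - a) + B(z - a)\<close> show, as in the argument of Kaufman and Sudan, that majority decoding yields a nearby \<open>f\<close>
  for which the bad matrices have density \<open>O(1/k)\<close>, with a small constant.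

  To see that there are no bad matrices at all, identify \<open>V\<close> with the field of \<open>N\<close> elements. Bilinear grids built from
  the field multiplication show that if \<open>L\<close> is bad, then \<open>L s\<close> is bad with probability about \<open>1/k\<close> for a random element
  \<open>s\<close> of a random Singer cycle. The random walk by such \<open>s\<close> is conjugation invariant with a density of at most \<open>n\<close>,
  and a nontrivial character of a transvection group of order \<open>N/q\<close> occurs with many conjugates; comparing
  Hilbert-Schmidt norms bounds the second eigenvalue by \<open>sqrt (n q / N)\<close>, which is much smaller than \<open>1/k\<close>. Hence a nonempty set
  of bad matrices would have density of order \<open>1/k\<close>, a contradiction.
\<close>

text \<open>The grid \<open>x + A(t - a) + B(z - a)\<close> cannot finish the proof. Used on a bad
  \<open>L\<close>, its rows all carry the linear part \<open>L\<close> itself, so it never refutes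
  an \<open>L\<close> violated on a fraction 1/k of its translates; averaging only bounds the number
  of such \<open>L\<close>. The bilinear grid changes the linear part of its rows, so that one bad
  \<open>L\<close> yields bad neighbours and expansion becomes applicable. Commutativity of the
  field makes this grid affine in both directions; the absence of zero divisors makes nearly all
  matrices in it invertible. The averages over different conjugates of the transvection group do not
  commute. In place of the representation theory of GL, a function of least norm under an energy
  constraint is shown to be invariant under all of them. Functions of the determinant are not
  contracted in this way; for them it suffices that field norms are evenly spread. Constants: p >= 2
  forces \<open>\<delta>\<close> > 1/2, and then the size hypothesis gives N >= 600 k^4 while the
  stated r is at most 1/1000. The estimates rest on these two numbers.\<close>

section \<open>Finite fields: order and additive characters\<close>

text \<open>Negatives come for free in characteristic p, since -y = (p - 1) y; see
  \<open>add_subgroup_diff\<close>.\<close>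

definition add_subgroup :: "'a::ab_group_add set \<Rightarrow> bool" where
  "add_subgroup A \<longleftrightarrow> 0 \<in> A \<and> (\<forall>x\<in>A. \<forall>y\<in>A. x + y \<in> A)"

definition cyclic_ext :: "'a::ring_1 set \<Rightarrow> 'a \<Rightarrow> 'a set" where
  "cyclic_ext A x = {a + of_nat j * x | a j. a \<in> A}"

lemma CHAR_finite_field_prime: "Factorial_Ring.prime CHAR('k::{field,finite})"
  by (rule prime_CHAR_semidom) (simp add: finite_imp_CHAR_pos)

lemma add_subgroup_of_nat:
  fixes A :: "'a::ring_1 set"
  assumes "add_subgroup A" "x \<in> A"
  shows "of_nat j * x \<in> A"
  using assms by (induction j) (auto simp: add_subgroup_def algebra_simps)

lemma of_nat_mult_mod_CHAR: "of_nat (j mod CHAR('a)) * x = of_nat j * (x :: 'a::ring_1)"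
proof -
  have "of_nat (j mod CHAR('a)) = (of_nat j :: 'a)"
    by (metis mod_mod_trivial of_nat_eq_iff_cong_CHAR cong_def)
  thus ?thesis by simp
qed

lemma add_subgroup_multiple_notin:
  fixes A :: "'k::{field,finite} set"
  assumes A: "add_subgroup A" and x: "x \<notin> A" and j: "of_nat j * x \<in> A"
  shows "CHAR('k) dvd j"
proof (rule ccontr)
  assume "\<not> CHAR('k) dvd j"
  hence "coprime j CHAR('k)"
    using CHAR_finite_field_prime[where 'k='k] by (metis coprime_commute prime_imp_coprime)
  then obtain i where "[j * i = 1] (mod CHAR('k))"
    using cong_solve_coprime_nat by fastforce
  hence "(of_nat (j * i) :: 'k) = 1"
    by (metis of_nat_1 of_nat_eq_iff_cong_CHAR)
  hence "of_nat i * (of_nat j * x) = x"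
    by (metis mult.commute mult.left_commute mult_1 of_nat_mult)
  with add_subgroup_of_nat[OF A j, of i] x show False by simp
qed

lemma add_subgroup_diff:
  fixes A :: "'k::{field,finite} set"
  assumes A: "add_subgroup A" "x \<in> A" "y \<in> A"
  shows "x - y \<in> A"
proof -
  have "CHAR('k) > 0"
    by (simp add: finite_imp_CHAR_pos)
  hence "of_nat (CHAR('k) - 1) * y = - y"
    by (simp add: of_nat_diff)
  with add_subgroup_of_nat[OF A(1,3), of "CHAR('k) - 1"] have "- y \<in> A" by simp
  with A have "x + - y \<in> A" unfolding add_subgroup_def by blast
  thus ?thesis by simp
qed

text \<open>The class of \<open>j\<close> modulo the characteristic is a coordinate on
  \<open>cyclic_ext A x\<close>; the order count and the character both rest on it.\<close>

lemma cyclic_ext_eq_imp: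
  fixes A :: "'k::{field,finite} set"
  assumes A: "add_subgroup A" and x: "x \<notin> A" and a: "a \<in> A" "a' \<in> A"
    and eq: "a + of_nat j * x = a' + of_nat j' * x"
  shows "[j = j'] (mod CHAR('k))"
proof -
  have *: "[j = j'] (mod CHAR('k))"
    if a: "a \<in> A" "a' \<in> A" and eq: "a + of_nat j * x = a' + of_nat j' * x" and le: "j' \<le> j" for a a' j j'
  proof -
    have "of_nat (j - j') * x = a' - a"
      using eq le by (simp add: of_nat_diff algebra_simps)
    also have "\<dots> \<in> A" by (rule add_subgroup_diff[OF A a(2,1)])
    finally have "CHAR('k) dvd j - j'" by (rule add_subgroup_multiple_notin[OF A x])
    thus ?thesis using le by (metis cong_altdef_nat cong_sym)
  qed
  show ?thesis
  proof (cases "j' \<le> j")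
    case True thus ?thesis using *[OF a eq] by simp
  next
    case False thus ?thesis using *[OF a(2,1) eq[symmetric]] by (simp add: cong_sym)
  qed
qed

lemma add_subgroup_cyclic_ext: "add_subgroup A \<Longrightarrow> add_subgroup (cyclic_ext A x)"
  for A :: "'a::ring_1 set"
proof -
  assume A: "add_subgroup A"
  have "0 = 0 + of_nat 0 * x" "0 \<in> A" using A by (auto simp: add_subgroup_def)
  hence 1: "0 \<in> cyclic_ext A x" unfolding cyclic_ext_def by blast
  have "a + of_nat i * x + (b + of_nat j * x) = (a + b) + of_nat (i + j) * x" for a b i j
    by (simp add: algebra_simps)
  moreover have "a + b \<in> A" if "a \<in> A" "b \<in> A" for a b using A that by (auto simp: add_subgroup_def)
  ultimately show ?thesis using 1 unfolding add_subgroup_def cyclic_ext_def by blast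
qed

lemma subset_cyclic_ext: "a \<in> A \<Longrightarrow> a \<in> cyclic_ext A x"
  unfolding cyclic_ext_def by (rule CollectI, rule exI[of _ a], rule exI[of _ 0]) simp

lemma generator_in_cyclic_ext: "add_subgroup A \<Longrightarrow> x \<in> cyclic_ext A x"
  unfolding cyclic_ext_def add_subgroup_def by (rule CollectI, rule exI[of _ 0], rule exI[of _ 1]) simp

lemma card_cyclic_ext:
  fixes A :: "'k::{field,finite} set"
  assumes A: "add_subgroup A" and x: "x \<notin> A"
  shows "card (cyclic_ext A x) = CHAR('k) * card A"
proof -
  let ?f = "\<lambda>(a, j). a + of_nat j * x"
  have "inj_on ?f (A \<times> {..<CHAR('k)})"
  proof (rule inj_onI)
    fix s t assume st: "s \<in> A \<times> {..<CHAR('k)}" "t \<in> A \<times> {..<CHAR('k)}" "?f s = ?f t"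
    obtain a j a' j' where [simp]: "s = (a, j)" "t = (a', j')" by (cases s, cases t) auto
    from st have *: "a \<in> A" "a' \<in> A" "j < CHAR('k)" "j' < CHAR('k)"
      and eq: "a + of_nat j * x = a' + of_nat j' * x" by auto
    from cyclic_ext_eq_imp[OF A x *(1,2) eq] have "j = j'" using * by (simp add: cong_def)
    with eq show "s = t" by simp
  qed
  moreover have "?f ` (A \<times> {..<CHAR('k)}) = cyclic_ext A x"
  proof
    show "cyclic_ext A x \<subseteq> ?f ` (A \<times> {..<CHAR('k)})"
    proof
      fix y assume "y \<in> cyclic_ext A x"
      then obtain a j where "a \<in> A" "y = a + of_nat j * x" by (auto simp: cyclic_ext_def)
      moreover have "j mod CHAR('k) < CHAR('k)" by (simp add: finite_imp_CHAR_pos)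
      ultimately show "y \<in> ?f ` (A \<times> {..<CHAR('k)})"
        by (intro image_eqI[of _ _ "(a, j mod CHAR('k))"]) (auto simp: of_nat_mult_mod_CHAR)
    qed
  qed (auto simp: cyclic_ext_def)
  ultimately have "card (cyclic_ext A x) = card (A \<times> {..<CHAR('k)})"
    using card_image by metis
  thus ?thesis by (simp add: card_cartesian_product)
qed

text \<open>A maximal additive subgroup of p-power order is everything, since adjoining an outside
  element multiplies the order by p. The power form is what makes x -> x^q additive.\<close>

lemma card_finite_field: "\<exists>e. CARD('k::{field,finite}) = CHAR('k) ^ e"
proof -
  define S where "S = {A :: 'k set. add_subgroup A \<and> (\<exists>e. card A = CHAR('k) ^ e)}"
  have "{0} \<in> S" unfolding S_def add_subgroup_def by (auto intro: exI[of _ 0])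
  then obtain A where A: "A \<in> S" "\<And>B. B \<in> S \<Longrightarrow> A \<subseteq> B \<Longrightarrow> A = B"
    using finite_has_maximal2[of S "{0}"] by auto
  have "A = UNIV"
  proof (rule ccontr)
    assume "A \<noteq> UNIV"
    then obtain x where x: "x \<notin> A" by auto
    from A(1) obtain e where e: "add_subgroup A" "card A = CHAR('k) ^ e" by (auto simp: S_def)
    have "card (cyclic_ext A x) = CHAR('k) ^ Suc e"
      using card_cyclic_ext[OF e(1) x] e(2) by simp
    hence "cyclic_ext A x \<in> S" using add_subgroup_cyclic_ext[OF e(1)] unfolding S_def by blast
    hence "A = cyclic_ext A x" using A(2) subset_cyclic_ext by blast
    thus False using x generator_in_cyclic_ext[OF e(1), of x] by blast
  qed
  with A(1) show ?thesis by (auto simp: S_def)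
qed

text \<open>A maximal proper subgroup \<open>A\<close> has index p, so in y = a + j x the number j
  is defined modulo p, and the j-th power of a nontrivial p-th root of unity is a character with
  kernel \<open>A\<close>.\<close>

lemma exists_additive_character:
  "\<exists>\<psi> :: 'k::{field,finite} \<Rightarrow> complex. (\<forall>x y. \<psi> (x + y) = \<psi> x * \<psi> y) \<and> (\<forall>x. norm (\<psi> x) = 1)
      \<and> (\<exists>x. \<psi> x \<noteq> 1)"
proof -
  define S where "S = {A :: 'k set. add_subgroup A \<and> A \<noteq> UNIV}"
  have "(1::'k) \<notin> {0}" by simp
  hence "{0::'k} \<noteq> UNIV" by blast
  hence "{0} \<in> S" by (simp add: S_def add_subgroup_def)
  then obtain A where A: "A \<in> S" "\<And>B. B \<in> S \<Longrightarrow> A \<subseteq> B \<Longrightarrow> A = B"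
    using finite_has_maximal2[of S "{0}"] by auto
  from A(1) have sub: "add_subgroup A" by (auto simp: S_def)
  from A(1) obtain x where x: "x \<notin> A" by (auto simp: S_def)
  have univ: "cyclic_ext A x = UNIV"
  proof (rule ccontr)
    assume "cyclic_ext A x \<noteq> UNIV"
    hence "cyclic_ext A x \<in> S" using add_subgroup_cyclic_ext[OF sub, of x] by (simp add: S_def)
    hence "A = cyclic_ext A x" using A(2) subset_cyclic_ext by blast
    thus False using x generator_in_cyclic_ext[OF sub, of x] by blast
  qed
  let ?p = "CHAR('k)"
  have p: "Factorial_Ring.prime ?p" by (rule CHAR_finite_field_prime)
  define \<zeta> where "\<zeta> = cis (2 * pi / ?p)"
  have zp: "\<zeta> ^ ?p = 1"
    unfolding \<zeta>_def Complex.DeMoivre using prime_gt_0_nat[OF p] by simp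
  have cong: "\<zeta> ^ i = \<zeta> ^ j" if "[i = j] (mod ?p)" for i j
  proof -
    have "\<zeta> ^ i = \<zeta> ^ (i mod ?p)" for i
      by (metis div_mult_mod_eq mult.commute mult_1 power_add power_mult power_one zp)
    thus ?thesis using that unfolding cong_def by metis
  qed
  have "\<zeta> \<noteq> 1"
  proof
    assume "\<zeta> = 1"
    hence "cos (2 * pi / ?p) = 1" unfolding \<zeta>_def by (simp add: complex_eq_iff)
    moreover have "cos (2 * pi / ?p) < cos 0"
    proof (cases "?p = 2")
      case True thus ?thesis by simp
    next
      case False
      hence "?p \<ge> 3" using prime_ge_2_nat[OF p] by simp
      hence "2 * pi / ?p \<le> pi" by (simp add: field_simps)
      moreover have "0 < 2 * pi / ?p" using prime_gt_0_nat[OF p] by simp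
      ultimately show ?thesis by (intro cos_monotone_0_pi) auto
    qed
    ultimately show False by simp
  qed
  define J where "J y = (SOME j. \<exists>a\<in>A. y = a + of_nat j * x)" for y
  have J: "\<exists>a\<in>A. y = a + of_nat (J y) * x" for y
  proof -
    have "\<exists>j. \<exists>a\<in>A. y = a + of_nat j * x" using univ unfolding cyclic_ext_def by blast
    thus ?thesis unfolding J_def by (rule someI_ex)
  qed
  \<comment> \<open>The choice \<open>J y\<close> is arbitrary within its class modulo p, but the
    power of \<open>\<zeta>\<close> depends only on the class.\<close>
  have Jeq: "\<zeta> ^ J y = \<zeta> ^ j" if "y = a + of_nat j * x" "a \<in> A" for y a j
    using cyclic_ext_eq_imp[OF sub x] J[of y] that by (metis cong)
  define \<psi> where "\<psi> y = \<zeta> ^ J y" for y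
  have add: "\<psi> (y + z) = \<psi> y * \<psi> z" for y z
  proof -
    obtain a b where ab: "a \<in> A" "b \<in> A" "y = a + of_nat (J y) * x" "z = b + of_nat (J z) * x"
      using J by blast
    have "y + z = (a + b) + of_nat (J y + J z) * x"
      using ab by (metis (no_types, lifting) add.assoc add.left_commute distrib_right of_nat_add)
    moreover have "a + b \<in> A" using sub ab by (auto simp: add_subgroup_def)
    ultimately have "\<psi> (y + z) = \<zeta> ^ (J y + J z)" unfolding \<psi>_def by (rule Jeq)
    thus ?thesis by (simp add: \<psi>_def power_add)
  qed
  moreover have "norm (\<psi> y) = 1" for y by (simp add: \<psi>_def \<zeta>_def norm_power)
  moreover have "\<psi> x = \<zeta> ^ 1" unfolding \<psi>_def
    using sub by (intro Jeq[of _ 0]) (auto simp: add_subgroup_def)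
  ultimately show ?thesis using \<open>\<zeta> \<noteq> 1\<close> by (metis power_one_right)
qed

section \<open>Subfields of the algebraic closure\<close>

lemma frobenius_add:
  fixes x y :: "'k::{field,finite} alg_closure"
  shows "(x + y) ^ (CARD('k) ^ j) = x ^ (CARD('k) ^ j) + y ^ (CARD('k) ^ j)"
proof -
  obtain e where e: "CARD('k) = CHAR('k) ^ e" using card_finite_field by blast
  show ?thesis
    by (rule freshmans_dream'[of _ "e * j"])
       (simp_all add: e CHAR_finite_field_prime flip: power_mult)
qed

lemma frobenius_sum:
  fixes f :: "'b \<Rightarrow> 'k::{field,finite} alg_closure"
  shows "(\<Sum>x\<in>A. f x) ^ (CARD('k) ^ j) = (\<Sum>x\<in>A. f x ^ (CARD('k) ^ j))"
  by (induction A rule: infinite_finite_induct) (auto simp: frobenius_add power_0_left)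

lemma finite_field_power_card: "(x::'k::{field,finite}) ^ CARD('k) = x"
proof (cases "x = 0")
  case False
  have "(\<Prod>y\<in>UNIV-{0}. x * y) = (\<Prod>y\<in>UNIV-{0}. y)"
    by (rule prod.reindex_bij_witness[of _ "\<lambda>y. y / x" "\<lambda>y. x * y"]) (use False in auto)
  hence "x ^ (CARD('k) - 1) * (\<Prod>y\<in>UNIV-{0}. y) = (\<Prod>y\<in>UNIV-{0}. y)"
    by (simp add: prod.distrib card_Diff_singleton)
  moreover have "(\<Prod>y\<in>UNIV-{0::'k}. y) \<noteq> 0" by (simp add: prod_zero_iff)
  ultimately have "x ^ (CARD('k) - 1) = 1" by simp
  hence "x ^ Suc (CARD('k) - 1) = x" by (simp only: power_Suc mult_1_right)
  moreover have "Suc (CARD('k) - 1) = CARD('k)" using zero_less_card_finite[where 'a='k] by linarith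
  ultimately show ?thesis by (simp only:)
qed simp

lemma frobenius_to_ac: "to_ac (x::'k::{field,finite}) ^ (CARD('k) ^ j) = to_ac x"
proof -
  have "x ^ (CARD('k) ^ j) = x"
    by (induction j) (simp_all add: power_mult mult.commute finite_field_power_card)
  thus ?thesis by (metis to_ac_power)
qed

text \<open>The subfield with q^m elements when m > 0; for m = 0 it is the whole closure, which
  suits the base case of Euclid's algorithm.\<close>

definition frob_fixed :: "nat \<Rightarrow> 'k::{field,finite} alg_closure set" where
  "frob_fixed m = {x. x ^ (CARD('k) ^ m) = x}"

lemma frobenius_inj:
  fixes x y :: "'k::{field,finite} alg_closure"
  assumes "x ^ (CARD('k) ^ j) = y ^ (CARD('k) ^ j)"
  shows "x = y"
proof -
  have "((x - y) + y) ^ (CARD('k) ^ j) = (x - y) ^ (CARD('k) ^ j) + y ^ (CARD('k) ^ j)"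
    by (rule frobenius_add)
  with assms have "(x - y) ^ (CARD('k) ^ j) = 0" by simp
  thus ?thesis by simp
qed

lemma card_power_eq_le:
  fixes c :: "'a::idom"
  assumes "m > 0"
  shows "finite {x. x ^ m = c}" "card {x. x ^ m = c} \<le> m"
proof -
  let ?p = "Polynomial.monom 1 m + [:-c:]"
  have deg: "Polynomial.degree ?p = m"
    using assms by (subst degree_add_eq_left) (auto simp: Polynomial.degree_monom_eq)
  hence "?p \<noteq> 0" using assms by auto
  moreover have "{x. x ^ m = c} = {x. poly ?p x = 0}" by (auto simp: poly_monom)
  ultimately show "finite {x. x ^ m = c}" "card {x. x ^ m = c} \<le> m"
    using poly_roots_finite[of ?p] card_poly_roots_bound[of ?p] deg by auto
qed

lemma card_gt_1_field: "CARD('k::{field,finite}) > 1"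
proof -
  have "card {0, 1::'k} \<le> CARD('k)" by (rule card_mono) auto
  thus ?thesis by simp
qed

lemma frob_fixed_poly:
  fixes m :: nat
  assumes m: "m > 0"
  defines "p \<equiv> Polynomial.monom (1::'k::{field,finite} alg_closure) (CARD('k) ^ m) - Polynomial.monom 1 1"
  shows "frob_fixed m = {x. poly p x = 0}" and "Polynomial.degree p = CARD('k) ^ m"
    and "p \<noteq> 0"
proof -
  have "CARD('k) > 1" by (rule card_gt_1_field)
  hence "CARD('k) ^ m > 1" using m by (metis one_less_power)
  thus deg: "Polynomial.degree p = CARD('k) ^ m"
    unfolding p_def diff_conv_add_uminus
    by (subst degree_add_eq_left) (auto simp: Polynomial.degree_monom_eq)
  show "p \<noteq> 0" using deg \<open>CARD('k) ^ m > 1\<close> by auto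
  show "frob_fixed m = {x. poly p x = 0}" by (auto simp: frob_fixed_def p_def poly_monom)
qed

lemma finite_frob_fixed: "m > 0 \<Longrightarrow> finite (frob_fixed m)"
  using frob_fixed_poly poly_roots_finite by metis

lemma card_frob_fixed_le: "m > 0 \<Longrightarrow> card (frob_fixed m :: 'k::{field,finite} alg_closure set) \<le> CARD('k) ^ m"
  using frob_fixed_poly card_poly_roots_bound by metis

text \<open>The closure splits X^(q^m) - X, and the derivative is the constant -1 because q^m = 0 in
  characteristic p, so all q^m roots are simple.\<close>

lemma card_frob_fixed:
  assumes m: "m > 0"
  shows "card (frob_fixed m :: 'k::{field,finite} alg_closure set) = CARD('k) ^ m"
proof -
  define p where "p = Polynomial.monom (1::'k alg_closure) (CARD('k) ^ m) - Polynomial.monom 1 1"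
  note P = frob_fixed_poly[OF m, where 'k='k, folded p_def]
  obtain e where e: "CARD('k) = CHAR('k) ^ e" using card_finite_field by blast
  have "e \<noteq> 0" using card_gt_1_field[where 'k='k] e by (cases e) auto
  hence "CHAR('k) dvd CARD('k) ^ m" using m e by (cases e; cases m) auto
  hence z: "(of_nat (CARD('k) ^ m) :: 'k alg_closure) = 0"
    by (subst of_nat_eq_0_iff_char_dvd) simp
  have "pderiv p = -1"
    using z by (simp add: p_def pderiv_diff pderiv_monom monom_0 one_pCons del: of_nat_power)
  have sf: "Polynomial.order a p = 1" if "poly p a = 0" for a
  proof (rule ccontr)
    assume "Polynomial.order a p \<noteq> 1"
    moreover have "Polynomial.order a p \<noteq> 0" using that P(3) by (simp add: order_root)
    ultimately have "2 \<le> Polynomial.order a p" by linarith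
    hence "[:-a, 1:] ^ 2 dvd p" by (metis order_1 power_le_dvd)
    then obtain r where "p = [:-a, 1:] ^ 2 * r" by (elim dvdE)
    hence r: "p = [:-a, 1:] * ([:-a, 1:] * r)" by (simp only: power2_eq_square mult.assoc)
    have "poly (pderiv p) a = 0" unfolding r pderiv_mult poly_add poly_mult by simp
    with \<open>pderiv p = -1\<close> show False by simp
  qed
  obtain A where A: "size A = Polynomial.degree p" "p = Polynomial.smult (Polynomial.lead_coeff p) (\<Prod>x\<in>#A. [:-x, 1:])"
    using alg_closed_imp_factorization[OF P(3)] by blast
  have "proots p = proots (\<Prod>x\<in>#A. [:-x, 1:])"
    using A(2) P(3) by (metis leading_coeff_0_iff proots_smult)
  also have "\<dots> = A"
  proof (induction A)
    case (add x A)
    have "(\<Prod>x\<in>#A. [:-x, 1:]) \<noteq> 0" by (auto simp: prod_mset_zero_iff)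
    hence "proots ([:-x, 1:] * (\<Prod>x\<in>#A. [:-x, 1:])) = {#x#} + A"
      by (subst proots_mult) (auto simp: add.IH)
    thus ?case by simp
  qed simp
  finally have "size (proots p) = Polynomial.degree p" using A(1) by simp
  moreover have "size (proots p) = (\<Sum>x\<in>(frob_fixed m :: 'k alg_closure set). 1)"
    unfolding size_multiset_overloaded_eq using P(1,3) sf
    by (intro sum.cong) auto
  ultimately show ?thesis using P(2) by simp
qed

text \<open>Euclid's algorithm on the exponents: an element fixed by the n-th Frobenius power is
  fixed by its multiples, so m may be reduced modulo n.\<close>

lemma frob_fixed_gcd:
  fixes h :: "'k::{field,finite} alg_closure"
  assumes "h \<in> frob_fixed a" "h \<in> frob_fixed b"
  shows "h \<in> frob_fixed (gcd a b)"
  using assms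
proof (induction a b rule: gcd_nat_induct)
  case (step m n)
  have *: "h ^ (CARD('k) ^ (n * j)) = h" for j
    using step.prems(2) by (induction j) (simp_all add: power_add power_mult frob_fixed_def)
  have "h ^ (CARD('k) ^ m) = h ^ (CARD('k) ^ (n * (m div n)) * CARD('k) ^ (m mod n))"
    by (metis mult_div_mod_eq power_add)
  also have "\<dots> = h ^ (CARD('k) ^ (m mod n))" by (subst power_mult) (simp only: *)
  finally have "h \<in> frob_fixed (m mod n)" using step.prems(1) by (simp add: frob_fixed_def)
  with step show ?case by (simp add: gcd_red_nat[of m n])
qed simp

lemma frob_fixed_closed:
  "x \<in> frob_fixed m \<Longrightarrow> y \<in> frob_fixed m \<Longrightarrow> x + y \<in> frob_fixed m"
  "x \<in> frob_fixed m \<Longrightarrow> y \<in> frob_fixed m \<Longrightarrow> x * y \<in> frob_fixed m"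
  "x \<in> frob_fixed m \<Longrightarrow> y \<in> frob_fixed m \<Longrightarrow> x / y \<in> frob_fixed m"
  "0 \<in> frob_fixed m" "1 \<in> frob_fixed m" "to_ac c \<in> frob_fixed m"
  by (auto simp: frob_fixed_def frobenius_add power_mult_distrib power_divide frobenius_to_ac)

lemma frob_fixed_sum: "(\<And>i. i \<in> A \<Longrightarrow> f i \<in> frob_fixed m) \<Longrightarrow> sum f A \<in> frob_fixed m"
  by (induction A rule: infinite_finite_induct) (auto simp: frob_fixed_closed)

text \<open>Greedy choice by counting: fewer than n elements span at most q^(n-1) < q^n elements, so
  the field contains one outside their span.\<close>

lemma extension_basis_exists:
  "\<exists>b :: 'n::finite \<Rightarrow> 'k::{field,finite} alg_closure. (\<forall>i. b i \<in> frob_fixed CARD('n)) \<and>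
     (\<forall>c. (\<Sum>i\<in>UNIV. to_ac (c i) * b i) = 0 \<longrightarrow> (\<forall>i. c i = 0))"
proof -
  define good :: "'n set \<Rightarrow> ('n \<Rightarrow> 'k alg_closure) \<Rightarrow> bool" where
    "good J b \<longleftrightarrow> (\<forall>i\<in>J. b i \<in> frob_fixed CARD('n)) \<and>
       (\<forall>c. (\<Sum>i\<in>J. to_ac (c i) * b i) = 0 \<longrightarrow> (\<forall>i\<in>J. c i = 0))" for J b
  have "\<exists>b. good J b" if "finite J" for J
    using that
  proof (induction J rule: finite_induct)
    case empty
    show ?case by (auto simp: good_def)
  next
    case (insert i J)
    note 2 = insert.hyps
    from insert.IH obtain b where "good J b" by blast
    hence b: "\<forall>i\<in>J. b i \<in> frob_fixed CARD('n)"
      and b2: "(\<Sum>i\<in>J. to_ac (c i) * b i) = 0 \<Longrightarrow> \<forall>i\<in>J. c i = 0" for c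
      unfolding good_def by auto
    define S where "S = (\<lambda>c. \<Sum>i\<in>J. to_ac (c i) * b i) ` (PiE J (\<lambda>_. UNIV :: 'k set))"
    have "card S \<le> card (PiE J (\<lambda>_. UNIV :: 'k set))"
      unfolding S_def by (rule card_image_le) (simp add: finite_PiE)
    also have "\<dots> = CARD('k) ^ card J" by (simp add: card_PiE)
    also have "card J < CARD('n)"
      using 2(2) by (metis UNIV_I finite psubset_card_mono psubsetI subset_UNIV)
    hence "CARD('k) ^ card J < CARD('k) ^ CARD('n)"
      by (intro power_strict_increasing) (use card_gt_1_field in auto)
    also have "\<dots> = card (frob_fixed CARD('n) :: 'k alg_closure set)" by (simp add: card_frob_fixed)
    finally have "\<not> frob_fixed CARD('n) \<subseteq> S"
      using card_mono[of S "frob_fixed CARD('n)"] by (auto simp: S_def finite_PiE)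
    then obtain x where x: "x \<in> frob_fixed CARD('n)" "x \<notin> S" by auto
    have xS: "x \<noteq> (\<Sum>i\<in>J. to_ac (c i) * b i)" for c
    proof
      assume "x = (\<Sum>i\<in>J. to_ac (c i) * b i)"
      also have "\<dots> = (\<Sum>i\<in>J. to_ac (restrict c J i) * b i)" by (intro sum.cong) auto
      also have "\<dots> \<in> S" unfolding S_def by (rule imageI) auto
      finally show False using x by simp
    qed
    show ?case
      unfolding good_def
    proof (rule exI[of _ "b(i := x)"], intro conjI allI impI)
      show "\<forall>j\<in>insert i J. (b(i := x)) j \<in> frob_fixed CARD('n)" using b x(1) by auto
    next
      fix c :: "'n \<Rightarrow> 'k" assume "(\<Sum>j\<in>insert i J. to_ac (c j) * (b(i := x)) j) = 0"
      moreover have "(\<Sum>j\<in>J. to_ac (c j) * (b(i := x)) j) = (\<Sum>j\<in>J. to_ac (c j) * b j)"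
        using 2 by (intro sum.cong) auto
      ultimately have eq: "to_ac (c i) * x + (\<Sum>j\<in>J. to_ac (c j) * b j) = 0"
        using 2 by simp
      have ci: "c i = 0"
      proof (rule ccontr)
        assume ci: "c i \<noteq> 0"
        have "(\<Sum>j\<in>J. to_ac (- c j / c i) * b j) = - (\<Sum>j\<in>J. to_ac (c j) * b j) / to_ac (c i)"
          by (simp add: sum_divide_distrib sum_negf)
        also have "\<dots> = x" using eq ci by (metis add_eq_0_iff2 eq_divide_imp mult.commute to_ac_eq_0_iff add.inverse_inverse add_eq_0_iff)
        finally show False using xS by metis
      qed
      with eq b2[of c] show "\<forall>j\<in>insert i J. c j = 0" by simp
    qed
  qed
  from this[of UNIV] show ?thesis by (auto simp: good_def)
qed

section \<open>Singer cycles\<close>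

locale extension_basis =
  fixes b :: "'n::finite \<Rightarrow> 'k::{field,finite} alg_closure"
  assumes b_mem: "b i \<in> frob_fixed CARD('n)"
    and indep: "(\<Sum>i\<in>UNIV. to_ac (c i) * b i) = 0 \<Longrightarrow> c i = 0"
begin

text \<open>The identification of K^n with the field of q^n elements given by the basis
  \<open>b\<close>.\<close>

definition phi :: "'k ^ 'n \<Rightarrow> 'k alg_closure" where
  "phi v = (\<Sum>i\<in>UNIV. to_ac (v $ i) * b i)"

lemma phi_add: "phi (u + v) = phi u + phi v"
  by (simp add: phi_def algebra_simps sum.distrib)

lemma phi_diff: "phi (u - v) = phi u - phi v"
  by (simp add: phi_def algebra_simps sum_subtractf)

lemma phi_0 [simp]: "phi 0 = 0"
  by (simp add: phi_def)

lemma phi_eq_0: "phi v = 0 \<longleftrightarrow> v = 0"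
  using indep[of "\<lambda>i. v $ i"] by (auto simp: phi_def vec_eq_iff)

lemma inj_phi: "inj phi"
  by (metis eq_iff_diff_eq_0 injI phi_diff phi_eq_0)

definition FF :: "'k alg_closure set" where
  "FF = range phi"

lemma FF_eq: "FF = frob_fixed CARD('n)"
  unfolding FF_def
proof (rule card_subset_eq)
  show "finite (frob_fixed CARD('n) :: 'k alg_closure set)" by (simp add: finite_frob_fixed)
  show "range phi \<subseteq> frob_fixed CARD('n)"
    by (auto simp: phi_def intro!: frob_fixed_sum frob_fixed_closed b_mem)
  show "card (range phi) = card (frob_fixed CARD('n) :: 'k alg_closure set)"
    by (simp add: card_image[OF inj_phi] card_frob_fixed)
qed

lemma FF_closed:
  "x \<in> FF \<Longrightarrow> y \<in> FF \<Longrightarrow> x + y \<in> FF"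
  "x \<in> FF \<Longrightarrow> y \<in> FF \<Longrightarrow> x * y \<in> FF"
  "x \<in> FF \<Longrightarrow> y \<in> FF \<Longrightarrow> x / y \<in> FF"
  "0 \<in> FF" "1 \<in> FF" "b i \<in> FF"
  unfolding FF_eq by (auto intro: frob_fixed_closed b_mem)

lemma finite_FF: "finite FF"
  by (simp add: FF_eq finite_frob_fixed)

lemma card_FF: "card FF = CARD('k) ^ CARD('n)"
  by (simp add: FF_eq card_frob_fixed)

lemma phi_mem: "phi v \<in> FF"
  by (simp add: FF_def)

definition phi_inv :: "'k alg_closure \<Rightarrow> 'k ^ 'n" where
  "phi_inv = inv_into UNIV phi"

lemma phi_phi_inv: "x \<in> FF \<Longrightarrow> phi (phi_inv x) = x"
  unfolding FF_def phi_inv_def by (rule f_inv_into_f)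

text \<open>Multiplication by \<open>h\<close> as a matrix in the basis \<open>b\<close>.\<close>

definition mm :: "'k alg_closure \<Rightarrow> 'k ^ 'n ^ 'n" where
  "mm h = (\<chi> i j. phi_inv (h * b j) $ i)"

lemma mm_column:
  assumes "h \<in> FF"
  shows "(\<Sum>i\<in>UNIV. to_ac (mm h $ i $ j) * b i) = h * b j"
  using phi_phi_inv[of "h * b j"] assms
  by (simp add: phi_def mm_def FF_closed)

lemma phi_mm:
  assumes "h \<in> FF"
  shows "phi (mm h *v v) = h * phi v"
proof -
  have "phi (mm h *v v) = (\<Sum>i\<in>UNIV. \<Sum>j\<in>UNIV. to_ac (mm h $ i $ j) * to_ac (v $ j) * b i)"
    by (simp add: phi_def matrix_vector_mult_def to_ac_sum sum_distrib_right)
  also have "\<dots> = (\<Sum>j\<in>UNIV. to_ac (v $ j) * (\<Sum>i\<in>UNIV. to_ac (mm h $ i $ j) * b i))"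
    by (subst sum.swap) (simp add: sum_distrib_left mult_ac)
  also have "\<dots> = h * phi v"
    unfolding mm_column[OF assms] phi_def sum_distrib_left by (simp add: mult_ac)
  finally show ?thesis .
qed

lemma matrix_eqI_phi:
  assumes "\<And>v. phi (A *v v) = phi (B *v v)"
  shows "A = (B :: 'k ^ 'n ^ 'n)"
  using assms inj_phi by (metis injD matrix_eq)

lemma mm_mult: "h \<in> FF \<Longrightarrow> h' \<in> FF \<Longrightarrow> mm (h * h') = mm h ** mm h'"
  by (rule matrix_eqI_phi) (simp add: phi_mm FF_closed flip: matrix_vector_mul_assoc)

lemma mm_add: "h \<in> FF \<Longrightarrow> h' \<in> FF \<Longrightarrow> mm (h + h') = mm h + mm h'"
  by (rule matrix_eqI_phi)
     (simp add: phi_mm FF_closed matrix_vector_mult_add_rdistrib phi_add algebra_simps)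

lemma mm_1: "mm 1 = mat 1"
  by (rule matrix_eqI_phi) (simp add: phi_mm FF_closed)

lemma invertible_mm:
  assumes "h \<in> FF" "h \<noteq> 0"
  shows "invertible (mm h)"
proof -
  have i: "1 / h \<in> FF" using assms by (intro FF_closed)
  hence "mm h ** mm (1 / h) = mat 1" "mm (1 / h) ** mm h = mat 1"
    using assms mm_mult[of h "1 / h"] mm_mult[of "1 / h" h] by (auto simp: mm_1)
  thus ?thesis unfolding invertible_def by blast
qed

section \<open>Simultaneous diagonalisation of the multiplication matrices over the closure\<close>

definition emb :: "'k ^ 'n ^ 'n \<Rightarrow> 'k alg_closure ^ 'n ^ 'n" where
  "emb A = (\<chi> i j. to_ac (A $ i $ j))"

lemma emb_mult: "emb (A ** B) = emb A ** emb B"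
  by (simp add: emb_def matrix_matrix_mult_def vec_eq_iff to_ac_sum)

lemma det_emb: "det (emb A) = to_ac (det A)"
  by (simp add: det_def emb_def to_ac_sum to_ac_prod)

definition idx :: "'n \<Rightarrow> nat" where
  "idx = (SOME f. bij_betw f UNIV {0..<CARD('n)})"

lemma bij_idx: "bij_betw idx UNIV {0..<CARD('n)}"
  unfolding idx_def using someI_ex[OF ex_bij_betw_finite_nat[OF finite]] .

lemma idx_less: "idx i < CARD('n)"
  using bij_idx by (auto simp: bij_betw_def)

lemma inj_idx: "idx i = idx j \<longleftrightarrow> i = j"
  using bij_idx by (auto simp: bij_betw_def inj_on_def)

lemma idx_0: "\<exists>i. idx i = 0"
  using bij_idx zero_less_card_finite[where 'a='n] by (metis atLeastLessThan_iff bij_betw_def image_iff le0)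

text \<open>The Moore matrix of the basis; its rows are simultaneous left eigenvectors of all \<open>mm h\<close>.\<close>

definition moore :: "'k alg_closure ^ 'n ^ 'n" where
  "moore = (\<chi> i j. b j ^ (CARD('k) ^ idx i))"

definition conj_diag :: "'k alg_closure \<Rightarrow> 'k alg_closure ^ 'n ^ 'n" where
  "conj_diag h = (\<chi> i j. if i = j then h ^ (CARD('k) ^ idx i) else 0)"

text \<open>The q^i-th power of the column relation \<open>mm_column\<close> leaves the entries of
  \<open>mm h\<close> unchanged, as they lie in K; this is one row of the identity.\<close>

lemma moore_mm:
  assumes "h \<in> FF"
  shows "moore ** emb (mm h) = conj_diag h ** moore"
proof -
  have "(\<Sum>l\<in>UNIV. b l ^ (CARD('k) ^ i) * to_ac (mm h $ l $ j)) = (h * b j) ^ (CARD('k) ^ i)" for i j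
  proof -
    have "(h * b j) ^ (CARD('k) ^ i) = (\<Sum>l\<in>UNIV. to_ac (mm h $ l $ j) * b l) ^ (CARD('k) ^ i)"
      by (simp add: mm_column assms)
    also have "\<dots> = (\<Sum>l\<in>UNIV. b l ^ (CARD('k) ^ i) * to_ac (mm h $ l $ j))"
      unfolding frobenius_sum power_mult_distrib frobenius_to_ac by (simp add: mult.commute)
    finally show ?thesis by simp
  qed
  thus ?thesis
    by (simp add: moore_def emb_def conj_diag_def matrix_matrix_mult_def vec_eq_iff
        power_mult_distrib if_distrib[of "\<lambda>x. x * y" for y] cong: if_cong)
qed

text \<open>A kernel vector of the transpose gives a q-polynomial that vanishes on the basis and,
  being K-linear, on all q^n field elements, although its degree is at most q^(n-1).\<close>

lemma det_moore: "det moore \<noteq> 0"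
proof -
  have ker: "c = 0" if c: "transpose moore *v c = 0" for c :: "'k alg_closure ^ 'n"
  proof -
    define p where "p = (\<Sum>i\<in>UNIV. Polynomial.monom (c $ i) (CARD('k) ^ idx i))"
    have root: "poly p x = 0" if x: "x \<in> FF" for x
    proof -
      obtain v where v: "x = phi v" using x unfolding FF_def by blast
      have "poly p x = (\<Sum>i\<in>UNIV. c $ i * (\<Sum>j\<in>UNIV. to_ac (v $ j) * b j ^ (CARD('k) ^ idx i)))"
        by (simp add: p_def poly_sum poly_monom v phi_def frobenius_sum power_mult_distrib frobenius_to_ac)
      also have "\<dots> = (\<Sum>j\<in>UNIV. to_ac (v $ j) * (\<Sum>i\<in>UNIV. b j ^ (CARD('k) ^ idx i) * c $ i))"
        unfolding sum_distrib_left by (subst sum.swap) (simp add: mult_ac)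
      also have "\<dots> = 0"
      proof -
        have "(\<Sum>i\<in>UNIV. b j ^ (CARD('k) ^ idx i) * c $ i) = 0" for j
          using c by (simp add: vec_eq_iff matrix_vector_mult_def transpose_def moore_def)
        thus ?thesis by simp
      qed
      finally show ?thesis .
    qed
    have "p = 0"
    proof (rule ccontr)
      assume p0: "p \<noteq> 0"
      have "Polynomial.degree p \<le> CARD('k) ^ (CARD('n) - 1)" unfolding p_def
      proof (intro degree_sum_le)
        fix i :: 'n
        have "Polynomial.degree (Polynomial.monom (c $ i) (CARD('k) ^ idx i)) \<le> CARD('k) ^ idx i"
          by (rule Polynomial.degree_monom_le)
        also have "\<dots> \<le> CARD('k) ^ (CARD('n) - 1)"
          using idx_less[of i] by (intro power_increasing) auto
        finally show "Polynomial.degree (Polynomial.monom (c $ i) (CARD('k) ^ idx i)) \<le> CARD('k) ^ (CARD('n) - 1)" .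
      qed auto
      also have "\<dots> < CARD('k) ^ CARD('n)"
        by (intro power_strict_increasing) (use card_gt_1_field in auto)
      also have "\<dots> = card FF" by (simp add: card_FF)
      also have "\<dots> \<le> card {x. poly p x = 0}"
        by (intro card_mono) (use root poly_roots_finite[OF p0] in auto)
      also have "\<dots> \<le> Polynomial.degree p" by (rule card_poly_roots_bound[OF p0])
      finally show False by simp
    qed
    have "c $ i = 0" for i
    proof -
      have "0 = Polynomial.coeff p (CARD('k) ^ idx i)" using \<open>p = 0\<close> by simp
      also have "\<dots> = (\<Sum>j\<in>UNIV. if j = i then c $ j else 0)"
        unfolding p_def coeff_sum coeff_monom
      proof (intro sum.cong refl)
        fix j
        have "CARD('k) ^ idx j = CARD('k) ^ idx i \<longleftrightarrow> j = i"
          using card_gt_1_field[where 'k='k] by (simp add: inj_idx)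
        thus "(if CARD('k) ^ idx j = CARD('k) ^ idx i then c $ j else 0) = (if j = i then c $ j else 0)"
          by simp
      qed
      finally show ?thesis by simp
    qed
    thus "c = 0" by (simp add: vec_eq_iff)
  qed
  hence "\<exists>B. B ** transpose moore = mat 1"
    by (subst matrix_left_invertible_ker) blast
  hence "invertible (transpose moore)" by (simp add: invertible_left_inverse)
  thus ?thesis by (simp add: invertible_det_nz)
qed

lemma det_conj_diag_shift: "det (conj_diag h - mat x) = (\<Prod>i<CARD('n). h ^ (CARD('k) ^ i) - x)"
proof -
  have "det (conj_diag h - mat x) = (\<Prod>i\<in>UNIV. h ^ (CARD('k) ^ idx i) - x)"
    by (subst det_diagonal) (auto simp: conj_diag_def mat_def)
  also have "\<dots> = (\<Prod>i\<in>{0..<CARD('n)}. h ^ (CARD('k) ^ i) - x)"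
    by (rule prod.reindex_bij_betw[OF bij_idx])
  finally show ?thesis by (simp add: atLeast0LessThan)
qed

lemma matrix_diff_distrib:
  fixes A :: "'a::comm_ring_1 ^ 'm::finite ^ 'l::finite"
  shows "A ** (B - C) = A ** B - A ** C" "(A - A') ** B = A ** B - A' ** B"
  by (simp_all add: matrix_matrix_mult_def vec_eq_iff right_diff_distrib left_diff_distrib sum_subtractf)

text \<open>The Moore matrix conjugates \<open>mm h\<close> into \<open>conj_diag h\<close>, so the
  eigenvalues are the Frobenius conjugates of \<open>h\<close>.\<close>

lemma det_mm_shift:
  assumes "h \<in> FF"
  shows "det (emb (mm h) - mat x) = (\<Prod>i<CARD('n). h ^ (CARD('k) ^ i) - x)"
proof -
  have "mat x ** moore = moore ** mat x"
    by (simp add: matrix_matrix_mult_def mat_def vec_eq_iff if_distrib[of "\<lambda>x. x * y" for y]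
        if_distrib[of "\<lambda>x. y * x" for y] mult.commute cong: if_cong)
  hence "moore ** (emb (mm h) - mat x) = (conj_diag h - mat x) ** moore"
    by (simp add: matrix_diff_distrib moore_mm assms)
  hence "det moore * det (emb (mm h) - mat x) = det (conj_diag h - mat x) * det moore"
    by (metis det_mul)
  thus ?thesis using det_moore by (simp add: det_conj_diag_shift)
qed

text \<open>This is the field norm; written as a single power of \<open>h\<close>, its fibres become
  root sets of X^M = c.\<close>

lemma det_mm:
  assumes "h \<in> FF"
  shows "to_ac (det (mm h)) = h ^ (\<Sum>i<CARD('n). CARD('k) ^ i)"
proof -
  have "to_ac (det (mm h)) = det (emb (mm h) - mat 0)" by (simp add: det_emb mat_def zero_vec_def[symmetric] vec_eq_iff)
  also have "\<dots> = (\<Prod>i<CARD('n). h ^ (CARD('k) ^ i))" by (simp only: det_mm_shift[OF assms]) simp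
  finally show ?thesis by (simp add: power_sum)
qed

section \<open>Regular elements (nonzero generators of the field over K), centralizers and
  counts\<close>

definition regular :: "'k alg_closure \<Rightarrow> bool" where
  "regular h \<longleftrightarrow> h \<in> FF \<and> h \<noteq> 0 \<and> (\<forall>d. 0 < d \<and> d < CARD('n) \<longrightarrow> h \<notin> frob_fixed d)"

text \<open>Cancelling the injective map x -> x^(q^i) from a coincidence puts \<open>h\<close> into
  \<open>frob_fixed (j - i)\<close> with 0 < j - i < n.\<close>

lemma regular_conj_distinct:
  assumes "regular h" "h ^ (CARD('k) ^ i) = h ^ (CARD('k) ^ j)" "i < CARD('n)" "j < CARD('n)"
  shows "i = j"
proof -
  have *: "\<not> i < j" if "h ^ (CARD('k) ^ i) = h ^ (CARD('k) ^ j)" "j < CARD('n)" for i j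
  proof
    assume ij: "i < j"
    have "h ^ (CARD('k) ^ i) = (h ^ (CARD('k) ^ (j - i))) ^ (CARD('k) ^ i)"
      using that(1) ij by (simp flip: power_mult power_add)
    hence "h = h ^ (CARD('k) ^ (j - i))" by (rule frobenius_inj)
    hence "h \<in> frob_fixed (j - i)" by (simp add: frob_fixed_def)
    thus False using assms(1) ij that(2) by (auto simp: regular_def)
  qed
  show ?thesis using *[of i j] *[of j i] assms by simp
qed

text \<open>In the Moore coordinates \<open>mm h\<close> is diagonal with distinct entries, so every
  matrix commuting with it is diagonal there too.\<close>

lemma regular_centralizer:
  assumes h: "regular h" and comm: "mm h ** U = U ** mm h"
  shows "\<exists>y. \<forall>v. phi (U *v v) = y * phi v"
proof -
  have hF: "h \<in> FF" using h by (simp add: regular_def)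
  obtain W' where W': "moore ** W' = mat 1" "W' ** moore = mat 1"
    using det_moore by (metis invertible_det_nz invertible_def)
  define Y where "Y = moore ** emb U ** W'"
  have YW: "Y ** moore = moore ** emb U"
    by (simp add: Y_def W' flip: matrix_mul_assoc)
  have "conj_diag h ** Y = moore ** emb (mm h) ** emb U ** W'"
    by (simp add: Y_def matrix_mul_assoc moore_mm hF)
  also have "\<dots> = moore ** (emb (mm h) ** emb U) ** W'" by (simp add: matrix_mul_assoc)
  also have "\<dots> = moore ** (emb U ** emb (mm h)) ** W'" by (metis comm emb_mult)
  also have "\<dots> = Y ** moore ** emb (mm h) ** W'" by (simp add: YW matrix_mul_assoc)
  also have "\<dots> = Y ** (conj_diag h ** moore) ** W'" by (simp add: moore_mm hF flip: matrix_mul_assoc)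
  also have "\<dots> = Y ** conj_diag h" by (simp add: W' flip: matrix_mul_assoc)
  finally have DY: "conj_diag h ** Y = Y ** conj_diag h" .
  have off: "Y $ i $ j = 0" if "i \<noteq> j" for i j
  proof -
    have "(conj_diag h ** Y) $ i $ j = h ^ (CARD('k) ^ idx i) * Y $ i $ j"
      by (simp add: conj_diag_def matrix_matrix_mult_def if_distrib[of "\<lambda>x. x * y" for y] cong: if_cong)
    moreover have "(Y ** conj_diag h) $ i $ j = Y $ i $ j * h ^ (CARD('k) ^ idx j)"
      by (simp add: conj_diag_def matrix_matrix_mult_def if_distrib[of "\<lambda>x. y * x" for y] cong: if_cong)
    ultimately have "Y $ i $ j * h ^ (CARD('k) ^ idx i) = Y $ i $ j * h ^ (CARD('k) ^ idx j)"
      using DY by (metis mult.commute)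
    moreover have "h ^ (CARD('k) ^ idx i) \<noteq> h ^ (CARD('k) ^ idx j)"
      using regular_conj_distinct[OF h _ idx_less idx_less] that inj_idx by blast
    ultimately show ?thesis by simp
  qed
  \<comment> \<open>The Moore row with exponent q^0 is the basis itself, so its diagonal entry is
    the field element by which \<open>U\<close> multiplies.\<close>
  obtain i where i: "idx i = 0" using idx_0 by blast
  have row: "(\<Sum>l\<in>UNIV. b l * to_ac (U $ l $ j)) = Y $ i $ i * b j" for j
  proof -
    have "(\<Sum>l\<in>UNIV. b l * to_ac (U $ l $ j)) = (moore ** emb U) $ i $ j"
      by (simp add: moore_def emb_def matrix_matrix_mult_def i)
    also have "\<dots> = (\<Sum>l\<in>UNIV. Y $ i $ l * moore $ l $ j)"
      unfolding YW[symmetric] by (simp add: matrix_matrix_mult_def)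
    also have "\<dots> = (\<Sum>l\<in>UNIV. if l = i then Y $ i $ i * moore $ i $ j else 0)"
      by (intro sum.cong) (auto simp: off)
    also have "\<dots> = Y $ i $ i * b j" by (simp add: moore_def i)
    finally show ?thesis .
  qed
  have "phi (U *v v) = Y $ i $ i * phi v" for v
  proof -
    have "phi (U *v v) = (\<Sum>l\<in>UNIV. \<Sum>j\<in>UNIV. to_ac (U $ l $ j) * to_ac (v $ j) * b l)"
      by (simp add: phi_def matrix_vector_mult_def to_ac_sum sum_distrib_right)
    also have "\<dots> = (\<Sum>j\<in>UNIV. to_ac (v $ j) * (\<Sum>l\<in>UNIV. b l * to_ac (U $ l $ j)))"
      by (subst sum.swap) (simp add: sum_distrib_left mult_ac)
    also have "\<dots> = Y $ i $ i * phi v"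
      by (simp add: row phi_def sum_distrib_left mult_ac)
    finally show ?thesis .
  qed
  thus ?thesis by blast
qed

text \<open>Evaluating at the vector \<open>e\<close> that represents 1 recovers the multiplier, so
  the centralizer embeds into the nonzero field elements.\<close>

lemma card_regular_centralizer:
  assumes h: "regular h"
  shows "card {U. invertible U \<and> mm h ** U = U ** mm h} \<le> CARD('k) ^ CARD('n) - 1"
proof -
  define S where "S = {U. invertible U \<and> mm h ** U = U ** mm h}"
  define e where "e = phi_inv 1"
  have e: "phi e = 1" unfolding e_def by (rule phi_phi_inv) (rule FF_closed)
  have S: "phi (U *v v) = phi (U *v e) * phi v" if "U \<in> S" for U v
  proof -
    have "mm h ** U = U ** mm h" using that by (simp add: S_def)
    from regular_centralizer[OF h this] obtain y where y: "\<forall>v. phi (U *v v) = y * phi v" by blast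
    show ?thesis using y[rule_format, of e] y[rule_format, of v] e by simp
  qed
  have "inj_on (\<lambda>U. phi (U *v e)) S"
    by (rule inj_onI) (metis S matrix_eqI_phi)
  moreover have "(\<lambda>U. phi (U *v e)) ` S \<subseteq> FF - {0}"
  proof clarify
    fix U assume U: "U \<in> S"
    have "phi (U *v e) \<noteq> 0"
    proof
      assume "phi (U *v e) = 0"
      hence "U *v e = 0" by (simp add: phi_eq_0)
      moreover from U obtain U' where "U' ** U = mat 1" unfolding S_def invertible_def by blast
      ultimately have "e = 0"
        by (metis matrix_vector_mul_assoc matrix_vector_mul_lid matrix_vector_mult_0_right)
      thus False using e by simp
    qed
    thus "phi (U *v e) \<in> FF - {0}" by (simp add: phi_mem)
  qed
  ultimately have "card S \<le> card (FF - {0})"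
    by (intro card_inj_on_le) (auto simp: finite_FF)
  also have "\<dots> = CARD('k) ^ CARD('n) - 1"
    by (simp add: finite_FF FF_closed card_FF)
  finally show ?thesis by (simp add: S_def)
qed

text \<open>Similarity to \<open>Z\<close> determines the eigenvalues and leaves at most n
  conjugates for \<open>h\<close>; for each of them the matrices \<open>P\<close> lie in one coset
  of the centralizer of \<open>mm h\<close>. This count becomes the density bound
  \<open>nu_le\<close>.\<close>

lemma card_regular_pairs:
  fixes Z :: "'k ^ 'n ^ 'n"
  shows "card {(P, h). invertible P \<and> regular h \<and> mm h ** P = P ** Z} \<le> CARD('n) * (CARD('k) ^ CARD('n) - 1)"
proof (cases "{(P, h). invertible P \<and> regular h \<and> mm h ** P = P ** Z} = {}")
  case True
  show ?thesis unfolding True by simp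
next
  case False
  then obtain P0 h0 where 0: "invertible P0" "regular h0" "mm h0 ** P0 = P0 ** Z" by auto
  define Q where "Q h = {P. invertible P \<and> mm h ** P = P ** Z}" for h
  define C where "C = (\<lambda>i. h0 ^ (CARD('k) ^ i)) ` {..<CARD('n)}"
  have conj: "h \<in> C" if P: "invertible P" "regular h" "mm h ** P = P ** Z" for P h
  proof -
    obtain P' where P': "P' ** P = mat 1" "P ** P' = mat 1" using P by (auto simp: invertible_def)
    obtain P0' where P0': "P0' ** P0 = mat 1" "P0 ** P0' = mat 1" using 0 by (auto simp: invertible_def)
    define T where "T = P0 ** P'"
    have "T ** mm h = P0 ** P' ** (mm h ** P) ** P'"
      by (simp add: T_def P' flip: matrix_mul_assoc)
    also have "\<dots> = P0 ** Z ** P'" unfolding P(3) by (metis P'(1) matrix_mul_assoc matrix_mul_lid)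
    also have "\<dots> = mm h0 ** T" by (simp add: T_def 0(3)[symmetric] matrix_mul_assoc)
    finally have T: "T ** mm h = mm h0 ** T" .
    \<comment> \<open>As \<open>h\<close> is an eigenvalue of \<open>mm h\<close>, similarity makes
      it an eigenvalue of \<open>mm h0\<close>, hence a conjugate of \<open>h0\<close>.\<close>
    have "emb T ** (emb (mm h) - mat h) = (emb (mm h0) - mat h) ** emb T"
    proof -
      have "mat h ** emb T = emb T ** mat h"
        by (simp add: matrix_matrix_mult_def mat_def vec_eq_iff if_distrib[of "\<lambda>x. x * y" for y]
            if_distrib[of "\<lambda>x. y * x" for y] mult.commute cong: if_cong)
      thus ?thesis by (simp add: matrix_diff_distrib T flip: emb_mult)
    qed
    hence "det (emb T) * det (emb (mm h) - mat h) = det (emb (mm h0) - mat h) * det (emb T)"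
      by (metis det_mul)
    moreover have "det (emb T) \<noteq> 0"
    proof -
      have "T ** (P ** P0') = mat 1" unfolding T_def by (metis P'(1) P0'(2) matrix_mul_assoc matrix_mul_lid)
      hence "det T * det (P ** P0') = 1" by (metis det_mul det_I)
      thus ?thesis by (auto simp: det_emb)
    qed
    moreover have "det (emb (mm h) - mat h) = 0"
      using det_mm_shift[of h h] P(2) by (auto simp: regular_def intro!: bexI[of _ 0])
    ultimately have "det (emb (mm h0) - mat h) = 0" by simp
    hence "\<exists>i<CARD('n). h0 ^ (CARD('k) ^ i) - h = 0"
      using det_mm_shift[of h0 h] 0(2) by (auto simp: regular_def)
    thus ?thesis by (auto simp: C_def)
  qed
  have Qle: "card (Q h) \<le> CARD('k) ^ CARD('n) - 1" if h: "regular h" for h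
  proof (cases "Q h = {}")
    case False
    then obtain P1 where P1: "invertible P1" "mm h ** P1 = P1 ** Z" by (auto simp: Q_def)
    then obtain P1' where P1': "P1' ** P1 = mat 1" "P1 ** P1' = mat 1" by (auto simp: invertible_def)
    have "card (Q h) \<le> card {U. invertible U \<and> mm h ** U = U ** mm h}"
    proof (rule card_inj_on_le[of "\<lambda>P. P ** P1'"])
      show "inj_on (\<lambda>P. P ** P1') (Q h)"
        by (rule inj_onI) (metis P1'(1) matrix_mul_assoc matrix_mul_rid)
      show "(\<lambda>P. P ** P1') ` Q h \<subseteq> {U. invertible U \<and> mm h ** U = U ** mm h}"
      proof clarify
        fix P assume P: "P \<in> Q h"
        have "invertible P1'" using P1' by (auto simp: invertible_def)
        hence "invertible (P ** P1')" using P by (intro invertible_mult) (auto simp: Q_def)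
        moreover have "mm h ** (P ** P1') = P ** P1' ** mm h"
        proof -
          have "mm h ** (P ** P1') = P ** Z ** P1'" using P by (simp add: Q_def matrix_mul_assoc)
          also have "\<dots> = P ** (P1' ** (P1 ** Z)) ** P1'" by (simp add: matrix_mul_assoc[of P1'] P1')
          also have "\<dots> = P ** P1' ** mm h ** (P1 ** P1')" by (simp add: P1(2)[symmetric] matrix_mul_assoc)
          finally show ?thesis by (simp add: P1')
        qed
        ultimately show "invertible (P ** P1') \<and> mm h ** (P ** P1') = P ** P1' ** mm h" by simp
      qed
    qed auto
    also have "\<dots> \<le> CARD('k) ^ CARD('n) - 1" by (rule card_regular_centralizer[OF h])
    finally show ?thesis .
  qed auto
  have "{(P, h). invertible P \<and> regular h \<and> mm h ** P = P ** Z} \<subseteq>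
          (\<Union>h\<in>{h\<in>C. regular h}. (\<lambda>P. (P, h)) ` Q h)"
    using conj by (auto simp: Q_def)
  hence "card {(P, h). invertible P \<and> regular h \<and> mm h ** P = P ** Z} \<le>
      card (\<Union>h\<in>{h\<in>C. regular h}. (\<lambda>P. (P, h)) ` Q h)"
    by (intro card_mono) (auto simp: C_def)
  also have "\<dots> \<le> (\<Sum>h\<in>{h\<in>C. regular h}. card ((\<lambda>P. (P, h)) ` Q h))"
    by (rule card_UN_le) (auto simp: C_def)
  also have "\<dots> \<le> (\<Sum>h\<in>{h\<in>C. regular h}. CARD('k) ^ CARD('n) - 1)"
    by (intro sum_mono) (use Qle card_image_le[OF finite] le_trans in \<open>fastforce\<close>)
  also have "\<dots> = card {h\<in>C. regular h} * (CARD('k) ^ CARD('n) - 1)" by simp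
  also have "card {h\<in>C. regular h} \<le> card C" by (intro card_mono) (auto simp: C_def)
  also have "card C \<le> CARD('n)" unfolding C_def using card_image_le[of "{..<CARD('n)}"] by simp
  finally show ?thesis by simp
qed

lemma geometric_card: "(CARD('k) - 1) * (\<Sum>i<m. CARD('k) ^ i) = CARD('k) ^ m - 1"
proof -
  have "(q - 1) * (\<Sum>i<m. q ^ i) + 1 = q ^ m" if "q > 0" for q :: nat
  proof (induction m)
    case (Suc m)
    have "(q - 1) * (\<Sum>i<Suc m. q ^ i) + 1 = ((q - 1) * (\<Sum>i<m. q ^ i) + 1) + (q - 1) * q ^ m"
      by (simp add: algebra_simps)
    also have "\<dots> = q ^ m + (q - 1) * q ^ m" by (simp only: Suc)
    also have "\<dots> = q ^ Suc m" using that by (cases q) auto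
    finally show ?case .
  qed simp
  from this[of "CARD('k)"] show ?thesis by simp
qed

text \<open>X^M = c has at most M = (q^n - 1)/(q - 1) roots, so no norm value is taken too
  often.\<close>

lemma card_det_fibre:
  "(CARD('k) - 1) * card {h \<in> FF. det (mm h) = c} \<le> CARD('k) ^ CARD('n) - 1"
proof -
  define M where "M = (\<Sum>i<CARD('n). CARD('k) ^ i)"
  have "CARD('k) ^ 0 \<le> M" unfolding M_def by (rule member_le_sum) auto
  hence M: "M > 0" by simp
  have "{h \<in> FF. det (mm h) = c} \<subseteq> {h. h ^ M = to_ac c}"
    using det_mm by (auto simp: M_def)
  hence "card {h \<in> FF. det (mm h) = c} \<le> card {h. h ^ M = to_ac c}"
    by (rule card_mono[OF card_power_eq_le(1)[OF M]])
  also have "\<dots> \<le> M" by (rule card_power_eq_le(2)[OF M])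
  finally show ?thesis using geometric_card[of "CARD('n)"] unfolding M_def
    by (metis mult_le_mono2)
qed

text \<open>A nonzero exception lies in the fixed field of gcd(d, n), a proper divisor of n and so
  at most n div 2. The geometric sum is at most twice its last term.\<close>

lemma card_nonregular:
  "card {h \<in> FF. \<not> regular h} \<le> 2 * CARD('k) ^ (CARD('n) div 2)"
proof -
  let ?m = "CARD('n) div 2"
  have sub: "{h \<in> FF. \<not> regular h} \<subseteq> {0} \<union> (\<Union>g\<in>{1..?m}. frob_fixed g)"
  proof clarify
    fix h assume h: "h \<in> FF" "\<not> regular h" "h \<notin> (\<Union>g\<in>{1..?m}. frob_fixed g)"
    show "h = 0"
    proof (rule ccontr)
      assume "h \<noteq> 0"
      then obtain d where d: "0 < d" "d < CARD('n)" "h \<in> frob_fixed d"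
        using h by (auto simp: regular_def)
      let ?g = "gcd d CARD('n)"
      have "h \<in> frob_fixed ?g" using frob_fixed_gcd[OF d(3)] h(1) by (simp add: FF_eq)
      have "?g > 0" "?g dvd CARD('n)" "?g \<le> d" using d by (auto intro: gcd_le1_nat)
      have "?g \<le> ?m"
      proof -
        obtain t where t: "CARD('n) = ?g * t" using \<open>?g dvd CARD('n)\<close> by blast
        have "t \<noteq> 0" using t by (metis mult_0_right zero_less_card_finite less_irrefl)
        moreover have "t \<noteq> 1" using t \<open>?g \<le> d\<close> d(2) by (metis leD mult_1_right)
        ultimately have "2 \<le> t" by simp
        hence "?g * 2 \<le> CARD('n)" using t by (metis mult_le_mono2)
        thus ?thesis by simp
      qed
      with \<open>?g > 0\<close> have "?g \<in> {1..?m}" unfolding atLeastAtMost_iff by linarith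
      thus False using h(3) \<open>h \<in> frob_fixed ?g\<close> by blast
    qed
  qed
  have "card {h \<in> FF. \<not> regular h} \<le> card ({0} \<union> (\<Union>g\<in>{1..?m}. frob_fixed g :: 'k alg_closure set))"
    by (rule card_mono[OF _ sub]) (auto intro: finite_frob_fixed)
  also have "\<dots> \<le> 1 + card (\<Union>g\<in>{1..?m}. frob_fixed g :: 'k alg_closure set)"
    by (rule order_trans[OF card_Un_le]) simp
  also have "\<dots> \<le> 1 + (\<Sum>g\<in>{1..?m}. card (frob_fixed g :: 'k alg_closure set))"
    by (intro add_left_mono card_UN_le) simp
  also have "\<dots> \<le> 1 + (\<Sum>g\<in>{1..?m}. CARD('k) ^ g)"
    by (intro add_left_mono sum_mono card_frob_fixed_le) simp
  also have "\<dots> \<le> 2 * CARD('k) ^ ?m"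
  proof -
    have "1 + (\<Sum>g\<in>{1..m}. q ^ g) \<le> 2 * q ^ m" if "q \<ge> 2" for q m :: nat
    proof (induction m)
      case (Suc m)
      have "1 + (\<Sum>g\<in>{1..Suc m}. q ^ g) = (1 + (\<Sum>g\<in>{1..m}. q ^ g)) + q ^ Suc m" by simp
      also have "\<dots> \<le> 2 * q ^ m + q ^ Suc m" using Suc by (intro add_right_mono)
      also have "2 * q ^ m \<le> q ^ Suc m" using that by simp
      finally show ?case by simp
    qed simp
    thus ?thesis using card_gt_1_field[where 'k='k] by simp
  qed
  finally show ?thesis .
qed

end

text \<open>The interface for the later parts, free of the algebraic closure. Indexing the matrices
  by vectors turns commutativity of the field into \<open>m u *v v = m v *v u\<close>.\<close>

theorem singer_structure:
  obtains m :: "'k::{field,finite} ^ 'n::finite \<Rightarrow> 'k ^ 'n ^ 'n" and e :: "'k ^ 'n" and R :: "('k ^ 'n) set"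
  where "\<And>u v. m (u + v) = m u + m v" and "\<And>u v. m u *v v = m v *v u"
    and "\<And>u. u \<noteq> 0 \<Longrightarrow> invertible (m u)" and "m e = mat 1" and "0 \<notin> R"
    and "card (- R) \<le> 2 * CARD('k) ^ (CARD('n) div 2)"
    and "\<And>Z :: 'k ^ 'n ^ 'n. card {(P, u). invertible P \<and> u \<in> R \<and> m u ** P = P ** Z} \<le> CARD('n) * (CARD('k) ^ CARD('n) - 1)"
    and "\<And>c. (CARD('k) - 1) * card {u. det (m u) = c} \<le> CARD('k) ^ CARD('n) - 1"
proof -
  obtain b :: "'n \<Rightarrow> 'k alg_closure" where b: "\<forall>i. b i \<in> frob_fixed CARD('n)"
     "\<forall>c. (\<Sum>i\<in>UNIV. to_ac (c i) * b i) = 0 \<longrightarrow> (\<forall>i. c i = 0)"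
    using extension_basis_exists[where 'n='n and 'k='k] by blast
  interpret extension_basis b by standard (use b in auto)
  show thesis
  proof (rule that[of "\<lambda>u. mm (phi u)" "phi_inv 1" "{u. regular (phi u)}"])
    show "mm (phi (u + v)) = mm (phi u) + mm (phi v)" for u v
      by (simp add: phi_add mm_add phi_mem)
    show "mm (phi u) *v v = mm (phi v) *v u" for u v
      by (rule injD[OF inj_phi]) (simp add: phi_mm phi_mem mult.commute)
    show "invertible (mm (phi u))" if "u \<noteq> 0" for u
      using that by (intro invertible_mm) (auto simp: phi_mem phi_eq_0)
    show "mm (phi (phi_inv 1)) = mat 1" by (simp add: phi_phi_inv FF_closed mm_1)
    show "0 \<notin> {u. regular (phi u)}" by (simp add: regular_def)
    have bij: "bij_betw phi {u. Q (phi u)} {h \<in> FF. Q h}" for Q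
      unfolding bij_betw_def using inj_phi by (auto simp: FF_def intro: inj_on_subset)
    have "card (- {u. regular (phi u)}) = card {h \<in> FF. \<not> regular h}"
      using bij_betw_same_card[OF bij[of "\<lambda>h. \<not> regular h"]] by (simp add: Collect_neg_eq)
    thus "card (- {u. regular (phi u)}) \<le> 2 * CARD('k) ^ (CARD('n) div 2)"
      using card_nonregular by simp
    show "(CARD('k) - 1) * card {u. det (mm (phi u)) = c} \<le> CARD('k) ^ CARD('n) - 1" for c
      using card_det_fibre[of c] bij_betw_same_card[OF bij[of "\<lambda>h. det (mm h) = c"]] by simp
    show "card {(P, u). invertible P \<and> u \<in> {u. regular (phi u)} \<and> mm (phi u) ** P = P ** Z}
        \<le> CARD('n) * (CARD('k) ^ CARD('n) - 1)" for Z :: "'k ^ 'n ^ 'n"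
    proof (rule order_trans[OF card_inj_on_le card_regular_pairs[of Z]])
      show "inj_on (\<lambda>(P, u). (P, phi u))
          {(P, u). invertible P \<and> u \<in> {u. regular (phi u)} \<and> mm (phi u) ** P = P ** Z}"
        using inj_phi by (auto simp: inj_on_def)
      show "finite {(P, h). invertible P \<and> regular h \<and> mm h ** P = P ** Z}"
        by (rule finite_subset[of _ "UNIV \<times> FF"]) (auto simp: finite_FF regular_def)
    qed auto
  qed
qed

section \<open>The general linear group\<close>

definition GL :: "('k::field ^ 'n ^ 'n) set" where
  "GL = {A. invertible A}"

lemma GL_iff_det: "A \<in> GL \<longleftrightarrow> det A \<noteq> 0"
  for A :: "'k::field ^ 'n ^ 'n"
  by (simp add: GL_def invertible_det_nz)

lemma finite_GL [simp]: "finite (GL :: ('k::{field,finite} ^ 'n::finite ^ 'n) set)"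
  by simp

lemma GL_mult: "A \<in> GL \<Longrightarrow> B \<in> GL \<Longrightarrow> A ** B \<in> GL"
  by (simp add: GL_iff_det det_mul)

lemma GL_mult_iff: "A ** B \<in> GL \<longleftrightarrow> A \<in> GL \<and> B \<in> GL"
  by (simp add: GL_iff_det det_mul)

lemma mat_1_GL: "mat 1 \<in> GL"
  by (simp add: GL_iff_det)

lemma GL_inverse:
  assumes "A \<in> GL"
  obtains A' where "A' \<in> GL" "A ** A' = mat 1" "A' ** A = mat 1"
  using assms unfolding GL_def invertible_def by blast

lemma card_GL_pos: "card (GL :: ('k::{field,finite} ^ 'n::finite ^ 'n) set) > 0"
  using mat_1_GL by (auto simp: card_gt_0_iff)

lemma bij_GL_left: "C \<in> GL \<Longrightarrow> bij_betw (\<lambda>A. C ** A) GL GL"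
proof -
  assume C: "C \<in> GL"
  then obtain C' where C': "C' \<in> GL" "C ** C' = mat 1" "C' ** C = mat 1" by (rule GL_inverse)
  show ?thesis
    by (rule bij_betw_byWitness[of _ "\<lambda>A. C' ** A"])
       (auto simp: matrix_mul_assoc C' C GL_mult)
qed

lemma bij_GL_right: "C \<in> GL \<Longrightarrow> bij_betw (\<lambda>A. A ** C) GL GL"
proof -
  assume C: "C \<in> GL"
  then obtain C' where C': "C' \<in> GL" "C ** C' = mat 1" "C' ** C = mat 1" by (rule GL_inverse)
  show ?thesis
    by (rule bij_betw_byWitness[of _ "\<lambda>A. A ** C'"])
       (auto simp: C' C GL_mult simp flip: matrix_mul_assoc)
qed

lemma sum_GL_left: "C \<in> GL \<Longrightarrow> (\<Sum>A\<in>GL. f (C ** A)) = (\<Sum>A\<in>GL. f A)"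
  by (rule sum.reindex_bij_betw[OF bij_GL_left])

lemma sum_GL_right: "C \<in> GL \<Longrightarrow> (\<Sum>A\<in>GL. f (A ** C)) = (\<Sum>A\<in>GL. f A)"
  by (rule sum.reindex_bij_betw[OF bij_GL_right])

section \<open>Rank-one perturbations of the identity and uniformity of
  \<open>A *v v\<close>\<close>

definition outer :: "'k::comm_ring_1 ^ 'n \<Rightarrow> 'k ^ 'n \<Rightarrow> 'k ^ 'n ^ 'n" where
  "outer x y = (\<chi> i j. x $ i * y $ j)"

definition dotv :: "'k::comm_ring_1 ^ 'n \<Rightarrow> 'k ^ 'n \<Rightarrow> 'k" where
  "dotv x y = (\<Sum>i\<in>UNIV. x $ i * y $ i)"

lemma dotv_simps:
  "dotv (x + y) z = dotv x z + dotv y z" "dotv z (x + y) = dotv z x + dotv z y"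
  "dotv (x - y) z = dotv x z - dotv y z" "dotv z (x - y) = dotv z x - dotv z y"
  "dotv (c *s x) z = c * dotv x z" "dotv z (c *s x) = c * dotv z x"
  "dotv 0 z = 0" "dotv z 0 = 0" "dotv (- x) z = - dotv x z" "dotv z (- x) = - dotv z x"
  by (simp_all add: dotv_def algebra_simps sum.distrib sum_subtractf sum_distrib_left sum_negf)

lemma dotv_commute: "dotv x y = dotv y x"
  by (simp add: dotv_def mult.commute)

lemma dotv_axis: "dotv (axis i c) x = c * x $ i" "dotv x (axis i c) = x $ i * c"
  by (simp_all add: dotv_def axis_def if_distrib[of "\<lambda>x. x * y" for y]
      if_distrib[of "\<lambda>x. y * x" for y] cong: if_cong)

lemma outer_mul_vec: "outer x y *v z = dotv y z *s x"
  by (simp add: outer_def dotv_def matrix_vector_mult_def vec_eq_iff sum_distrib_left mult_ac)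

lemma mul_outer: "A ** outer x y = outer (A *v x) y"
  by (simp add: outer_def matrix_matrix_mult_def matrix_vector_mult_def vec_eq_iff sum_distrib_left mult_ac)

lemma outer_mul: "outer x y ** A = outer x (y v* A)"
  by (simp add: outer_def matrix_matrix_mult_def vector_matrix_mult_def vec_eq_iff sum_distrib_left mult_ac)

lemma outer_add: "outer (x + x') y = outer x y + outer x' y"
  by (simp add: outer_def vec_eq_iff algebra_simps)

lemma outer_0: "outer 0 y = 0" "outer x 0 = 0"
  by (simp_all add: outer_def vec_eq_iff)

lemma mult_add_distrib:
  fixes A :: "'a::semiring_1 ^ 'm::finite ^ 'l"
  shows "(A + A') ** B = A ** B + A' ** B"
  by (simp add: matrix_matrix_mult_def vec_eq_iff distrib_right sum.distrib)

lemma one_plus_outer_mult: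
  "(mat 1 + outer x y) ** (mat 1 + outer x' y) = mat 1 + outer (x + x' + dotv y x' *s x) y"
proof -
  have "outer x y ** outer x' y = outer (dotv y x' *s x) y"
    by (simp add: mul_outer outer_mul_vec)
  thus ?thesis
    by (simp add: matrix_add_ldistrib mult_add_distrib outer_add algebra_simps)
qed

lemma one_plus_outer_GL:
  fixes x y :: "'k::field ^ 'n"
  assumes "1 + dotv y x \<noteq> 0"
  shows "mat 1 + outer x y \<in> GL"
proof -
  \<comment> \<open>The inverse of a rank-one update is again one with the same covector; this
    \<open>t\<close> solves x + x' + (y.x') x = 0 for x' = t x.\<close>
  define t where "t = - (1 / (1 + dotv y x))"
  have t: "1 + t + t * dotv y x = 0"
    using assms by (simp add: t_def field_simps)
  let ?x' = "t *s x"
  have "x + ?x' + dotv y ?x' *s x = (1 + t + t * dotv y x) *s x"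
    by (simp add: dotv_simps vec_eq_iff algebra_simps)
  hence "x + ?x' + dotv y ?x' *s x = 0" by (simp add: t)
  hence "(mat 1 + outer x y) ** (mat 1 + outer ?x' y) = mat 1"
    by (subst one_plus_outer_mult) (simp add: outer_0)
  thus ?thesis by (auto simp: GL_def invertible_right_inverse)
qed

text \<open>The matrix is \<open>1 + (w - v)y\<^sup>T\<close> for a covector \<open>y\<close> that vanishes at neither vector.\<close>

lemma GL_transitive:
  fixes v w :: "'k::field ^ 'n"
  assumes "v \<noteq> 0" "w \<noteq> 0"
  shows "\<exists>A\<in>GL. A *v v = w \<and> (\<exists>y. A = mat 1 + outer (w - v) y)"
proof -
  obtain i j where ij: "v $ i \<noteq> 0" "w $ j \<noteq> 0" using assms by (auto simp: vec_eq_iff)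
  have "\<exists>y. dotv y v \<noteq> 0 \<and> dotv y w \<noteq> 0"
  proof (cases "w $ i = 0")
    case False
    thus ?thesis using ij by (intro exI[of _ "axis i 1"]) (simp add: dotv_axis)
  next
    case wi: True
    show ?thesis
    proof (cases "v $ j = 0")
      case False
      thus ?thesis using ij by (intro exI[of _ "axis j 1"]) (simp add: dotv_axis)
    next
      case True
      thus ?thesis using ij wi
        by (intro exI[of _ "axis i 1 + axis j 1"]) (simp add: dotv_axis dotv_simps)
    qed
  qed
  then obtain y0 where y0: "dotv y0 v \<noteq> 0" "dotv y0 w \<noteq> 0" by blast
  define y where "y = (1 / dotv y0 v) *s y0"
  have y: "dotv y v = 1" "dotv y w \<noteq> 0" using y0 by (auto simp: y_def dotv_simps)
  have "1 + dotv y (w - v) \<noteq> 0" using y by (simp add: dotv_simps)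
  hence "mat 1 + outer (w - v) y \<in> GL" by (rule one_plus_outer_GL)
  moreover have "(mat 1 + outer (w - v) y) *v v = w"
    by (simp add: matrix_vector_mult_add_rdistrib outer_mul_vec y)
  ultimately show ?thesis by blast
qed

lemma GL_vec_eq_0: "A \<in> GL \<Longrightarrow> A *v v = 0 \<longleftrightarrow> v = 0"
  by (metis GL_inverse matrix_vector_mul_assoc matrix_vector_mul_lid matrix_vector_mult_0_right)

lemma GL_vec_inj: "A \<in> GL \<Longrightarrow> A *v v = A *v w \<longleftrightarrow> v = w"
  by (metis GL_inverse matrix_vector_mul_assoc matrix_vector_mul_lid)

text \<open>Left multiplication by a matrix carrying one nonzero vector to another injects fibre
  into fibre, so the q^n - 1 fibres have equal size.\<close>

lemma card_GL_fibre:
  fixes v w :: "'k::{field,finite} ^ 'n::finite"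
  assumes "v \<noteq> 0" "w \<noteq> 0"
  shows "(CARD('k) ^ CARD('n) - 1) * card {A \<in> GL. A *v v = w} = card (GL :: ('k ^ 'n ^ 'n) set)"
proof -
  define f where "f x = card {A \<in> GL :: ('k ^ 'n ^ 'n) set. A *v v = x}" for x
  have le: "f x \<le> f y" if "x \<noteq> 0" "y \<noteq> 0" for x y
  proof -
    obtain C where C: "C \<in> GL" "C *v x = y" using GL_transitive[OF \<open>x \<noteq> 0\<close> \<open>y \<noteq> 0\<close>] by blast
    show ?thesis unfolding f_def
    proof (rule card_inj_on_le[of "\<lambda>A. C ** A"])
      show "inj_on (\<lambda>A. C ** A) {A \<in> GL. A *v v = x}"
        using bij_GL_left[OF C(1)] by (auto simp: bij_betw_def inj_on_def)
      show "(\<lambda>A. C ** A) ` {A \<in> GL. A *v v = x} \<subseteq> {A \<in> GL. A *v v = y}"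
        using C by (auto simp: GL_mult simp flip: matrix_vector_mul_assoc)
    qed simp
  qed
  have "card (GL :: ('k ^ 'n ^ 'n) set) = card (\<Union>x\<in>UNIV - {0}. {A \<in> GL. A *v v = x})"
    by (rule arg_cong[where f = card]) (use assms GL_vec_eq_0 in auto)
  also have "\<dots> = (\<Sum>x\<in>UNIV - {0}. f x)"
    unfolding f_def by (rule card_UN_disjoint) auto
  also have "\<dots> = (\<Sum>x\<in>UNIV - {0::'k ^ 'n}. f w)"
    by (rule sum.cong) (use le assms in \<open>auto intro: antisym\<close>)
  also have "\<dots> = (CARD('k) ^ CARD('n) - 1) * f w" by (simp add: card_Diff_singleton)
  finally show ?thesis by (simp add: f_def)
qed

text \<open>The averaging principle behind the union bounds below: for random \<open>A\<close> the
  vector \<open>A *v v\<close> is uniform on the nonzero vectors.\<close>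

lemma sum_GL_vec:
  fixes v :: "'k::{field,finite} ^ 'n::finite" and g :: "'k ^ 'n \<Rightarrow> real"
  assumes "v \<noteq> 0"
  shows "(real CARD('k) ^ CARD('n) - 1) * (\<Sum>A\<in>GL. g (A *v v))
    = real (card (GL :: ('k ^ 'n ^ 'n) set)) * (\<Sum>w\<in>UNIV - {0}. g w)"
proof -
  let ?N = "real CARD('k) ^ CARD('n) - 1"
  have fib: "?N * real (card {A \<in> GL. A *v v = w}) = real (card (GL :: ('k ^ 'n ^ 'n) set))" if "w \<noteq> 0" for w
  proof -
    have "real ((CARD('k) ^ CARD('n) - 1) * card {A \<in> GL. A *v v = w}) = real (card (GL :: ('k ^ 'n ^ 'n) set))"
      by (simp only: card_GL_fibre[OF assms that])
    thus ?thesis by (simp add: of_nat_diff)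
  qed
  have "(\<Sum>A\<in>GL. g (A *v v)) = (\<Sum>w\<in>UNIV - {0}. \<Sum>A | A \<in> GL \<and> A *v v = w. g (A *v v))"
    by (rule sum.group[symmetric]) (use assms GL_vec_eq_0 in auto)
  also have "\<dots> = (\<Sum>w\<in>UNIV - {0}. real (card {A \<in> GL. A *v v = w}) * g w)"
    by (intro sum.cong refl) simp
  finally have "?N * (\<Sum>A\<in>GL. g (A *v v)) = (\<Sum>w\<in>UNIV - {0}. (?N * real (card {A \<in> GL. A *v v = w})) * g w)"
    by (simp add: sum_distrib_left mult.assoc)
  also have "\<dots> = (\<Sum>w\<in>UNIV - {0}. real (card (GL :: ('k ^ 'n ^ 'n) set)) * g w)"
    by (intro sum.cong) (use fib in auto)
  finally show ?thesis by (simp add: sum_distrib_left)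
qed

lemma axis_component: "axis i c $ j = (if j = i then c else 0)"
  by (simp add: axis_def)

text \<open>When y.x = 0 the updates by multiples of x multiply by adding the multiples. The q-th
  power is the identity, so the determinant d satisfies d^q = 1, while d^q = d in K.\<close>

lemma det_transvection:
  fixes x y :: "'k::{field,finite} ^ 'n::finite"
  assumes "dotv y x = 0"
  shows "det (mat 1 + outer x y) = 1"
proof -
  have pow: "det (mat 1 + outer (of_nat m *s x) y) = det (mat 1 + outer x y) ^ m" for m
  proof (induction m)
    case (Suc m)
    have "(mat 1 + outer x y) ** (mat 1 + outer (of_nat m *s x) y) = mat 1 + outer (of_nat (Suc m) *s x) y"
      using assms by (simp add: one_plus_outer_mult dotv_simps vec_eq_iff algebra_simps)
    thus ?case using Suc by (metis det_mul power_Suc)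
  qed (simp add: outer_0)
  have "(of_nat CARD('k) :: 'k) = 0" using CHAR_dvd_CARD[where 'a='k] by (simp add: of_nat_eq_0_iff_char_dvd)
  with pow[of "CARD('k)"] show ?thesis by (simp add: finite_field_power_card outer_0)
qed

text \<open>Column reduction: one moves \<open>A e\<^sub>i\<close> to \<open>e\<^sub>i\<close> by transvections that fix the columns already treated.\<close>

lemma transvections_generate_SL:
  fixes f :: "'k::{field,finite} ^ 'n::finite ^ 'n \<Rightarrow> 'a"
  assumes inv: "\<And>x y B. dotv y x = 0 \<Longrightarrow> f ((mat 1 + outer x y) ** B) = f B"
    and det: "det A = 1"
  shows "f (A ** B) = f B"
proof -
  have main: "\<forall>B. f (A ** B) = f B" if "det A = 1" "\<And>j. j \<in> J \<Longrightarrow> A *v axis j 1 = axis j 1" for A J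
    using that
  proof (induction "card (- J)" arbitrary: J A)
    case 0
    hence "A *v axis j 1 = axis j 1" for j by (auto simp: card_eq_0_iff)
    hence "A $ i $ j = (mat 1 :: 'k ^ 'n ^ 'n) $ i $ j" for i j
      by (simp add: matrix_vector_mul_component mat_def axis_component vec_eq_iff matrix_vector_mult_def if_distrib cong: if_cong)
    hence "A = mat 1" by (simp add: vec_eq_iff)
    thus ?case by simp
  next
    case (Suc m)
    then obtain i where i: "i \<notin> J" by (metis Compl_iff card.empty ex_in_conv nat.distinct(1))
    have m: "m = card (- insert i J)"
    proof -
      have "- insert i J = - J - {i}" by auto
      thus ?thesis using Suc.hyps(2) i by simp
    qed
    \<comment> \<open>The transvection with x = (e_i - v)/y_i moves v = A e_i to e_i and fixes every
      e_j with y_j = 0; the condition y.v = y_i is exactly y.x = 0. The cases below search for such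
      a \<open>y\<close>.\<close>
    have step: "\<forall>B. f (A ** B) = f B"
      if A: "det A = 1" "\<And>j. j \<in> J \<Longrightarrow> A *v axis j 1 = axis j 1"
        and y: "\<And>j. j \<in> J \<Longrightarrow> y $ j = 0" "dotv y (A *v axis i 1) = y $ i" "y $ i \<noteq> 0" for A y
    proof
      fix B
      define v where "v = A *v axis i 1"
      define x where "x = (1 / y $ i) *s (axis i 1 - v)"
      have yx: "dotv y x = 0" using y(2) by (simp add: x_def dotv_simps dotv_axis v_def)
      let ?T = "mat 1 + outer x y"
      have "\<forall>B. f (?T ** A ** B) = f B"
      proof (rule Suc.hyps(1)[OF m])
        have "det ?T = 1" by (rule det_transvection[OF yx])
        thus "det (?T ** A) = 1" using A by (simp add: det_mul)
        fix j assume j: "j \<in> insert i J"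
        show "(?T ** A) *v axis j 1 = axis j 1"
        proof (cases "j = i")
          case True
          have "?T *v v = axis i 1" using y(2,3)
            by (simp add: matrix_vector_mult_add_rdistrib outer_mul_vec x_def v_def vec_eq_iff)
          thus ?thesis using True by (simp add: v_def flip: matrix_vector_mul_assoc)
        next
          case False
          hence "j \<in> J" using j by simp
          thus ?thesis using A(2) y(1)
            by (simp add: matrix_vector_mult_add_rdistrib outer_mul_vec dotv_axis axis_component flip: matrix_vector_mul_assoc)
        qed
      qed
      moreover have "f (?T ** A ** B) = f (A ** B)" using inv[OF yx] by (simp flip: matrix_mul_assoc)
      ultimately show "f (A ** B) = f B" by simp
    qed
    define v where "v = A *v axis i 1"
    note A = Suc.prems
    consider (other) l where "l \<notin> J" "l \<noteq> i" "v $ l \<noteq> 0"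
      | (only) "\<And>l. l \<notin> J \<Longrightarrow> l \<noteq> i \<Longrightarrow> v $ l = 0" by blast
    thus ?case
    proof cases
      case other
      let ?y = "axis i 1 + axis l ((1 - v $ i) / v $ l)"
      show ?thesis
      proof (rule step[OF A, of ?y])
        show "?y $ j = 0" if "j \<in> J" for j using that i other by (auto simp: axis_component)
        have "?y $ i = 1" using other by (simp add: axis_component)
        thus "?y $ i \<noteq> 0" "dotv ?y (A *v axis i 1) = ?y $ i"
          using other by (simp_all add: dotv_simps dotv_axis flip: v_def)
      qed
    next
      case only
      \<comment> \<open>Otherwise v is a combination of the vectors e_j with j in \<open>J\<close>,
        which \<open>A\<close> fixes; then \<open>A\<close> sends both v and e_i to v.\<close>
      have vi: "v $ i \<noteq> 0"
      proof
        assume vi: "v $ i = 0"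
        have "A \<in> GL" using A by (simp add: GL_iff_det)
        define z where "z = (\<Sum>j\<in>J. v $ j *s axis j 1)"
        have zl: "z $ l = (if l \<in> J then v $ l else 0)" for l
          by (simp add: z_def axis_component if_distrib cong: if_cong)
        have "z $ l = v $ l" for l using zl only vi by (cases "l = i") auto
        hence "z = v" by (simp add: vec_eq_iff)
        have "A *v z = (\<Sum>j\<in>J. v $ j *s (A *v axis j 1))"
          by (simp add: z_def vec.sum vec.scale)
        also have "\<dots> = z" unfolding z_def by (intro sum.cong) (use A(2) in auto)
        finally have "A *v z = A *v axis i 1" using \<open>z = v\<close> by (simp add: v_def)
        hence "z = axis i 1" using GL_vec_inj[OF \<open>A \<in> GL\<close>] by blast
        with zl[of i] i show False by (simp add: axis_component)
      qed
      show ?thesis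
      proof (cases "\<exists>l. l \<notin> J \<and> l \<noteq> i")
        case True
        then obtain l where l: "l \<notin> J" "l \<noteq> i" by blast
        \<comment> \<open>A preliminary transvection copies the entry v_i into the free position l,
          which leads back to the previous case.\<close>
        let ?T = "mat 1 + outer (axis l 1) (axis i 1)"
        have T0: "dotv (axis i 1) (axis l 1 :: 'k ^ 'n) = 0" using l by (simp add: dotv_axis axis_component)
        have v2: "(?T ** A) *v axis i 1 = v + v $ i *s axis l 1"
          by (simp add: v_def matrix_vector_mult_add_rdistrib outer_mul_vec dotv_axis flip: matrix_vector_mul_assoc)
        let ?v = "v + v $ i *s axis l 1"
        have vl: "?v $ l \<noteq> 0" using only[OF l] vi by (simp add: axis_component)
        let ?y = "axis i 1 + axis l ((1 - ?v $ i) / ?v $ l)"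
        have "\<forall>B. f (?T ** A ** B) = f B"
        proof (rule step[of _ ?y])
          show "det (?T ** A) = 1" using A(1) det_transvection[OF T0] by (simp add: det_mul)
          show "(?T ** A) *v axis j 1 = axis j 1" if "j \<in> J" for j
          proof -
            have "j \<noteq> i" using that i by auto
            thus ?thesis using A(2)[OF that]
              by (simp add: matrix_vector_mult_add_rdistrib outer_mul_vec dotv_axis axis_component flip: matrix_vector_mul_assoc)
            qed
          show "?y $ j = 0" if "j \<in> J" for j using that i l by (auto simp: axis_component)
          have y1: "?y $ i = 1" using l by (simp add: axis_component)
          thus "?y $ i \<noteq> 0" by simp
          show "dotv ?y ((?T ** A) *v axis i 1) = ?y $ i"
            unfolding v2 y1 using vl by (simp add: dotv_simps(1) dotv_axis)
        qed
        thus ?thesis using inv[OF T0] by (metis matrix_mul_assoc)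
      next
        case False
        hence J: "j \<in> J" if "j \<noteq> i" for j using that by blast
        \<comment> \<open>Only column i is left. Clearing its other entries yields a diagonal matrix
          of determinant v_i, so v_i = 1 and y = e_i satisfies the requirement.\<close>
        define x where "x = (1 / v $ i) *s (v $ i *s axis i 1 - v)"
        have x0: "dotv (axis i 1) x = 0" by (simp add: x_def dotv_simps dotv_axis axis_component)
        let ?T = "mat 1 + outer x (axis i 1)"
        have col: "(?T ** A) *v axis j 1 = (if j = i then v $ i *s axis i 1 else axis j 1)" for j
        proof (cases "j = i")
          case True
          have "?T *v v = v $ i *s axis i 1" using vi
            by (simp add: matrix_vector_mult_add_rdistrib outer_mul_vec dotv_axis x_def vec_eq_iff)
          thus ?thesis using True by (simp add: v_def flip: matrix_vector_mul_assoc)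
        next
          case False
          thus ?thesis using A(2)[OF J[OF False]]
            by (simp add: matrix_vector_mult_add_rdistrib outer_mul_vec dotv_axis axis_component flip: matrix_vector_mul_assoc)
        qed
        have ent: "(?T ** A) $ l $ j = (if j = i then v $ i *s axis i 1 else axis j 1) $ l" for l j
        proof -
          have "(?T ** A) $ l $ j = ((?T ** A) *v axis j 1) $ l"
            by (simp add: matrix_vector_mult_def axis_component if_distrib cong: if_cong)
          thus ?thesis by (simp only: col)
        qed
        have "det (?T ** A) = (\<Prod>j\<in>UNIV. (?T ** A) $ j $ j)"
          by (rule det_diagonal) (auto simp: ent axis_component)
        also have "\<dots> = (\<Prod>j\<in>UNIV. if j = i then v $ i else 1)"
          by (intro prod.cong) (auto simp: ent axis_component)
        also have "\<dots> = v $ i" by simp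
        finally have "v $ i = 1" using det_transvection[OF x0] A(1) by (simp add: det_mul)
        show ?thesis
        proof (rule step[OF A, of "axis i 1"])
          show "axis i 1 $ j = (0::'k)" if "j \<in> J" for j using that i by (auto simp: axis_component)
          show "dotv (axis i 1) (A *v axis i 1) = axis i 1 $ i"
            using \<open>v $ i = 1\<close> by (simp add: dotv_axis axis_component flip: v_def)
          show "(axis i 1 :: 'k ^ 'n) $ i \<noteq> 0" by (simp add: axis_component)
        qed
      qed
    qed
  qed
  show ?thesis using main[of A "{}"] det by auto
qed

section \<open>Contraction by averaging over transvections\<close>

text \<open>\<open>nu_comm\<close> is conjugation invariance written without inverses;
  \<open>i0\<close> selects the coordinate functional shared by one group of transvections.\<close>

locale conj_weight =
  fixes nu :: "'k::{field,finite} ^ 'n::finite ^ 'n \<Rightarrow> real" and i0 :: 'n and \<psi> :: "'k \<Rightarrow> complex"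
  assumes nu_nonneg: "nu Z \<ge> 0"
    and nu_comm: "A \<in> GL \<Longrightarrow> nu (A ** Z) = nu (Z ** A)"
    and psi_add: "\<psi> (x + y) = \<psi> x * \<psi> y"
    and psi_norm: "norm (\<psi> x) = 1"
    and psi_nontriv: "\<exists>x. \<psi> x \<noteq> 1"
begin

definition U0 :: "('k ^ 'n) set" where "U0 = {u. u $ i0 = 0}"

text \<open>For \<open>u\<close> in \<open>U0\<close> these form an abelian group of transvections,
  and the \<open>chi a\<close> with \<open>a\<close> in \<open>U0\<close> are its
  characters.\<close>

definition tv :: "'k ^ 'n \<Rightarrow> 'k ^ 'n ^ 'n" where "tv u = mat 1 + outer u (axis i0 1)"

definition chi :: "'k ^ 'n \<Rightarrow> 'k ^ 'n \<Rightarrow> complex" where "chi a u = \<psi> (dotv a u)"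

lemma U0_closed: "0 \<in> U0" "u \<in> U0 \<Longrightarrow> v \<in> U0 \<Longrightarrow> u + v \<in> U0"
    "u \<in> U0 \<Longrightarrow> v \<in> U0 \<Longrightarrow> u - v \<in> U0" "u \<in> U0 \<Longrightarrow> - u \<in> U0"
  by (auto simp: U0_def)

lemma card_U0_pos: "card U0 > 0"
  using U0_closed(1) by (auto simp: card_gt_0_iff)

lemma tv_add: "v \<in> U0 \<Longrightarrow> tv u ** tv v = tv (u + v)"
  by (simp add: tv_def one_plus_outer_mult dotv_axis U0_def)

lemma tv_0: "tv 0 = mat 1"
  by (simp add: tv_def outer_0)

lemma tv_GL: "u \<in> U0 \<Longrightarrow> tv u \<in> GL"
  unfolding tv_def by (rule one_plus_outer_GL) (simp add: dotv_axis U0_def)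

lemma det_tv: "u \<in> U0 \<Longrightarrow> det (tv u) = 1"
  unfolding tv_def by (rule det_transvection) (simp add: dotv_axis U0_def)

lemma psi_0: "\<psi> 0 = 1"
  using psi_add[of 0 0] psi_norm[of 0] by auto

lemma psi_cnj: "cnj (\<psi> x) = \<psi> (- x)"
proof -
  have "\<psi> x * \<psi> (- x) = 1" using psi_add[of x "- x"] by (simp add: psi_0)
  moreover have "\<psi> x * cnj (\<psi> x) = 1" by (metis complex_norm_square mult.right_neutral of_real_1 power_one psi_norm)
  ultimately show ?thesis by (metis mult_cancel_left zero_neq_one mult_zero_left)
qed

lemma chi_simps:
  "chi a (u + v) = chi a u * chi a v" "chi (a + b) u = chi a u * chi b u"
  "cnj (chi a u) = chi a (- u)" "chi (- a) u = chi a (- u)" "chi 0 u = 1" "chi a 0 = 1"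
  "norm (chi a u) = 1"
  by (simp_all add: chi_def dotv_simps psi_add psi_cnj psi_0 psi_norm)

lemma chi_commute: "chi a u = chi u a"
  by (simp add: chi_def dotv_commute)

lemma sum_U0_shift: "v \<in> U0 \<Longrightarrow> (\<Sum>u\<in>U0. f (u + v)) = (\<Sum>u\<in>U0. f u)"
  by (rule sum.reindex_bij_witness[of _ "\<lambda>u. u - v" "\<lambda>u. u + v"]) (auto simp: U0_closed)

lemma sum_U0_minus: "(\<Sum>u\<in>U0. f (- u)) = (\<Sum>u\<in>U0. f u)"
  by (rule sum.reindex_bij_witness[of _ "\<lambda>u. - u" "\<lambda>u. - u"]) (auto simp: U0_closed)

lemma chi_sum:
  assumes "a \<in> U0"
  shows "(\<Sum>u\<in>U0. chi a u) = (if a = 0 then of_nat (card U0) else 0)"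
proof (cases "a = 0")
  case False
  then obtain i where i: "a $ i \<noteq> 0" by (auto simp: vec_eq_iff)
  obtain t where t: "\<psi> t \<noteq> 1" using psi_nontriv by blast
  let ?v = "axis i (t / a $ i)"
  have "i \<noteq> i0" using i assms by (auto simp: U0_def)
  hence v: "?v \<in> U0" by (simp add: U0_def axis_component)
  have "chi a ?v = \<psi> t" using i by (simp add: chi_def dotv_axis)
  moreover have "(\<Sum>u\<in>U0. chi a u) = (\<Sum>u\<in>U0. chi a u) * chi a ?v"
    using sum_U0_shift[OF v, of "chi a"] by (simp add: chi_simps sum_distrib_right)
  ultimately show ?thesis using t False by auto
qed (simp add: chi_simps)

definition corr :: "'k ^ 'n \<Rightarrow> real" where
  "corr w = (\<Sum>Y\<in>GL. nu (tv w ** Y) * nu Y)"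

lemma nu_conj: "C \<in> GL \<Longrightarrow> C' ** C = mat 1 \<Longrightarrow> nu (C ** Z ** C') = nu Z"
  using nu_comm[of C "Z ** C'"] by (metis matrix_mul_assoc matrix_mul_rid)

text \<open>The shear conjugating \<open>tv w\<close> to \<open>tv w'\<close> leaves \<open>nu\<close> unchanged.\<close>

lemma corr_const:
  assumes w: "w \<in> U0" "w' \<in> U0" "w \<noteq> 0" "w' \<noteq> 0"
  shows "corr w = corr w'"
proof -
  obtain C y where C: "C \<in> GL" "C *v w = w'" "C = mat 1 + outer (w' - w) y"
    using GL_transitive[OF w(3,4)] by (elim bexE conjE exE) (rule that)
  obtain C' where C': "C' \<in> GL" "C ** C' = mat 1" "C' ** C = mat 1" using C(1) by (rule GL_inverse)
  have "(axis i0 1 v* C) $ j = axis i0 (1::'k) $ j" for j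
  proof -
    have "(axis i0 1 v* C) $ j = C $ i0 $ j"
      by (simp add: vector_matrix_mult_def axis_def if_distrib[of "\<lambda>x. x * y" for y]
          if_distrib[of "\<lambda>x. y * x" for y] cong: if_cong)
    also have "\<dots> = axis i0 (1::'k) $ j"
      unfolding C(3) using w by (simp add: U0_def outer_def mat_def axis_def)
    finally show ?thesis .
  qed
  hence "axis i0 1 v* C = axis i0 (1::'k)" by (simp add: vec_eq_iff)
  hence tw: "C ** tv w = tv w' ** C"
    by (simp add: tv_def matrix_add_ldistrib mult_add_distrib mul_outer outer_mul C(2))
  have "corr w = (\<Sum>Y\<in>GL. nu (C ** (tv w ** Y) ** C') * nu (C ** Y ** C'))"
    unfolding corr_def by (simp add: nu_conj[OF C(1) C'(3)])
  also have "\<dots> = (\<Sum>Y\<in>GL. nu (tv w' ** (C ** Y ** C')) * nu (C ** Y ** C'))"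
    by (simp add: matrix_mul_assoc tw)
  also have "\<dots> = (\<Sum>Y\<in>GL. nu (tv w' ** (Y ** C')) * nu (Y ** C'))"
    using sum_GL_left[OF C(1), of "\<lambda>Y. nu (tv w' ** (Y ** C')) * nu (Y ** C')"] .
  also have "\<dots> = corr w'"
    unfolding corr_def using sum_GL_right[OF C'(1), of "\<lambda>Y. nu (tv w' ** Y) * nu Y"] .
  finally show ?thesis .
qed

text \<open>The expanded square is the Fourier transform of \<open>corr\<close> at \<open>a\<close>.
  As \<open>corr\<close> is constant off 0 and a nontrivial character sums to -1 there, it equals
  |U0| (corr 0 - c1) with c1 >= 0. Hence each nontrivial character carries at most the fraction
  1/|U0| of the total square norm.\<close>

lemma hs_component:
  assumes a: "a \<in> U0" "a \<noteq> 0"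
  shows "(\<Sum>Y\<in>GL. (cmod (\<Sum>u\<in>U0. chi a u * of_real (nu (tv u ** Y))))\<^sup>2) \<le> card U0 * (\<Sum>Y\<in>GL. (nu Y)\<^sup>2)"
proof -
  define c1 where "c1 = corr a"
  have shift: "(\<Sum>Y\<in>GL. nu (tv u ** Y) * nu (tv v ** Y)) = corr (u - v)" if "u \<in> U0" "v \<in> U0" for u v
  proof -
    have "(\<Sum>Y\<in>GL. nu (tv u ** Y) * nu (tv v ** Y)) =
      (\<Sum>Y\<in>GL. nu (tv u ** (tv (- v) ** Y)) * nu (tv v ** (tv (- v) ** Y)))"
      using sum_GL_left[OF tv_GL, of "- v" "\<lambda>Y. nu (tv u ** Y) * nu (tv v ** Y)"] that
      by (simp add: U0_closed)
    also have "\<dots> = corr (u - v)"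
      unfolding corr_def using that by (simp add: matrix_mul_assoc tv_add U0_closed tv_0)
    finally show ?thesis .
  qed
  have "complex_of_real (\<Sum>Y\<in>GL. (cmod (\<Sum>u\<in>U0. chi a u * of_real (nu (tv u ** Y))))\<^sup>2) =
      (\<Sum>Y\<in>GL. \<Sum>u\<in>U0. \<Sum>v\<in>U0. chi a (u - v) * of_real (nu (tv u ** Y) * nu (tv v ** Y)))"
    unfolding of_real_sum complex_norm_square cnj_sum sum_product
    by (intro sum.cong refl) (simp add: chi_simps diff_conv_add_uminus del: add_uminus_conv_diff)
  also have "\<dots> = (\<Sum>u\<in>U0. \<Sum>v\<in>U0. \<Sum>Y\<in>GL. chi a (u - v) * of_real (nu (tv u ** Y) * nu (tv v ** Y)))"
    by (subst sum.swap, intro sum.cong refl, rule sum.swap)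
  also have "\<dots> = (\<Sum>u\<in>U0. \<Sum>v\<in>U0. chi a (u - v) * of_real (corr (u - v)))"
    by (intro sum.cong refl) (simp add: shift[symmetric] sum_distrib_left)
  also have "\<dots> = (\<Sum>v\<in>U0. \<Sum>u\<in>U0. chi a (u - v) * of_real (corr (u - v)))"
    by (rule sum.swap)
  also have "\<dots> = (\<Sum>v\<in>U0. \<Sum>w\<in>U0. chi a w * of_real (corr w))"
  proof (rule sum.cong[OF refl])
    fix v assume "v \<in> U0"
    thus "(\<Sum>u\<in>U0. chi a (u - v) * of_real (corr (u - v))) = (\<Sum>w\<in>U0. chi a w * of_real (corr w))"
      using sum_U0_shift[of "- v" "\<lambda>w. chi a w * of_real (corr w)"] by (simp add: U0_closed)
  qed
  also have "\<dots> = of_nat (card U0) * (\<Sum>w\<in>U0. chi a w * of_real (corr w))" by simp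
  also have "(\<Sum>w\<in>U0. chi a w * of_real (corr w)) = of_real (corr 0 - c1)"
  proof -
    have "(\<Sum>w\<in>U0. chi a w * of_real (corr w)) = of_real (corr 0) + (\<Sum>w\<in>U0-{0}. chi a w * of_real (corr w))"
      by (simp add: sum.remove[of U0 0] U0_closed chi_simps)
    also have "(\<Sum>w\<in>U0-{0}. chi a w * of_real (corr w)) = (\<Sum>w\<in>U0-{0}. chi a w) * of_real c1"
      unfolding sum_distrib_right c1_def
    proof (rule sum.cong[OF refl])
      fix w assume "w \<in> U0 - {0}"
      hence "corr w = corr a" using a by (intro corr_const) auto
      thus "chi a w * of_real (corr w) = chi a w * of_real (corr a)" by (simp only:)
    qed
    also have "(\<Sum>w\<in>U0-{0}. chi a w) = -1"
      using chi_sum[OF a(1)] a(2) by (simp add: sum.remove[of U0 0] U0_closed chi_simps eq_neg_iff_add_eq_0 add.commute)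
    finally show ?thesis by simp
  qed
  finally have "complex_of_real (\<Sum>Y\<in>GL. (cmod (\<Sum>u\<in>U0. chi a u * of_real (nu (tv u ** Y))))\<^sup>2) = complex_of_real (real (card U0) * (corr 0 - c1))"
    by (simp only: of_real_mult of_real_of_nat_eq)
  hence "(\<Sum>Y\<in>GL. (cmod (\<Sum>u\<in>U0. chi a u * of_real (nu (tv u ** Y))))\<^sup>2) = card U0 * (corr 0 - c1)"
    by (simp only: of_real_eq_iff)
  also have "\<dots> \<le> card U0 * corr 0"
    by (intro mult_left_mono) (auto simp: c1_def corr_def intro!: sum_nonneg mult_nonneg_nonneg nu_nonneg)
  also have "corr 0 = (\<Sum>Y\<in>GL. (nu Y)\<^sup>2)" by (simp add: corr_def tv_0 power2_eq_square)
  finally show ?thesis .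
qed

definition Tc :: "('k ^ 'n ^ 'n \<Rightarrow> complex) \<Rightarrow> 'k ^ 'n ^ 'n \<Rightarrow> complex" where
  "Tc F A = (\<Sum>Z\<in>GL. of_real (nu Z) * F (A ** Z))"

text \<open>The square of the contraction factor on nontrivial characters; a density of at most n/g
  and mass at most 1 make it at most n/|U0|.\<close>

definition lam2 :: real where
  "lam2 = real (card (GL :: ('k ^ 'n ^ 'n) set)) * (\<Sum>Z\<in>GL. (nu Z)\<^sup>2) / card U0"

lemma lam2_nonneg: "lam2 \<ge> 0"
  by (simp add: lam2_def sum_nonneg)

lemma cauchy_schwarz_complex:
  fixes f g :: "'b \<Rightarrow> complex"
  shows "(cmod (\<Sum>x\<in>S. f x * g x))\<^sup>2 \<le> (\<Sum>x\<in>S. (cmod (f x))\<^sup>2) * (\<Sum>x\<in>S. (cmod (g x))\<^sup>2)"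
proof -
  have "cmod (\<Sum>x\<in>S. f x * g x) \<le> (\<Sum>x\<in>S. cmod (f x) * cmod (g x))"
    by (rule order_trans[OF norm_sum]) (simp add: norm_mult)
  hence "(cmod (\<Sum>x\<in>S. f x * g x))\<^sup>2 \<le> (\<Sum>x\<in>S. cmod (f x) * cmod (g x))\<^sup>2"
    by (intro power_mono) auto
  also have "\<dots> \<le> (\<Sum>x\<in>S. (cmod (f x))\<^sup>2) * (\<Sum>x\<in>S. (cmod (g x))\<^sup>2)"
    by (rule Cauchy_Schwarz_ineq_sum)
  finally show ?thesis .
qed

text \<open>Averaging over \<open>U0\<close> turns the kernel into its character component.
  Conjugation invariance moves \<open>A'\<close> to the right end of the argument, so that
  \<open>hs_component\<close> applies; Cauchy-Schwarz then bounds each value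
  \<open>Tc F A\<close>.\<close>

lemma Tc_isotypic:
  assumes a: "a \<in> U0" "a \<noteq> 0" and F: "\<And>u A. u \<in> U0 \<Longrightarrow> F (tv u ** A) = chi a (- u) * F A"
  shows "(\<Sum>A\<in>GL. (cmod (Tc F A))\<^sup>2) \<le> lam2 * (\<Sum>A\<in>GL. (cmod (F A))\<^sup>2)"
proof -
  let ?N = "card U0" and ?E = "\<Sum>Z\<in>GL. (nu Z)\<^sup>2" and ?F = "\<Sum>A\<in>GL. (cmod (F A))\<^sup>2"
  have pt: "(cmod (Tc F A))\<^sup>2 \<le> ?E / ?N * ?F" if A: "A \<in> GL" for A
  proof -
    obtain A' where A': "A' \<in> GL" "A ** A' = mat 1" "A' ** A = mat 1" using A by (rule GL_inverse)
    have T: "Tc F A = (\<Sum>Y\<in>GL. of_real (nu (A' ** (tv u ** Y))) * (chi a (- u) * F Y))" if "u \<in> U0" for u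
    proof -
      have "Tc F A = (\<Sum>Y\<in>GL. of_real (nu (A' ** Y)) * F (A ** (A' ** Y)))"
        unfolding Tc_def using sum_GL_left[OF A'(1), of "\<lambda>Z. of_real (nu Z) * F (A ** Z)"] by simp
      also have "\<dots> = (\<Sum>Y\<in>GL. of_real (nu (A' ** Y)) * F Y)" by (simp add: matrix_mul_assoc A')
      also have "\<dots> = (\<Sum>Y\<in>GL. of_real (nu (A' ** (tv u ** Y))) * F (tv u ** Y))"
        using sum_GL_left[OF tv_GL[OF that], of "\<lambda>Y. of_real (nu (A' ** Y)) * F Y"] by simp
      finally show ?thesis using F that by simp
    qed
    have "of_nat ?N * Tc F A = (\<Sum>u\<in>U0. Tc F A)" by simp
    also have "\<dots> = (\<Sum>u\<in>U0. \<Sum>Y\<in>GL. of_real (nu (A' ** (tv u ** Y))) * (chi a (- u) * F Y))"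
      by (intro sum.cong refl T)
    also have "\<dots> = (\<Sum>Y\<in>GL. (\<Sum>u\<in>U0. chi (- a) u * of_real (nu (tv u ** (Y ** A')))) * F Y)"
    proof -
      have "nu (A' ** (tv u ** Y)) = nu (tv u ** (Y ** A'))" for u Y
        using nu_comm[OF A'(1), of "tv u ** Y"] by (simp add: matrix_mul_assoc)
      thus ?thesis by (subst sum.swap) (simp add: sum_distrib_left chi_simps mult_ac)
    qed
    finally have eq: "of_nat ?N * Tc F A = (\<Sum>Y\<in>GL. (\<Sum>u\<in>U0. chi (- a) u * of_real (nu (tv u ** (Y ** A')))) * F Y)" .
    have "(cmod (of_nat ?N * Tc F A))\<^sup>2 \<le>
        (\<Sum>Y\<in>GL. (cmod (\<Sum>u\<in>U0. chi (- a) u * of_real (nu (tv u ** (Y ** A')))))\<^sup>2) * ?F"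
      unfolding eq by (rule cauchy_schwarz_complex)
    also have "(\<Sum>Y\<in>GL. (cmod (\<Sum>u\<in>U0. chi (- a) u * of_real (nu (tv u ** (Y ** A')))))\<^sup>2) =
        (\<Sum>Y\<in>GL. (cmod (\<Sum>u\<in>U0. chi (- a) u * of_real (nu (tv u ** Y))))\<^sup>2)"
      using sum_GL_right[OF A'(1), of "\<lambda>Y. (cmod (\<Sum>u\<in>U0. chi (- a) u * of_real (nu (tv u ** Y))))\<^sup>2"] .
    also have "\<dots> \<le> ?N * ?E" by (rule hs_component) (use a U0_closed in auto)
    finally have "real ?N ^ 2 * (cmod (Tc F A))\<^sup>2 \<le> ?N * ?E * ?F"
      by (simp add: norm_mult power_mult_distrib mult_right_mono sum_nonneg)
    thus ?thesis using card_U0_pos by (simp add: field_simps power2_eq_square)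
  qed
  have "(\<Sum>A\<in>GL. (cmod (Tc F A))\<^sup>2) \<le> (\<Sum>A\<in>(GL :: ('k ^ 'n ^ 'n) set). ?E / ?N * ?F)"
    by (intro sum_mono pt)
  thus ?thesis by (simp add: lam2_def mult_ac)
qed

definition T :: "('k ^ 'n ^ 'n \<Rightarrow> real) \<Rightarrow> 'k ^ 'n ^ 'n \<Rightarrow> real" where
  "T f A = (\<Sum>Z\<in>GL. nu Z * f (A ** Z))"

definition ip :: "('k ^ 'n ^ 'n \<Rightarrow> real) \<Rightarrow> ('k ^ 'n ^ 'n \<Rightarrow> real) \<Rightarrow> real" where
  "ip f g = (\<Sum>A\<in>GL. f A * g A)"

text \<open>The projection onto functions on which left translation by \<open>tv\<close> acts
  through a character; \<open>Pr\<close> is the case of the trivial character.\<close>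

definition comp :: "'k ^ 'n \<Rightarrow> ('k ^ 'n ^ 'n \<Rightarrow> real) \<Rightarrow> 'k ^ 'n ^ 'n \<Rightarrow> complex" where
  "comp a f A = (\<Sum>u\<in>U0. chi a u * of_real (f (tv u ** A))) / of_nat (card U0)"

definition Pr :: "('k ^ 'n ^ 'n \<Rightarrow> real) \<Rightarrow> 'k ^ 'n ^ 'n \<Rightarrow> real" where
  "Pr f A = (\<Sum>u\<in>U0. f (tv u ** A)) / card U0"

lemma comp_0: "comp 0 f A = of_real (Pr f A)"
  by (simp add: comp_def Pr_def chi_simps)

lemma comp_isotypic:
  assumes "v \<in> U0"
  shows "comp a f (tv v ** A) = chi a (- v) * comp a f A"
proof -
  have "(\<Sum>u\<in>U0. chi a u * of_real (f (tv u ** (tv v ** A)))) = (\<Sum>u\<in>U0. chi a (- v) * (chi a (u + v) * of_real (f (tv (u + v) ** A))))"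
  proof (intro sum.cong refl)
    fix u assume "u \<in> U0"
    have "chi a (- v) * chi a (u + v) = chi a u" by (simp flip: chi_simps(1))
    thus "chi a u * of_real (f (tv u ** (tv v ** A))) = chi a (- v) * (chi a (u + v) * of_real (f (tv (u + v) ** A)))"
      using assms by (simp add: matrix_mul_assoc tv_add flip: mult.assoc)
  qed
  also have "\<dots> = chi a (- v) * (\<Sum>u\<in>U0. chi a u * of_real (f (tv u ** A)))"
    using sum_U0_shift[OF assms, of "\<lambda>u. chi a u * of_real (f (tv u ** A))"] by (simp add: sum_distrib_left[symmetric])
  finally show ?thesis by (simp add: comp_def)
qed

lemma comp_T: "comp a (T f) A = Tc (comp a f) A"
proof -
  have "(\<Sum>u\<in>U0. chi a u * of_real (T f (tv u ** A))) =
    (\<Sum>Z\<in>GL. of_real (nu Z) * (\<Sum>u\<in>U0. chi a u * of_real (f (tv u ** (A ** Z)))))"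
    unfolding T_def of_real_sum sum_distrib_left
    by (subst sum.swap) (simp add: matrix_mul_assoc mult_ac)
  thus ?thesis by (simp add: comp_def Tc_def flip: sum_divide_distrib)
qed

lemma parseval: "complex_of_real (ip f g) = (\<Sum>a\<in>U0. \<Sum>A\<in>GL. comp a f A * cnj (comp a g A))"
proof -
  let ?N = "of_nat (card U0) :: complex"
  have N: "?N \<noteq> 0" using card_U0_pos by (metis of_nat_eq_0_iff less_irrefl)
  have orth: "(\<Sum>a\<in>U0. chi a u * chi a (- v)) = (if u = v then ?N else 0)" if "u \<in> U0" "v \<in> U0" for u v
  proof -
    have "(\<Sum>a\<in>U0. chi a u * chi a (- v)) = (\<Sum>a\<in>U0. chi (u - v) a)"
      by (intro sum.cong refl) (metis chi_commute chi_simps(1) diff_conv_add_uminus)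
    thus ?thesis using chi_sum[of "u - v"] that by (simp add: U0_closed)
  qed
  have "(\<Sum>a\<in>U0. \<Sum>A\<in>GL. comp a f A * cnj (comp a g A)) =
    (\<Sum>a\<in>U0. \<Sum>A\<in>GL. \<Sum>u\<in>U0. \<Sum>v\<in>U0. (chi a u * chi a (- v)) * of_real (f (tv u ** A) * g (tv v ** A))) / ?N\<^sup>2"
    unfolding sum_divide_distrib
    by (intro sum.cong refl)
       (simp add: comp_def sum_product chi_simps power2_eq_square mult_ac flip: sum_divide_distrib)
  also have "(\<Sum>a\<in>U0. \<Sum>A\<in>GL. \<Sum>u\<in>U0. \<Sum>v\<in>U0. (chi a u * chi a (- v)) * of_real (f (tv u ** A) * g (tv v ** A))) =
    (\<Sum>A\<in>GL. \<Sum>u\<in>U0. \<Sum>v\<in>U0. (\<Sum>a\<in>U0. chi a u * chi a (- v)) * of_real (f (tv u ** A) * g (tv v ** A)))"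
    unfolding sum_distrib_right
    by (rule trans[OF sum.swap], rule sum.cong[OF refl], rule trans[OF sum.swap],
        rule sum.cong[OF refl], rule sum.swap)
  also have "\<dots> = (\<Sum>A\<in>GL. \<Sum>u\<in>U0. \<Sum>v\<in>U0. if u = v then ?N * of_real (f (tv u ** A) * g (tv u ** A)) else 0)"
    by (intro sum.cong refl) (simp add: orth)
  also have "\<dots> = (\<Sum>A\<in>GL. \<Sum>u\<in>U0. ?N * of_real (f (tv u ** A) * g (tv u ** A)))"
    by (intro sum.cong refl) simp
  also have "\<dots> = (\<Sum>u\<in>U0. ?N * of_real (\<Sum>A\<in>GL. f (tv u ** A) * g (tv u ** A)))"
    by (subst sum.swap) (simp add: sum_distrib_left)
  also have "\<dots> = (\<Sum>u\<in>U0. ?N * of_real (ip f g))"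
    unfolding ip_def by (intro sum.cong refl) (simp add: sum_GL_left[OF tv_GL, of _ "\<lambda>A. f A * g A"])
  also have "\<dots> = ?N\<^sup>2 * of_real (ip f g)" by (simp add: power2_eq_square)
  finally show ?thesis using N by simp
qed

text \<open>\<open>T\<close> multiplies on the right and the transvections on the left, so
  \<open>T\<close> respects the character decomposition. The trivial component cancels, and
  \<open>Tc_isotypic\<close> treats the others.\<close>

lemma contraction:
  "ip f (T f) - ip (Pr f) (T (Pr f)) \<le> sqrt lam2 * (ip f f - ip (Pr f) (Pr f))"
proof -
  define n2 where "n2 a = (\<Sum>A\<in>GL. (cmod (comp a f A))\<^sup>2)" for a
  have zero: "(\<Sum>A\<in>GL. comp 0 f A * cnj (comp 0 g A)) = of_real (ip (Pr f) (Pr g))" for g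
    by (simp add: comp_0 ip_def)
  have PrT: "Pr (T f) A = T (Pr f) A" for A
  proof -
    have "complex_of_real (Pr (T f) A) = of_real (T (Pr f) A)"
      unfolding comp_0[symmetric] comp_T by (simp add: Tc_def T_def comp_0)
    thus ?thesis by simp
  qed
  have "complex_of_real (ip f f) = of_real (ip (Pr f) (Pr f)) + (\<Sum>a\<in>U0-{0}. of_real (n2 a))"
  proof -
    have "complex_of_real (n2 a) = (\<Sum>A\<in>GL. comp a f A * cnj (comp a f A))" for a
      unfolding n2_def of_real_sum complex_norm_square ..
    thus ?thesis
      unfolding parseval[of f f] by (subst sum.remove[of U0 0]) (simp_all add: U0_closed zero)
  qed
  hence norm: "ip f f - ip (Pr f) (Pr f) = (\<Sum>a\<in>U0-{0}. n2 a)"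
    by (simp flip: of_real_sum of_real_add)
  have "complex_of_real (ip f (T f)) = of_real (ip (Pr f) (Pr (T f))) + (\<Sum>a\<in>U0-{0}. \<Sum>A\<in>GL. comp a f A * cnj (comp a (T f) A))"
    unfolding parseval[of f "T f"] by (subst sum.remove[of U0 0]) (simp_all add: U0_closed zero)
  moreover have "ip (Pr f) (Pr (T f)) = ip (Pr f) (T (Pr f))" by (simp add: ip_def PrT)
  ultimately have "complex_of_real (ip f (T f) - ip (Pr f) (T (Pr f))) =
      (\<Sum>a\<in>U0-{0}. \<Sum>A\<in>GL. comp a f A * cnj (comp a (T f) A))"
    by simp
  hence "\<bar>ip f (T f) - ip (Pr f) (T (Pr f))\<bar> = cmod (\<Sum>a\<in>U0-{0}. \<Sum>A\<in>GL. comp a f A * cnj (comp a (T f) A))"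
    by (metis norm_of_real)
  also have "\<dots> \<le> (\<Sum>a\<in>U0-{0}. cmod (\<Sum>A\<in>GL. comp a f A * cnj (comp a (T f) A)))"
    by (rule norm_sum)
  also have "\<dots> \<le> (\<Sum>a\<in>U0-{0}. sqrt lam2 * n2 a)"
  proof (rule sum_mono)
    fix a assume a: "a \<in> U0 - {0}"
    have "(cmod (\<Sum>A\<in>GL. comp a f A * cnj (comp a (T f) A)))\<^sup>2 \<le> n2 a * (\<Sum>A\<in>GL. (cmod (cnj (comp a (T f) A)))\<^sup>2)"
      unfolding n2_def by (rule cauchy_schwarz_complex)
    also have "\<dots> = n2 a * (\<Sum>A\<in>GL. (cmod (Tc (comp a f) A))\<^sup>2)" by (simp add: comp_T)
    also have "\<dots> \<le> n2 a * (lam2 * n2 a)"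
      unfolding n2_def using a
      by (intro mult_left_mono Tc_isotypic[of a] comp_isotypic) (auto intro: sum_nonneg)
    also have "\<dots> = (sqrt lam2 * n2 a)\<^sup>2" using lam2_nonneg by (simp add: power2_eq_square mult_ac)
    finally show "cmod (\<Sum>A\<in>GL. comp a f A * cnj (comp a (T f) A)) \<le> sqrt lam2 * n2 a"
      by (rule power2_le_imp_le) (simp add: n2_def sum_nonneg lam2_nonneg)
  qed
  also have "\<dots> = sqrt lam2 * (ip f f - ip (Pr f) (Pr f))" by (simp add: norm sum_distrib_left)
  finally show ?thesis by linarith
qed

end

section \<open>The spectral bound\<close>

lemma dotv_mul: "dotv w (A *v x) = dotv (w v* A) x"
proof -
  have "dotv w (A *v x) = (\<Sum>i\<in>UNIV. \<Sum>j\<in>UNIV. w $ i * A $ i $ j * x $ j)"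
    by (simp add: dotv_def matrix_vector_mult_def sum_distrib_left mult.assoc)
  also have "\<dots> = dotv (w v* A) x"
    by (subst sum.swap) (simp add: dotv_def vector_matrix_mult_def sum_distrib_left mult_ac)
  finally show ?thesis .
qed

definition diag_at :: "'n \<Rightarrow> 'k::field \<Rightarrow> 'k ^ 'n ^ 'n" where
  "diag_at i c = (\<chi> j l. if j = l then (if j = i then c else 1) else 0)"

lemma det_diag_at: "det (diag_at i c) = c"
proof -
  have "det (diag_at i c) = (\<Prod>j\<in>UNIV. if j = i then c else 1)"
    by (subst det_diagonal) (simp_all add: diag_at_def)
  thus ?thesis by simp
qed

lemma card_det_eq:
  fixes c :: "'k::{field,finite}"
  assumes "c \<noteq> 0"
  shows "(CARD('k) - 1) * card {A \<in> GL :: ('k ^ 'n::finite ^ 'n) set. det A = c} = card (GL :: ('k ^ 'n ^ 'n) set)"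
proof -
  define f where "f x = card {A \<in> GL :: ('k ^ 'n ^ 'n) set. det A = x}" for x
  have le: "f x \<le> f y" if "x \<noteq> 0" "y \<noteq> 0" for x y
  proof -
    let ?D = "diag_at (undefined :: 'n) (y / x) :: 'k ^ 'n ^ 'n"
    have D: "?D \<in> GL" using that by (simp add: GL_iff_det det_diag_at)
    show ?thesis unfolding f_def
    proof (rule card_inj_on_le[of "\<lambda>A. ?D ** A"])
      show "inj_on (\<lambda>A. ?D ** A) {A \<in> GL. det A = x}"
        using bij_GL_left[OF D] by (auto simp: bij_betw_def inj_on_def)
      show "(\<lambda>A. ?D ** A) ` {A \<in> GL. det A = x} \<subseteq> {A \<in> GL. det A = y}"
        using D that by (auto simp: GL_mult det_mul det_diag_at)
    qed simp
  qed
  have "card (GL :: ('k ^ 'n ^ 'n) set) = card (\<Union>x\<in>UNIV - {0}. {A \<in> GL :: ('k ^ 'n ^ 'n) set. det A = x})"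
    by (rule arg_cong[where f = card]) (auto simp: GL_iff_det)
  also have "\<dots> = (\<Sum>x\<in>UNIV - {0}. f x)"
    unfolding f_def by (rule card_UN_disjoint) auto
  also have "\<dots> = (\<Sum>x\<in>UNIV - {0::'k}. f c)"
    by (rule sum.cong) (use le assms in \<open>auto intro: antisym\<close>)
  also have "\<dots> = (CARD('k) - 1) * f c" by (simp add: card_Diff_singleton)
  finally show ?thesis by (simp add: f_def)
qed

context conj_weight
begin

definition lt :: "'k ^ 'n ^ 'n \<Rightarrow> ('k ^ 'n ^ 'n \<Rightarrow> real) \<Rightarrow> 'k ^ 'n ^ 'n \<Rightarrow> real" where
  "lt C f A = f (C ** A)"

text \<open>An energy that no average over a conjugate of the transvection group can raise, by
  \<open>Psi_Pr\<close> and \<open>Psi_lt\<close>.\<close>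

definition Psi :: "('k ^ 'n ^ 'n \<Rightarrow> real) \<Rightarrow> real" where
  "Psi f = sqrt lam2 * ip f f - ip f (T f)"

lemma ip_lt: "C \<in> GL \<Longrightarrow> ip (lt C f) (lt C g) = ip f g"
  unfolding ip_def lt_def by (rule sum_GL_left)

lemma T_lt: "T (lt C f) = lt C (T f)"
  by (rule ext) (simp add: T_def lt_def matrix_mul_assoc)

lemma Psi_lt: "C \<in> GL \<Longrightarrow> Psi (lt C f) = Psi f"
  by (simp add: Psi_def T_lt ip_lt)

lemma Psi_Pr: "Psi (Pr f) \<le> Psi f"
  using contraction[of f] by (simp add: Psi_def algebra_simps)

lemma Pr_tv: "v \<in> U0 \<Longrightarrow> Pr f (tv v ** A) = Pr f A"
  using sum_U0_shift[of v "\<lambda>u. f (tv u ** A)"] by (simp add: Pr_def matrix_mul_assoc tv_add)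

lemma ip_Pr: "ip f (Pr g) = ip (Pr f) g"
proof -
  have "ip f (Pr g) = (\<Sum>u\<in>U0. \<Sum>A\<in>GL. f A * g (tv u ** A)) / card U0"
    unfolding ip_def Pr_def by (simp add: sum_distrib_left flip: sum_divide_distrib) (subst sum.swap, simp)
  also have "(\<Sum>u\<in>U0. \<Sum>A\<in>GL. f A * g (tv u ** A)) = (\<Sum>u\<in>U0. \<Sum>A\<in>GL. f (tv (- u) ** A) * g A)"
  proof (rule sum.cong[OF refl])
    fix u assume u: "u \<in> U0"
    have "(\<Sum>A\<in>GL. f A * g (tv u ** A)) = (\<Sum>A\<in>GL. f (tv (- u) ** A) * g (tv u ** (tv (- u) ** A)))"
      using sum_GL_left[OF tv_GL, of "- u" "\<lambda>A. f A * g (tv u ** A)"] u by (simp add: U0_closed)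
    thus "(\<Sum>A\<in>GL. f A * g (tv u ** A)) = (\<Sum>A\<in>GL. f (tv (- u) ** A) * g A)"
      using u by (simp add: matrix_mul_assoc tv_add U0_closed tv_0)
  qed
  also have "\<dots> = (\<Sum>u\<in>U0. \<Sum>A\<in>GL. f (tv u ** A) * g A)"
    by (rule sum_U0_minus)
  also have "\<dots> / card U0 = ip (Pr f) g"
    unfolding ip_def Pr_def by (simp add: sum_distrib_right flip: sum_divide_distrib) (subst sum.swap, simp)
  finally show ?thesis .
qed

lemma Pr_Pr: "Pr (Pr f) = Pr f"
proof
  fix A
  have "(\<Sum>u\<in>U0. Pr f (tv u ** A)) = (\<Sum>u\<in>U0. Pr f A)" by (intro sum.cong refl Pr_tv)
  thus "Pr (Pr f) A = Pr f A" using U0_closed(1) by (auto simp: Pr_def[of "Pr f"])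
qed

lemma ip_minus_Pr: "ip (\<lambda>A. f A - Pr f A) (\<lambda>A. f A - Pr f A) = ip f f - ip (Pr f) (Pr f)"
proof -
  have "ip (\<lambda>A. f A - Pr f A) (\<lambda>A. f A - Pr f A) = ip f f - 2 * ip f (Pr f) + ip (Pr f) (Pr f)"
    unfolding ip_def by (simp add: sum.distrib sum_subtractf sum_distrib_left algebra_simps)
  also have "ip f (Pr f) = ip (Pr f) (Pr f)" using ip_Pr[of f "Pr f"] by (simp add: Pr_Pr)
  finally show ?thesis by simp
qed

text \<open>Instead of iterating averages, one takes a point of least norm among functions with
  energy at most \<open>Psi b\<close> and the determinant sums of \<open>b\<close>. Averaging stays
  in this set and strictly shortens what is not yet invariant, so the minimiser is invariant under
  all transvections, hence under SL.\<close>

lemma exists_SL_invariant: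
  assumes b0: "\<And>A. A \<notin> GL \<Longrightarrow> b A = 0"
  shows "\<exists>f. Psi f \<le> Psi b \<and>
    (\<forall>c. (\<Sum>A\<in>GL. if det A = c then f A else 0) = (\<Sum>A\<in>GL. if det A = c then b A else 0)) \<and>
    (\<forall>A\<in>GL. \<forall>B\<in>GL. det A = det B \<longrightarrow> f A = f B)"
proof -
  \<comment> \<open>Vectors of a Euclidean space, so that closedness alone yields a point of least
    norm; vanishing off \<open>GL\<close> makes that norm agree with \<open>ip\<close>.\<close>
  define K where "K = {x :: real ^ ('k ^ 'n ^ 'n). (\<forall>A. (if A \<in> GL then 0 else x $ A) = 0) \<and>
     Psi (\<lambda>A. x $ A) \<le> Psi b \<and>
     (\<forall>c. (\<Sum>A\<in>GL. if det A = c then x $ A else 0) = (\<Sum>A\<in>GL. if det A = c then b A else 0))}"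
  have "closed K" unfolding K_def
  proof (intro closed_Collect_conj closed_Collect_all)
    fix A :: "'k ^ 'n ^ 'n"
    show "closed {x :: real ^ ('k ^ 'n ^ 'n). (if A \<in> GL then 0 else x $ A) = 0}"
      by (cases "A \<in> GL") (auto intro!: closed_Collect_eq continuous_intros)
  next
    show "closed {x :: real ^ ('k ^ 'n ^ 'n). Psi (($) x) \<le> Psi b}"
      unfolding Psi_def ip_def T_def by (intro closed_Collect_le continuous_intros)
  next
    fix c :: 'k
    have "continuous_on UNIV (\<lambda>x :: real ^ ('k ^ 'n ^ 'n). if det A = c then x $ A else 0)" for A :: "'k ^ 'n ^ 'n"
      by (cases "det A = c") (auto intro!: continuous_intros)
    thus "closed {x :: real ^ ('k ^ 'n ^ 'n). (\<Sum>A\<in>GL. if det A = c then x $ A else 0) = (\<Sum>A\<in>GL. if det A = c then b A else 0)}"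
      by (intro closed_Collect_eq continuous_on_sum continuous_on_const)
  qed
  have vec_eta: "($) (\<chi> A. h A) = h" for h :: "'k ^ 'n ^ 'n \<Rightarrow> real"
    by (rule ext) simp
  have "(\<chi> A. b A) \<in> K" unfolding K_def using b0 by (simp add: vec_eta cong: if_cong)
  hence "K \<noteq> {}" by blast
  have "\<exists>x\<in>K. \<forall>y\<in>K. dist 0 x \<le> dist 0 y"
    by (rule distance_attains_inf[OF \<open>closed K\<close> \<open>K \<noteq> {}\<close>]) blast
  then obtain x where x: "x \<in> K" "\<And>y. y \<in> K \<Longrightarrow> dist 0 x \<le> dist 0 y" by blast
  define f where "f = (\<lambda>A. x $ A)"
  have f0: "f A = 0" if "A \<notin> GL" for A using x(1) that unfolding K_def f_def by (auto split: if_splits)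
  have fPsi: "Psi f \<le> Psi b" using x(1) by (simp add: K_def f_def)
  have fdet: "(\<Sum>A\<in>GL. if det A = c then f A else 0) = (\<Sum>A\<in>GL. if det A = c then b A else 0)" for c
    using x(1) unfolding f_def K_def by blast
  have norm_ip: "(norm y)\<^sup>2 = ip (\<lambda>A. y $ A) (\<lambda>A. y $ A)" if "\<And>A. A \<notin> GL \<Longrightarrow> y $ A = 0"
    for y :: "real ^ ('k ^ 'n ^ 'n)"
  proof -
    have "(norm y)\<^sup>2 = (\<Sum>A\<in>UNIV. y $ A * y $ A)" by (simp add: power2_norm_eq_inner inner_vec_def)
    also have "\<dots> = ip (\<lambda>A. y $ A) (\<lambda>A. y $ A)"
      unfolding ip_def by (rule sum.mono_neutral_right) (use that in auto)
    finally show ?thesis .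
  qed
  have inv: "f (C ** (tv v ** A)) = f (C ** A)" if C: "C \<in> GL" and v: "v \<in> U0" for C v A
  proof -
    obtain C' where C': "C' \<in> GL" "C ** C' = mat 1" "C' ** C = mat 1" using C by (rule GL_inverse)
    \<comment> \<open>The average of \<open>f\<close> over the conjugate group of all
      \<open>C ** tv u ** C'\<close>.\<close>
    define g where "g = lt C' (Pr (lt C f))"
    have g0: "g A = 0" if "A \<notin> GL" for A
      unfolding g_def lt_def Pr_def using that by (simp add: f0 GL_mult_iff)
    have "(\<chi> A. g A) \<in> K"
    proof -
      have "Psi g \<le> Psi b"
        using Psi_lt[OF C'(1), of "Pr (lt C f)"] Psi_Pr[of "lt C f"] Psi_lt[OF C, of f] fPsi
        by (simp add: g_def)
      moreover have "(\<Sum>A\<in>GL. if det A = c then g A else 0) = (\<Sum>A\<in>GL. if det A = c then f A else 0)" for c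
      proof -
        have "(\<Sum>A\<in>GL. if det A = c then g A else 0) =
            (\<Sum>A\<in>GL. (\<Sum>u\<in>U0. if det A = c then f (C ** (tv u ** (C' ** A))) else 0) / card U0)"
          unfolding g_def lt_def Pr_def by (intro sum.cong refl) simp
        also have "\<dots> = (\<Sum>u\<in>U0. \<Sum>A\<in>GL. if det A = c then f (C ** (tv u ** (C' ** A))) else 0) / card U0"
          by (subst sum.swap) (simp add: sum_divide_distrib)
        also have "(\<Sum>u\<in>U0. \<Sum>A\<in>GL. if det A = c then f (C ** (tv u ** (C' ** A))) else 0) =
            (\<Sum>u\<in>U0. \<Sum>A\<in>GL. if det A = c then f A else 0)"
        proof (rule sum.cong[OF refl])
          fix u assume u: "u \<in> U0"
          let ?M = "C ** tv u ** C'"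
          have "det C * det C' = 1" using C'(2) by (metis det_I det_mul)
          hence "det ?M = 1" by (simp add: det_mul det_tv[OF u])
          hence dM: "det (?M ** A) = det A" for A by (metis det_mul mult_1)
          have M: "?M \<in> GL" using C C' tv_GL[OF u] by (simp add: GL_mult)
          have "(\<Sum>A\<in>GL. if det A = c then f (C ** (tv u ** (C' ** A))) else 0) =
              (\<Sum>A\<in>GL. if det (?M ** A) = c then f (?M ** A) else 0)"
            by (simp only: dM) (simp add: matrix_mul_assoc cong: if_cong)
          also have "\<dots> = (\<Sum>A\<in>GL. if det A = c then f A else 0)"
            by (rule sum_GL_left[OF M])
          finally show "(\<Sum>A\<in>GL. if det A = c then f (C ** (tv u ** (C' ** A))) else 0) =
              (\<Sum>A\<in>GL. if det A = c then f A else 0)" .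
        qed
        also have "\<dots> / card U0 = (\<Sum>A\<in>GL. if det A = c then f A else 0)"
          using U0_closed(1) by auto
        finally show ?thesis .
      qed
      ultimately show ?thesis unfolding K_def using g0 fdet by (simp add: vec_eta cong: if_cong)
    qed
    from x(2)[OF this] have "(norm x)\<^sup>2 \<le> (norm (\<chi> A. g A))\<^sup>2" by simp
    also have "(norm (\<chi> A. g A))\<^sup>2 = ip g g" using norm_ip[of "\<chi> A. g A"] g0 by (simp add: vec_eta)
    also have "\<dots> = ip (Pr (lt C f)) (Pr (lt C f))" unfolding g_def by (rule ip_lt[OF C'(1)])
    also have "(norm x)\<^sup>2 = ip f f" using norm_ip[of x] f0 by (simp add: f_def)
    also have "\<dots> = ip (lt C f) (lt C f)" by (rule ip_lt[OF C, symmetric])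
    finally have "ip (\<lambda>A. lt C f A - Pr (lt C f) A) (\<lambda>A. lt C f A - Pr (lt C f) A) \<le> 0"
      by (simp add: ip_minus_Pr)
    moreover have "ip (\<lambda>A. lt C f A - Pr (lt C f) A) (\<lambda>A. lt C f A - Pr (lt C f) A) \<ge> 0"
      unfolding ip_def by (intro sum_nonneg) simp
    ultimately have "(\<Sum>A\<in>GL. (lt C f A - Pr (lt C f) A) * (lt C f A - Pr (lt C f) A)) = 0"
      unfolding ip_def by linarith
    hence eq: "lt C f A = Pr (lt C f) A" if "A \<in> GL" for A
      using that by (subst (asm) sum_nonneg_eq_0_iff) auto
    show ?thesis
    proof (cases "A \<in> GL")
      case True
      hence "tv v ** A \<in> GL" using tv_GL[OF v] by (simp add: GL_mult)
      thus ?thesis using eq[of "tv v ** A"] eq[OF True] Pr_tv[OF v, of "lt C f" A] by (simp add: lt_def)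
    next
      case False
      thus ?thesis by (simp add: f0 GL_mult_iff)
    qed
  qed
  have trans: "f ((mat 1 + outer z y) ** B) = f B" if "dotv y z = 0" for y z B
  proof (cases "y = 0")
    case False
    \<comment> \<open>Each transvection lies in some conjugate of the fixed group: \<open>C'\<close>
      is chosen so that its row \<open>i0\<close> is the covector \<open>y\<close>.\<close>
    have "axis i0 1 \<noteq> (0 :: 'k ^ 'n)" by (simp add: axis_eq_0_iff)
    then obtain D where D: "D \<in> GL" "D *v axis i0 1 = y" using GL_transitive[OF _ False] by blast
    define C' where "C' = transpose D"
    have C'G: "C' \<in> GL" using D by (simp add: C'_def GL_iff_det)
    then obtain C where C: "C \<in> GL" "C' ** C = mat 1" "C ** C' = mat 1" by (rule GL_inverse)
    have row: "axis i0 1 v* C' = y" unfolding C'_def using D(2) by (metis transpose_matrix_vector transpose_transpose)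
    define u where "u = C' *v z"
    have "u $ i0 = dotv (axis i0 1) u" by (simp add: dotv_axis)
    also have "\<dots> = dotv y z" by (simp add: u_def dotv_mul row)
    finally have u: "u \<in> U0" using that by (simp add: U0_def)
    have "C ** tv u ** C' = mat 1 + outer z y"
    proof -
      have "C *v u = z" unfolding u_def by (simp add: matrix_vector_mul_assoc C)
      thus ?thesis
        by (simp add: tv_def matrix_add_ldistrib mult_add_distrib mul_outer outer_mul row C)
    qed
    hence "(mat 1 + outer z y) ** B = C ** (tv u ** (C' ** B))" by (simp add: matrix_mul_assoc)
    thus ?thesis using inv[OF C(1) u, of "C' ** B"] by (simp add: matrix_mul_assoc C)
  qed (simp add: outer_0)
  have "f A = f B" if AB: "A \<in> GL" "B \<in> GL" "det A = det B" for A B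
  proof -
    obtain B' where B': "B' \<in> GL" "B ** B' = mat 1" "B' ** B = mat 1" using AB(2) by (rule GL_inverse)
    have "det (A ** B') = 1" using B'(2) AB(3) by (metis det_I det_mul)
    from transvections_generate_SL[of f, OF trans this, of B]
    show ?thesis by (simp add: B' flip: matrix_mul_assoc)
  qed
  with fPsi fdet show ?thesis by blast
qed

text \<open>The invariant \<open>f\<close> is a function of the determinant with the same fibre sums
  as \<open>b\<close>. Each determinant class has weight at most 1/(q - 1), so \<open>T f\<close> is
  at most the mean of \<open>b\<close>; this bounds \<open>Psi f\<close>, and with it
  \<open>Psi b\<close>, from below.\<close>

theorem spectral_bound:
  assumes b: "\<And>A. b A \<ge> 0" "\<And>A. A \<notin> GL \<Longrightarrow> b A = 0"
    and nu_det: "\<And>c. c \<noteq> 0 \<Longrightarrow> (real CARD('k) - 1) * (\<Sum>Z\<in>GL. if det Z = c then nu Z else 0) \<le> 1"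
  shows "(\<Sum>A\<in>GL. b A * (\<Sum>Z\<in>GL. nu Z * b (A ** Z))) \<le>
    sqrt lam2 * (\<Sum>A\<in>GL. (b A)\<^sup>2) + (\<Sum>A\<in>GL. b A)\<^sup>2 / card (GL :: ('k ^ 'n ^ 'n) set)"
proof -
  obtain f where f: "Psi f \<le> Psi b"
    "\<And>c. (\<Sum>A\<in>GL. if det A = c then f A else 0) = (\<Sum>A\<in>GL. if det A = c then b A else 0)"
    "\<And>A B. A \<in> GL \<Longrightarrow> B \<in> GL \<Longrightarrow> det A = det B \<Longrightarrow> f A = f B"
    using exists_SL_invariant[of b, OF b(2)] by blast
  let ?G = "real (card (GL :: ('k ^ 'n ^ 'n) set))" and ?q = "real CARD('k) - 1"
  have q: "?q > 0" using card_gt_1_field[where 'k='k] by simp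
  define \<phi> where "\<phi> c = f (diag_at i0 c)" for c
  have f_phi: "f A = \<phi> (det A)" if "A \<in> GL" for A
    unfolding \<phi>_def using that f(3)[of A "diag_at i0 (det A)"] by (simp add: det_diag_at GL_iff_det)
  have fib: "?q * card {A \<in> GL :: ('k ^ 'n ^ 'n) set. det A = c} = ?G" if "c \<noteq> 0" for c :: 'k
  proof -
    have "real ((CARD('k) - 1) * card {A \<in> GL :: ('k ^ 'n ^ 'n) set. det A = c}) = ?G"
      by (simp only: card_det_eq[OF that])
    thus ?thesis using card_gt_1_field[where 'k='k] by (simp add: of_nat_diff)
  qed
  have fibsum: "(\<Sum>A\<in>GL. if det A = c then f A else 0) = ?G / ?q * \<phi> c" if "c \<noteq> 0" for c
  proof -
    have "(\<Sum>A\<in>GL. if det A = c then f A else 0) = (\<Sum>A\<in>{A \<in> GL :: ('k ^ 'n ^ 'n) set. det A = c}. \<phi> c)"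
      by (subst sum.inter_filter[symmetric]) (auto simp: f_phi intro!: sum.cong)
    also have "\<dots> = real (card {A \<in> GL :: ('k ^ 'n ^ 'n) set. det A = c}) * \<phi> c" by simp
    also have "real (card {A \<in> GL :: ('k ^ 'n ^ 'n) set. det A = c}) = ?G / ?q"
      using fib[OF that] q by (simp add: field_simps)
    finally show ?thesis .
  qed
  have G: "?G > 0" using card_GL_pos by simp
  have GLne: "(GL :: ('k ^ 'n ^ 'n) set) \<noteq> {}" using mat_1_GL by blast
  have phi_nonneg: "\<phi> c \<ge> 0" if "c \<noteq> 0" for c
  proof -
    have "?G / ?q * \<phi> c = (\<Sum>A\<in>GL. if det A = c then b A else 0)"
      using fibsum[OF that] f(2) by simp
    also have "\<dots> \<ge> 0" by (intro sum_nonneg) (simp add: b(1))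
    finally have "?G / ?q * \<phi> c \<ge> 0" .
    thus ?thesis using mult_le_cancel_left_pos[OF divide_pos_pos[OF G q], of 0 "\<phi> c"]
      by (simp only: mult_zero_right)
  qed
  have split: "(\<Sum>A\<in>GL. h A) = (\<Sum>c\<in>UNIV-{0}. \<Sum>A\<in>GL. if det A = c then h A else 0)"
    for h :: "'k ^ 'n ^ 'n \<Rightarrow> real"
  proof -
    have "(\<Sum>c\<in>UNIV-{0}. \<Sum>A\<in>GL. if det A = c then h A else 0) =
        (\<Sum>A\<in>GL. \<Sum>c\<in>UNIV-{0}. if det A = c then h A else 0)" by (rule sum.swap)
    also have "\<dots> = (\<Sum>A\<in>GL. h A)" by (rule sum.cong) (auto simp: GL_iff_det)
    finally show ?thesis by simp
  qed
  have sumf: "(\<Sum>A\<in>GL. f A) = (\<Sum>A\<in>GL. b A)" using split[of f] split[of b] by (simp add: f(2))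
  have sumphi: "(\<Sum>A\<in>GL. f A) = ?G / ?q * (\<Sum>c\<in>UNIV-{0}. \<phi> c)"
    using split[of f] by (simp add: fibsum sum_distrib_left)
  have Tf: "T f A \<le> (\<Sum>A\<in>GL. b A) / ?G" if A: "A \<in> GL" for A
  proof -
    have dA: "det A \<noteq> 0" using A by (simp add: GL_iff_det)
    have "T f A = (\<Sum>c\<in>UNIV-{0}. \<Sum>Z\<in>GL. if det Z = c then nu Z * f (A ** Z) else 0)"
      unfolding T_def by (rule split)
    also have "\<dots> = (\<Sum>c\<in>UNIV-{0}. (\<Sum>Z\<in>GL. if det Z = c then nu Z else 0) * \<phi> (det A * c))"
      unfolding sum_distrib_right
      by (intro sum.cong refl) (auto simp: f_phi GL_mult A det_mul)
    also have "\<dots> \<le> (\<Sum>c\<in>UNIV-{0}. 1 / ?q * \<phi> (det A * c))"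
    proof (intro sum_mono mult_right_mono)
      fix c :: 'k assume c: "c \<in> UNIV - {0}"
      show "(\<Sum>Z\<in>GL. if det Z = c then nu Z else 0) \<le> 1 / ?q"
        using nu_det[of c] c q by (simp add: field_simps)
      show "0 \<le> \<phi> (det A * c)" using c dA by (intro phi_nonneg) auto
    qed
    also have "\<dots> = 1 / ?q * (\<Sum>c\<in>UNIV-{0}. \<phi> (det A * c))" by (simp add: sum_distrib_left)
    also have "(\<Sum>c\<in>UNIV-{0}. \<phi> (det A * c)) = (\<Sum>c\<in>UNIV-{0}. \<phi> c)"
      by (rule sum.reindex_bij_witness[of _ "\<lambda>c. c / det A" "\<lambda>c. det A * c"]) (use dA in auto)
    also have "1 / ?q * (\<Sum>c\<in>UNIV-{0}. \<phi> c) = (\<Sum>A\<in>GL. f A) / ?G"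
      using sumphi GLne by simp
    finally show ?thesis by (simp add: sumf)
  qed
  have "ip f (T f) \<le> (\<Sum>A\<in>GL. f A * ((\<Sum>A\<in>GL. b A) / ?G))"
    unfolding ip_def by (intro sum_mono mult_left_mono Tf) (auto simp: f_phi GL_iff_det intro!: phi_nonneg)
  also have "\<dots> = (\<Sum>A\<in>GL. b A)\<^sup>2 / ?G"
    unfolding sum_distrib_right[symmetric] sumf by (simp add: power2_eq_square)
  finally have 1: "ip f (T f) \<le> (\<Sum>A\<in>GL. b A)\<^sup>2 / ?G" .
  have "0 \<le> sqrt lam2 * ip f f"
    using lam2_nonneg by (intro mult_nonneg_nonneg) (auto simp: ip_def intro!: sum_nonneg)
  with 1 f(1) have "ip b (T b) \<le> sqrt lam2 * ip b b + (\<Sum>A\<in>GL. b A)\<^sup>2 / ?G"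
    by (simp add: Psi_def)
  thus ?thesis by (simp add: ip_def T_def power2_eq_square)
qed

end

section \<open>The gap theorem\<close>

lemma GL_matrix_inv:
  assumes "P \<in> GL"
  shows "P ** matrix_inv P = mat 1" "matrix_inv P ** P = mat 1" "matrix_inv P \<in> GL"
proof -
  have "P ** matrix_inv P = mat 1 \<and> matrix_inv P ** P = mat 1"
    unfolding matrix_inv_def by (rule someI_ex) (use assms in \<open>simp add: GL_def invertible_def\<close>)
  thus "P ** matrix_inv P = mat 1" "matrix_inv P ** P = mat 1" by auto
  thus "matrix_inv P \<in> GL" by (auto simp: GL_def invertible_def)
qed

text \<open>The factor 5 is dictated by n = 3, q = 2, where 36 <= 40; from n = 3 on, the left side
  at most doubles.\<close>

lemma square_le_exponential:
  fixes n q :: nat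
  assumes q: "q \<ge> 2" and n: "n \<ge> 2"
  shows "n\<^sup>2 * q\<^sup>2 \<le> 5 * q ^ n"
  using n
proof (induction n rule: dec_induct)
  case (step n)
  show ?case
  proof (cases "n = 2")
    case True
    have "9 * q\<^sup>2 \<le> (5 * q) * q\<^sup>2" using q by (intro mult_right_mono) auto
    moreover have "(Suc n)\<^sup>2 * q\<^sup>2 = 9 * q\<^sup>2" using True by simp
    moreover have "5 * q ^ Suc n = 5 * q * q\<^sup>2" using True by (simp add: power2_eq_square power3_eq_cube)
    ultimately show ?thesis by (simp only:)
  next
    case False
    hence n: "n \<ge> 3" using step.hyps by simp
    have "(Suc n)\<^sup>2 = n\<^sup>2 + (2 * n + 1)" by (simp add: power2_eq_square)
    also have "2 * n + 1 \<le> n * n" using mult_le_mono1[OF n, of n] n by linarith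
    finally have "(Suc n)\<^sup>2 \<le> 2 * n\<^sup>2" by (simp add: power2_eq_square)
    hence "(Suc n)\<^sup>2 * q\<^sup>2 \<le> 2 * (n\<^sup>2 * q\<^sup>2)" by simp
    also have "\<dots> \<le> q * (5 * q ^ n)" by (rule mult_mono) (use step.IH q in auto)
    finally show ?thesis by simp
  qed
qed simp

text \<open>Here the fourth power of k enters: (k^2 n q)^2 <= (N/600)(5 N), so k times the
  eigenvalue bound is below an absolute constant less than 1.\<close>

lemma spectral_numeric:
  fixes k :: real and q n :: nat
  assumes "q \<ge> 2" "n \<ge> 2" "k \<ge> 0" "600 * k ^ 4 \<le> real q ^ n"
  shows "k * sqrt (n * q / real q ^ n) \<le> 2 / 5"
proof -
  let ?N = "real q ^ n"
  have N: "?N > 0" using assms by simp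
  have "real (n\<^sup>2 * q\<^sup>2) \<le> real (5 * q ^ n)" using square_le_exponential[OF assms(1,2)] by (simp only: of_nat_le_iff)
  hence nq: "(real n * q)\<^sup>2 \<le> 5 * ?N" by (simp add: power_mult_distrib)
  have "(k\<^sup>2 * (n * q))\<^sup>2 = k ^ 4 * (real n * q)\<^sup>2" by (simp add: power_mult_distrib)
  also have "\<dots> \<le> (?N / 600) * (5 * ?N)" using assms nq by (intro mult_mono) auto
  also have "\<dots> \<le> (4 / 25 * ?N)\<^sup>2" using N by (simp add: power2_eq_square)
  finally have "k\<^sup>2 * (n * q) \<le> 4 / 25 * ?N" by (rule power2_le_imp_le) (use N in auto)
  hence "(k * sqrt (n * q / ?N))\<^sup>2 \<le> (2 / 5)\<^sup>2"
    using N by (simp add: power_mult_distrib field_simps)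
  thus ?thesis by (rule power2_le_imp_le) simp
qed

section \<open>The random walk by conjugates of field multiplications\<close>

locale singer =
  fixes m :: "'k::{field,finite} ^ 'n::finite \<Rightarrow> 'k ^ 'n ^ 'n" and e :: "'k ^ 'n" and R :: "('k ^ 'n) set"
    and N g :: real
  assumes N_def: "N = real CARD('k) ^ CARD('n)" and g_def: "g = real (card (GL :: ('k ^ 'n ^ 'n) set))"
    and m_add: "m (u + v) = m u + m v" and m_comm: "m u *v v = m v *v u"
    and m_GL: "u \<noteq> 0 \<Longrightarrow> m u \<in> GL" and m_e: "m e = mat 1" and zero_R: "0 \<notin> R"
    and card_R: "card (- R) \<le> 2 * CARD('k) ^ (CARD('n) div 2)"
    and card_pairs: "card {(P, u). P \<in> GL \<and> u \<in> R \<and> m u ** P = P ** Z} \<le> CARD('n) * (CARD('k) ^ CARD('n) - 1)"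
    and card_det: "(CARD('k) - 1) * card {u. det (m u) = c} \<le> CARD('k) ^ CARD('n) - 1"
begin

lemma N_gt_1: "N - 1 > 0"
proof -
  have "real CARD('k) ^ CARD('n) > 1" using card_gt_1_field[where 'k='k] by (intro one_less_power) auto
  thus ?thesis by (simp add: N_def)
qed

lemma real_N1: "real (CARD('k) ^ CARD('n) - 1) = N - 1"
  using card_gt_1_field[where 'k='k] by (simp add: of_nat_diff N_def)

text \<open>The probability that the conjugate of \<open>m u\<close> by \<open>P\<close> is
  \<open>Z\<close>, for uniform \<open>P\<close> in \<open>GL\<close> and uniform nonzero
  \<open>u\<close>, counting only \<open>u\<close> in \<open>R\<close>. Dropping the other
  \<open>u\<close> costs a little mass and buys the density bound \<open>nu_le\<close>.\<close>

definition nu :: "'k ^ 'n ^ 'n \<Rightarrow> real" where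
  "nu Z = (\<Sum>P\<in>GL. \<Sum>u\<in>R. of_bool (m u ** P = P ** Z)) / ((N - 1) * g)"

lemma cG: "g > 0"
  using card_GL_pos by (simp add: g_def)

lemma nu_nonneg: "nu Z \<ge> 0"
  unfolding nu_def using N_gt_1 cG by (intro divide_nonneg_nonneg sum_nonneg) auto

lemma nu_comm:
  assumes A: "A \<in> GL"
  shows "nu (A ** Z) = nu (Z ** A)"
proof -
  obtain A' where A': "A' \<in> GL" "A ** A' = mat 1" "A' ** A = mat 1" using A by (rule GL_inverse)
  have "m u ** P = P ** (A ** Z) \<longleftrightarrow> m u ** (P ** A) = P ** A ** (Z ** A)" for u P
  proof
    assume "m u ** P = P ** (A ** Z)"
    hence "m u ** P ** A = P ** (A ** Z) ** A" by simp
    thus "m u ** (P ** A) = P ** A ** (Z ** A)" by (simp add: matrix_mul_assoc)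
  next
    assume "m u ** (P ** A) = P ** A ** (Z ** A)"
    hence "m u ** (P ** A) ** A' = P ** A ** (Z ** A) ** A'" by simp
    thus "m u ** P = P ** (A ** Z)" by (simp add: A' flip: matrix_mul_assoc)
  qed
  hence "(\<Sum>P\<in>GL. \<Sum>u\<in>R. of_bool (m u ** P = P ** (A ** Z)) :: real) =
      (\<Sum>P\<in>GL. \<Sum>u\<in>R. of_bool (m u ** (P ** A) = P ** A ** (Z ** A)))" by simp
  also have "\<dots> = (\<Sum>P\<in>GL. \<Sum>u\<in>R. of_bool (m u ** P = P ** (Z ** A)))"
    using sum_GL_right[OF A, of "\<lambda>P. \<Sum>u\<in>R. of_bool (m u ** P = P ** (Z ** A))"] .
  finally show ?thesis by (simp add: nu_def)
qed

lemma nu_le: "nu Z \<le> CARD('n) / g"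
proof -
  have "(\<Sum>P\<in>GL. \<Sum>u\<in>R. of_bool (m u ** P = P ** Z) :: real) =
      (\<Sum>(P, u)\<in>GL \<times> R. of_bool (m u ** P = P ** Z))"
    by (rule sum.cartesian_product)
  also have "\<dots> = (\<Sum>x\<in>GL \<times> R. of_bool (m (snd x) ** fst x = fst x ** Z))"
    by (rule sum.cong) auto
  also have "\<dots> = card {(P, u). P \<in> GL \<and> u \<in> R \<and> m u ** P = P ** Z}"
    by (subst sum_of_bool_eq) (auto intro!: arg_cong[where f = card])
  also have "\<dots> \<le> real (CARD('n) * (CARD('k) ^ CARD('n) - 1))"
    using card_pairs[of Z] by (simp only: of_nat_le_iff)
  also have "\<dots> = CARD('n) * (N - 1)"
    by (simp only: of_nat_mult real_N1)
  finally have "nu Z \<le> CARD('n) * (N - 1) / ((N - 1) * g)"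
    unfolding nu_def using N_gt_1 cG by (intro divide_right_mono) auto
  also have "\<dots> = CARD('n) / g" using N_gt_1 by simp
  finally show ?thesis .
qed

lemma sum_nu:
  "(\<Sum>Z\<in>GL. nu Z * h Z) = (\<Sum>P\<in>GL. \<Sum>u\<in>R. h (matrix_inv P ** m u ** P)) / ((N - 1) * g)"
  for h :: "'k ^ 'n ^ 'n \<Rightarrow> real"
proof -
  have one: "(\<Sum>Z\<in>GL. of_bool (m u ** P = P ** Z) * h Z) = h (matrix_inv P ** m u ** P)"
    if "P \<in> GL" "u \<in> R" for P u
  proof -
    have eq: "m u ** P = P ** Z \<longleftrightarrow> Z = matrix_inv P ** m u ** P" for Z
      using GL_matrix_inv[OF that(1)] by (metis matrix_mul_assoc matrix_mul_lid)
    have "m u \<in> GL" using that zero_R by (intro m_GL) auto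
    hence "matrix_inv P ** m u ** P \<in> GL" using GL_matrix_inv[OF that(1)] that by (simp add: GL_mult)
    thus ?thesis by (simp add: eq of_bool_def if_distrib[of "\<lambda>x. x * y" for y] cong: if_cong)
  qed
  have "(\<Sum>Z\<in>GL. (\<Sum>P\<in>GL. \<Sum>u\<in>R. of_bool (m u ** P = P ** Z)) * h Z) =
      (\<Sum>Z\<in>GL. \<Sum>P\<in>GL. \<Sum>u\<in>R. of_bool (m u ** P = P ** Z) * h Z)"
    by (simp only: sum_distrib_right)
  also have "\<dots> = (\<Sum>P\<in>GL. \<Sum>Z\<in>GL. \<Sum>u\<in>R. of_bool (m u ** P = P ** Z) * h Z)"
    by (rule sum.swap)
  also have "\<dots> = (\<Sum>P\<in>GL. \<Sum>u\<in>R. \<Sum>Z\<in>GL. of_bool (m u ** P = P ** Z) * h Z)"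
    by (rule sum.cong[OF refl], rule sum.swap)
  also have "\<dots> = (\<Sum>P\<in>GL. \<Sum>u\<in>R. h (matrix_inv P ** m u ** P))"
    by (intro sum.cong refl one)
  finally show ?thesis by (simp add: nu_def sum_divide_distrib[symmetric])
qed

lemma card_R_le: "real (card R) \<le> N - 1"
proof -
  have "card R \<le> card (UNIV - {0 :: 'k ^ 'n})" using zero_R by (intro card_mono) auto
  also have "\<dots> = CARD('k) ^ CARD('n) - 1" by (simp add: card_Diff_singleton)
  finally show ?thesis by (simp only: real_N1[symmetric] of_nat_le_iff)
qed

lemma sum_nu_le_1: "(\<Sum>Z\<in>GL. nu Z) \<le> 1"
proof -
  have "(\<Sum>Z\<in>GL. nu Z) = g * card R / ((N - 1) * g)"
    using sum_nu[of "\<lambda>_. 1"] by (simp add: g_def)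
  also have "\<dots> \<le> 1" using mult_left_mono[OF card_R_le, of g] N_gt_1 cG by (simp add: field_simps)
  finally show ?thesis .
qed

lemma nu_det:
  assumes "c \<noteq> 0"
  shows "(real CARD('k) - 1) * (\<Sum>Z\<in>GL. if det Z = c then nu Z else 0) \<le> 1"
proof -
  have det: "det (matrix_inv P ** m u ** P) = det (m u)" if "P \<in> GL" for P u
  proof -
    have "det (matrix_inv P) * det P = 1" using GL_matrix_inv(2)[OF that] by (metis det_I det_mul)
    thus ?thesis by (simp add: det_mul)
  qed
  have "(\<Sum>Z\<in>GL. if det Z = c then nu Z else 0) = (\<Sum>Z\<in>GL. nu Z * of_bool (det Z = c))"
    by (intro sum.cong refl) auto
  also have "\<dots> = (\<Sum>P\<in>(GL :: ('k ^ 'n ^ 'n) set). \<Sum>u\<in>R. of_bool (det (m u) = c)) / ((N - 1) * g)"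
    unfolding sum_nu by (intro arg_cong2[where f = "(/)"] sum.cong refl) (simp add: det)
  also have "\<dots> = card {u \<in> R. det (m u) = c} / (N - 1)"
    using cG by (simp add: sum_of_bool_eq Collect_conj_eq Int_commute flip: g_def)
  also have "\<dots> \<le> card {u. det (m u) = c} / (N - 1)"
    using N_gt_1 by (intro divide_right_mono) (auto intro!: card_mono)
  finally have "(real CARD('k) - 1) * (\<Sum>Z\<in>GL. if det Z = c then nu Z else 0) \<le>
      (real CARD('k) - 1) * (card {u. det (m u) = c} / (N - 1))"
    using card_gt_1_field[where 'k='k] by (intro mult_left_mono) auto
  also have "\<dots> = real ((CARD('k) - 1) * card {u. det (m u) = c}) / (N - 1)"
    using card_gt_1_field[where 'k='k] by (simp add: of_nat_diff)
  also have "\<dots> \<le> (N - 1) / (N - 1)"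
    using card_det[of c] N_gt_1 unfolding real_N1[symmetric]
    by (intro divide_right_mono) (simp_all only: of_nat_le_iff of_nat_0_le_iff)
  also have "\<dots> = 1" using N_gt_1 by simp
  finally show ?thesis .
qed

lemma card_hyperplane: "card {u :: 'k ^ 'n. u $ i = 0} * CARD('k) = CARD('k) ^ CARD('n)"
proof -
  have "bij_betw (\<lambda>(u, c). u + axis i c) ({u :: 'k ^ 'n. u $ i = 0} \<times> UNIV) UNIV"
    by (rule bij_betw_byWitness[of _ "\<lambda>v. (v - axis i (v $ i), v $ i)"])
       (auto simp: axis_component vec_eq_iff)
  from bij_betw_same_card[OF this] show ?thesis by (simp add: card_cartesian_product)
qed

text \<open>For n = 1 the transvection group is trivial, but then \<open>nu\<close> is at most 1/g
  pointwise and the bound is direct. Otherwise density and mass give g times the sum of squares at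
  most n, so \<open>lam2\<close> is at most n q / N.\<close>

lemma nu_form_bound:
  assumes B: "B \<subseteq> GL"
  shows "(\<Sum>L\<in>B. \<Sum>Z\<in>GL. nu Z * of_bool (L ** Z \<in> B)) \<le>
    (if CARD('n) = 1 then 0 else sqrt (CARD('n) * CARD('k) / N)) * card B + (card B)\<^sup>2 / g"
proof (cases "CARD('n) = 1")
  case True
  have "(\<Sum>Z\<in>GL. nu Z * of_bool (L ** Z \<in> B)) \<le> card B / g" if L: "L \<in> B" for L
  proof -
    have LG: "L \<in> GL" using L B by auto
    have "(\<Sum>Z\<in>GL. nu Z * of_bool (L ** Z \<in> B)) \<le> (\<Sum>Z\<in>GL. 1 / g * of_bool (L ** Z \<in> B))"
      using nu_le True by (intro sum_mono mult_right_mono) auto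
    also have "\<dots> = (\<Sum>Z\<in>GL. 1 / g * of_bool (Z \<in> B))"
      using sum_GL_left[OF LG, of "\<lambda>Z. 1 / g * of_bool (Z \<in> B)"] .
    also have "\<dots> = card B / g"
      using B by (simp add: sum_of_bool_eq Int_absorb1 flip: sum_distrib_left sum_divide_distrib)
    finally show ?thesis .
  qed
  hence "(\<Sum>L\<in>B. \<Sum>Z\<in>GL. nu Z * of_bool (L ** Z \<in> B)) \<le> (\<Sum>L\<in>B. card B / g)"
    by (rule sum_mono)
  thus ?thesis using True by (simp add: power2_eq_square)
next
  case False
  obtain \<psi> :: "'k \<Rightarrow> complex" where psi: "\<forall>x y. \<psi> (x + y) = \<psi> x * \<psi> y" "\<forall>x. norm (\<psi> x) = 1" "\<exists>x. \<psi> x \<noteq> 1"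
    using exists_additive_character by blast
  interpret conj_weight nu undefined \<psi>
    by standard (use psi nu_nonneg nu_comm in auto)
  have b: "(\<Sum>A\<in>GL. of_bool (A \<in> B) * (\<Sum>Z\<in>GL. nu Z * of_bool (A ** Z \<in> B))) \<le>
    sqrt lam2 * (\<Sum>A\<in>GL. (of_bool (A \<in> B))\<^sup>2) + (\<Sum>A\<in>GL. of_bool (A \<in> B))\<^sup>2 / real (card (GL :: ('k ^ 'n ^ 'n) set))"
    by (rule spectral_bound) (use B nu_det in auto)
  note b = b[folded g_def]
  have sB: "(\<Sum>A\<in>GL. of_bool (A \<in> B)) = real (card B)"
    using B by (simp add: sum_of_bool_eq Int_absorb1)
  have "(\<Sum>Z\<in>GL. (nu Z)\<^sup>2) \<le> (\<Sum>Z\<in>GL. CARD('n) / g * nu Z)"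
    unfolding power2_eq_square by (intro sum_mono mult_right_mono nu_le nu_nonneg)
  also have "\<dots> \<le> CARD('n) / g * 1"
    unfolding sum_distrib_left[symmetric] by (intro mult_left_mono sum_nu_le_1) (use cG in auto)
  finally have "g * (\<Sum>Z\<in>GL. (nu Z)\<^sup>2) \<le> CARD('n)" using cG by (simp add: field_simps)
  hence "lam2 \<le> CARD('n) / card U0"
    unfolding lam2_def g_def[symmetric] by (intro divide_right_mono) auto
  also have "\<dots> = CARD('n) * CARD('k) / N"
  proof -
    have "real (card U0) * CARD('k) = N"
      using arg_cong[OF card_hyperplane[of undefined], of real] by (simp add: U0_def N_def)
    hence "CARD('n) * CARD('k) / N = real CARD('n) * CARD('k) / (card U0 * CARD('k))" by simp
    thus ?thesis using card_gt_1_field[where 'k='k] by simp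
  qed
  finally have "sqrt lam2 * card B \<le> sqrt (CARD('n) * CARD('k) / N) * card B"
    by (intro mult_right_mono) auto
  moreover have "(\<Sum>L\<in>B. \<Sum>Z\<in>GL. nu Z * of_bool (L ** Z \<in> B)) =
      (\<Sum>A\<in>GL. of_bool (A \<in> B) * (\<Sum>Z\<in>GL. nu Z * of_bool (A ** Z \<in> B)))"
    by (rule sum.mono_neutral_cong_left) (use B in auto)
  ultimately show ?thesis using b False by (simp add: sB power2_eq_square[of "of_bool _"] flip: of_bool_conj)
qed

lemma m_0: "m 0 = 0"
  using m_add[of 0 0] by simp

text \<open>The grid has entries \<open>f (y + Lt + L P\<^sup>-\<^sup>1 m(Q(z - a)) (Pt + s))\<close> for \<open>t, z \<in> T\<close>. As \<open>m w x = m x w\<close>,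
  every row and every column is affine in the free index; the row \<open>z = a\<close> is the constraint with linear part \<open>L\<close>.\<close>

lemma grid:
  fixes f :: "'k ^ 'n \<Rightarrow> 'a::ab_group_add" and T :: "('k ^ 'n) set"
  defines "Bad \<equiv> {L \<in> GL. \<exists>y. (\<Sum>t\<in>T. f (y + L *v t)) \<noteq> 0}"
  assumes L: "L \<in> Bad" and P: "P \<in> GL" and Q: "Q \<in> GL" and a: "a \<in> T"
    and s: "\<And>t. t \<in> T \<Longrightarrow> P *v t + s \<noteq> 0"
  shows "(\<exists>z\<in>T-{a}. m (e + Q *v (z - a)) \<in> GL \<longrightarrow> L ** (matrix_inv P ** m (e + Q *v (z - a)) ** P) \<in> Bad) \<or>
    (\<exists>t\<in>T. L ** matrix_inv P ** m (P *v t + s) ** Q \<in> Bad)"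
proof (rule ccontr)
  assume "\<not> ?thesis"
  hence rows: "\<And>z. z \<in> T - {a} \<Longrightarrow> m (e + Q *v (z - a)) \<in> GL \<and> L ** (matrix_inv P ** m (e + Q *v (z - a)) ** P) \<notin> Bad"
    and cols: "\<And>t. t \<in> T \<Longrightarrow> L ** matrix_inv P ** m (P *v t + s) ** Q \<notin> Bad" by auto
  have LG: "L \<in> GL" using L by (simp add: Bad_def)
  let ?P' = "matrix_inv P"
  note P' = GL_matrix_inv[OF P]
  have good: "(\<Sum>t\<in>T. f (y + A *v t)) = 0" if "A \<in> GL" "A \<notin> Bad" for A y
    using that by (auto simp: Bad_def)
  have "(\<Sum>t\<in>T. f (y + L *v t)) = 0" for y
  proof -
    define F where "F t z = f (y + L *v t + (L ** ?P' ** m (Q *v (z - a))) *v (P *v t + s))" for t z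
    have col: "(\<Sum>z\<in>T. F t z) = 0" if t: "t \<in> T" for t
    proof -
      let ?A = "L ** ?P' ** m (P *v t + s) ** Q"
      have "?A \<in> GL" using LG P' Q m_GL[OF s[OF t]] by (simp add: GL_mult)
      moreover have "F t z = f ((y + L *v t - ?A *v a) + ?A *v z)" for z
      proof -
        have "(L ** ?P' ** m (Q *v (z - a))) *v (P *v t + s) = (L ** ?P') *v (m (Q *v (z - a)) *v (P *v t + s))"
          by (simp add: matrix_vector_mul_assoc)
        also have "\<dots> = ?A *v (z - a)"
          by (subst m_comm) (simp add: matrix_vector_mul_assoc matrix_mul_assoc)
        finally have eq: "(L ** ?P' ** m (Q *v (z - a))) *v (P *v t + s) = ?A *v z - ?A *v a"
          by (simp only: matrix_vector_mult_diff_distrib)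
        show ?thesis unfolding F_def eq by (simp add: algebra_simps)
      qed
      ultimately show ?thesis using good cols[OF t] by simp
    qed
    have row: "(\<Sum>t\<in>T. F t z) = 0" if z: "z \<in> T - {a}" for z
    proof -
      let ?w = "Q *v (z - a)"
      let ?C = "L ** (?P' ** m (e + ?w) ** P)"
      have "?C \<in> GL" using LG P' P rows[OF z] by (simp add: GL_mult)
      moreover have "F t z = f ((y + (L ** ?P' ** m ?w) *v s) + ?C *v t)" for t
      proof -
        have "?C = L ** (?P' ** P) + L ** ?P' ** m ?w ** P"
          by (simp add: m_add m_e mult_add_distrib matrix_add_ldistrib matrix_mul_assoc)
        hence "?C *v t = L *v t + (L ** ?P' ** m ?w) *v (P *v t)"
          by (simp add: P' matrix_vector_mult_add_rdistrib matrix_vector_mul_assoc)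
        hence eq: "?C *v t = L *v t + (L ** ?P' ** m ?w) *v (P *v t)" .
        show ?thesis unfolding F_def eq matrix_vector_right_distrib by (simp add: add_ac)
      qed
      ultimately show ?thesis using good rows[OF z] by simp
    qed
    have "0 = (\<Sum>t\<in>T. \<Sum>z\<in>T. F t z)" by (simp add: col)
    also have "\<dots> = (\<Sum>z\<in>T. \<Sum>t\<in>T. F t z)" by (rule sum.swap)
    also have "\<dots> = (\<Sum>t\<in>T. F t a) + (\<Sum>z\<in>T-{a}. \<Sum>t\<in>T. F t z)"
      by (rule sum.remove) (use a in auto)
    also have "(\<Sum>z\<in>T-{a}. \<Sum>t\<in>T. F t z) = 0" by (rule sum.neutral) (use row in blast)
    finally show ?thesis by (simp add: F_def m_0)
  qed
  thus False using L by (simp add: Bad_def)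
qed

text \<open>Averaged over \<open>P\<close> and \<open>Q\<close>, the columns of the grid have
  uniform linear part and the rows are steps of the walk from \<open>L\<close>, up to the vectors
  outside \<open>R\<close>. Summed over \<open>L\<close> in \<open>Bad\<close>, the spectral bound
  leaves at most 2/5 + 1/100 + 1/5 + 1/100 where at least 1 is required.\<close>

theorem no_bad_linear_parts:
  fixes f :: "'k ^ 'n \<Rightarrow> 'a::ab_group_add" and T :: "('k ^ 'n) set"
  defines "Bad \<equiv> {L \<in> GL. \<exists>y. (\<Sum>t\<in>T. f (y + L *v t)) \<noteq> 0}"
  assumes k2: "card T \<ge> 2" and big: "600 * real (card T) ^ 4 \<le> N"
    and small: "100 * real (card T) * card Bad \<le> g"
  shows "Bad = {}"
proof (rule ccontr)
  assume ne: "Bad \<noteq> {}"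
  define k where "k = real (card T)"
  define nr where "nr = real (card (- R))"
  have k: "k \<ge> 2" using k2 by (simp add: k_def)
  have BG: "Bad \<subseteq> GL" by (auto simp: Bad_def)
  have "T \<noteq> {}" using k2 by auto
  then obtain a where a: "a \<in> T" by blast
  have "k ^ 1 \<le> k ^ 4" using k by (intro power_increasing) auto
  hence "k \<le> k ^ 4" by simp
  hence kN: "k < N" using big[folded k_def] k by linarith
  \<comment> \<open>As k < N, some shift avoids the k vectors -(P t); it keeps the column matrices
    invertible.\<close>
  have "\<exists>s. \<forall>t\<in>T. P *v t + s \<noteq> 0" for P :: "'k ^ 'n ^ 'n"
  proof -
    have "card ((\<lambda>t. - (P *v t)) ` T) \<le> card T" by (rule card_image_le) simp
    also have "\<dots> < CARD('k ^ 'n)" using kN unfolding k_def N_def by (simp flip: of_nat_power)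
    finally have "(\<lambda>t. - (P *v t)) ` T \<noteq> UNIV" by force
    then obtain s where "s \<notin> (\<lambda>t. - (P *v t)) ` T" by blast
    hence "\<forall>t\<in>T. P *v t + s \<noteq> 0" by (auto simp: eq_neg_iff_add_eq_0 add.commute)
    thus ?thesis by blast
  qed
  note ex_s = this
  define s where "s P = (SOME s. \<forall>t\<in>T. P *v t + s \<noteq> 0)" for P :: "'k ^ 'n ^ 'n"
  have s: "P *v t + s P \<noteq> 0" if "t \<in> T" for P t
    using someI_ex[OF ex_s[of P]] that unfolding s_def by blast
  define S where "S L = (\<Sum>Z\<in>GL. nu Z * of_bool (L ** Z \<in> Bad))" for L
  have key: "1 \<le> k * S L + k * nr / (N - 1) + k * card Bad / g" if L: "L \<in> Bad" for L
  proof -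
    \<comment> \<open>A singular \<open>m (e + w)\<close> counts as a failure. It arises only for e
      + w = 0, which is outside \<open>R\<close> and so is charged to \<open>nr\<close>.\<close>
    define br where "br P w = (of_bool (m (e + w) \<in> GL \<longrightarrow> L ** (matrix_inv P ** m (e + w) ** P) \<in> Bad) :: real)" for P w
    define bu where "bu P u = (of_bool (L ** (matrix_inv P ** m u ** P) \<in> Bad) :: real)" for P u
    define bc where "bc P t Q = (of_bool (L ** matrix_inv P ** m (P *v t + s P) ** Q \<in> Bad) :: real)" for P t Q
    have pt: "1 \<le> (\<Sum>z\<in>T-{a}. br P (Q *v (z - a))) + (\<Sum>t\<in>T. bc P t Q)"
      if PQ: "P \<in> GL" "Q \<in> GL" for P Q
    proof -
      have nn: "0 \<le> (\<Sum>z\<in>T-{a}. br P (Q *v (z - a)))" "0 \<le> (\<Sum>t\<in>T. bc P t Q)"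
        by (auto intro!: sum_nonneg simp: br_def bc_def)
      from grid[OF L[unfolded Bad_def] PQ a s[of _ P], folded Bad_def]
      consider (r) z where "z \<in> T - {a}" "br P (Q *v (z - a)) = 1"
        | (c) t where "t \<in> T" "bc P t Q = 1"
        by (auto simp: br_def bc_def)
      thus ?thesis
      proof cases
        case r
        have "br P (Q *v (z - a)) \<le> (\<Sum>z\<in>T-{a}. br P (Q *v (z - a)))"
          by (rule member_le_sum) (use r in \<open>auto simp: br_def\<close>)
        thus ?thesis using r nn by linarith
      next
        case c
        have "bc P t Q \<le> (\<Sum>t\<in>T. bc P t Q)"
          by (rule member_le_sum) (use c in \<open>auto simp: bc_def\<close>)
        thus ?thesis using c nn by linarith
      qed
    qed
    have colsum: "(\<Sum>Q\<in>GL. bc P t Q) = card Bad" if P: "P \<in> GL" and t: "t \<in> T" for P t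
    proof -
      have "L ** matrix_inv P ** m (P *v t + s P) \<in> GL"
        using L BG GL_matrix_inv[OF P] m_GL[OF s[OF t, of P]] by (auto simp: GL_mult)
      hence "(\<Sum>Q\<in>GL. bc P t Q) = (\<Sum>Q\<in>GL. of_bool (Q \<in> Bad))"
        unfolding bc_def by (rule sum_GL_left)
      thus ?thesis using BG by (simp add: sum_of_bool_eq Int_absorb1)
    qed
    have rowsum: "(N - 1) * (\<Sum>Q\<in>GL. br P (Q *v (z - a))) \<le>
        g * ((\<Sum>u\<in>R. bu P u) + nr)" if z: "z \<in> T - {a}" for P z
    proof -
      have "(\<Sum>w\<in>UNIV-{0}. br P w) \<le> (\<Sum>w\<in>UNIV. br P w)"
        by (rule sum_mono2) (auto simp: br_def)
      also have "\<dots> \<le> (\<Sum>w\<in>UNIV. of_bool (e + w \<in> R) * bu P (e + w) + of_bool (e + w \<notin> R))"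
      proof (rule sum_mono)
        fix w
        have "m (e + w) \<in> GL" if "e + w \<in> R" using that zero_R by (intro m_GL) auto
        thus "br P w \<le> of_bool (e + w \<in> R) * bu P (e + w) + of_bool (e + w \<notin> R)"
          by (auto simp: br_def bu_def)
      qed
      also have "\<dots> = (\<Sum>u\<in>UNIV. of_bool (u \<in> R) * bu P u + of_bool (u \<notin> R))"
        by (rule sum.reindex_bij_witness[of _ "\<lambda>u. u - e" "\<lambda>w. e + w"]) auto
      also have "\<dots> = (\<Sum>u\<in>R. bu P u) + nr"
      proof -
        have "(\<Sum>u\<in>UNIV. of_bool (u \<in> R) * bu P u) =
            (\<Sum>u\<in>R. bu P u)"
          by (rule sum.mono_neutral_cong_right) auto
        moreover have "(\<Sum>u\<in>UNIV. of_bool (u \<notin> R)) = nr"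
          by (simp add: nr_def sum_of_bool_eq Compl_eq)
        ultimately show ?thesis by (simp add: sum.distrib)
      qed
      finally have "(\<Sum>w\<in>UNIV-{0}. br P w) \<le> (\<Sum>u\<in>R. bu P u) + nr" .
      moreover have "(N - 1) * (\<Sum>Q\<in>GL. br P (Q *v (z - a))) = g * (\<Sum>w\<in>UNIV-{0}. br P w)"
        unfolding N_def g_def by (rule sum_GL_vec) (use z in auto)
      ultimately show ?thesis using cG by simp
    qed
    define W where "W = (\<Sum>P\<in>GL. \<Sum>u\<in>R. bu P u)"
    have WS: "W = (N - 1) * g * S L"
      using sum_nu[of "\<lambda>Z. of_bool (L ** Z \<in> Bad)"] N_gt_1 cG by (simp add: W_def S_def bu_def field_simps)
    have gs: "(\<Sum>P\<in>(GL :: ('k ^ 'n ^ 'n) set). c) = g * c" for c :: real by (simp add: g_def)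
    have lin: "(\<Sum>P\<in>GL. c1 * (c2 * (h P + c3)) + c4) = c1 * c2 * ((\<Sum>P\<in>GL. h P) + g * c3) + g * c4"
      for c1 c2 c3 c4 and h :: "'k ^ 'n ^ 'n \<Rightarrow> real"
      by (simp add: sum.distrib distrib_left sum_distrib_left mult_ac g_def)
    have kk: "real (card (T - {a})) \<le> k" by (simp add: k_def card_Diff_singleton_if)
    have "g * (g * 1) = (\<Sum>P\<in>(GL :: ('k ^ 'n ^ 'n) set). \<Sum>Q\<in>(GL :: ('k ^ 'n ^ 'n) set). 1)" by (simp only: gs)
    also have "\<dots> \<le> (\<Sum>P\<in>GL. \<Sum>Q\<in>GL. (\<Sum>z\<in>T-{a}. br P (Q *v (z - a))) + (\<Sum>t\<in>T. bc P t Q))"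
      by (intro sum_mono pt)
    also have "\<dots> = (\<Sum>P\<in>GL. (\<Sum>z\<in>T-{a}. \<Sum>Q\<in>GL. br P (Q *v (z - a))) + (\<Sum>t\<in>T. \<Sum>Q\<in>GL. bc P t Q))"
      unfolding sum.distrib
      by (intro arg_cong2[where f = "(+)"] sum.cong[OF refl] sum.swap)
    also have "\<dots> \<le> (\<Sum>P\<in>GL. k * (g / (N - 1) * ((\<Sum>u\<in>R. bu P u) + nr)) + k * card Bad)"
    proof (intro sum_mono add_mono)
      fix P :: "'k ^ 'n ^ 'n" assume P: "P \<in> GL"
      let ?x = "g / (N - 1) * ((\<Sum>u\<in>R. bu P u) + nr)"
      have "(\<Sum>z\<in>T-{a}. \<Sum>Q\<in>GL. br P (Q *v (z - a))) \<le> (\<Sum>z\<in>T-{a}. ?x)"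
        using rowsum N_gt_1 by (intro sum_mono) (simp add: field_simps)
      also have "\<dots> = real (card (T - {a})) * ?x" by simp
      also have "\<dots> \<le> k * ?x" using N_gt_1 cG
        by (intro mult_right_mono kk mult_nonneg_nonneg add_nonneg_nonneg sum_nonneg) (auto simp: nr_def bu_def)
      finally show "(\<Sum>z\<in>T-{a}. \<Sum>Q\<in>GL. br P (Q *v (z - a))) \<le> k * ?x" .
      show "(\<Sum>t\<in>T. \<Sum>Q\<in>GL. bc P t Q) \<le> k * card Bad"
        by (simp add: colsum[OF P] k_def)
    qed
    also have "\<dots> = k * (g / (N - 1)) * (W + g * nr) + g * (k * card Bad)"
      unfolding W_def by (rule lin)
    also have "\<dots> = g * g * (k * S L + k * nr / (N - 1) + k * card Bad / g)"
      unfolding WS using N_gt_1 cG by (simp add: field_simps)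
    finally show ?thesis using cG by simp
  qed
  define B where "B = real (card Bad)"
  define lam where "lam = (if CARD('n) = 1 then 0 else sqrt (CARD('n) * CARD('k) / N))"
  have B0: "B > 0" using ne by (simp add: B_def card_gt_0_iff)
  have "(\<Sum>L\<in>Bad. S L) \<le> lam * B + B\<^sup>2 / g"
    using nu_form_bound[OF BG] by (simp add: S_def lam_def B_def)
  hence "k * (\<Sum>L\<in>Bad. S L) \<le> k * (lam * B + B\<^sup>2 / g)" using k by (intro mult_left_mono) auto
  moreover have "(\<Sum>L\<in>Bad. 1) \<le> (\<Sum>L\<in>Bad. k * S L + k * nr / (N - 1) + k * B / g)"
    by (intro sum_mono) (use key in \<open>simp add: B_def\<close>)
  hence "B \<le> k * (\<Sum>L\<in>Bad. S L) + B * (k * nr / (N - 1) + k * B / g)"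
    by (simp add: B_def sum.distrib sum_distrib_left algebra_simps)
  ultimately have "B \<le> k * (lam * B + B\<^sup>2 / g) + B * (k * nr / (N - 1) + k * B / g)" by linarith
  also have "\<dots> = B * (k * lam + k * B / g + k * nr / (N - 1) + k * B / g)"
    by (simp add: algebra_simps power2_eq_square add_divide_distrib)
  finally have "B * 1 \<le> B * (k * lam + k * B / g + k * nr / (N - 1) + k * B / g)" by simp
  hence main: "1 \<le> k * lam + k * B / g + k * nr / (N - 1) + k * B / g" using B0 by (simp only: mult_le_cancel_left_pos)
  have "k * B / g \<le> 1 / 100" using small cG by (simp add: k_def B_def field_simps)
  moreover have "k * lam \<le> 2 / 5"
  proof (cases "CARD('n) = 1")
    case False
    hence "CARD('n) \<ge> 2" using zero_less_card_finite[where 'a='n] by linarith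
    thus ?thesis using spectral_numeric[of "CARD('k)" "CARD('n)" k] big k card_gt_1_field[where 'k='k] False
      by (simp add: lam_def N_def k_def)
  qed (simp add: lam_def)
  moreover have "k * nr / (N - 1) \<le> 1 / 5"
  proof -
    have N: "N \<ge> 9600"
    proof -
      have "2 ^ 4 \<le> k ^ 4" using k by (intro power_mono) auto
      thus ?thesis using big by (simp add: k_def)
    qed
    have "nr\<^sup>2 \<le> (2 * real CARD('k) ^ (CARD('n) div 2))\<^sup>2"
    proof (rule power_mono)
      have "nr \<le> real (2 * CARD('k) ^ (CARD('n) div 2))"
        unfolding nr_def using card_R by (simp only: of_nat_le_iff)
      thus "nr \<le> 2 * real CARD('k) ^ (CARD('n) div 2)" by simp
    qed (simp add: nr_def)
    also have "\<dots> = 4 * real CARD('k) ^ (CARD('n) div 2 * 2)" by (simp add: power_mult_distrib power_mult)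
    also have "\<dots> \<le> 4 * N" unfolding N_def
      using card_gt_1_field[where 'k='k] by (intro mult_left_mono power_increasing) auto
    finally have nr: "nr\<^sup>2 \<le> 4 * N" .
    have "4 * k\<^sup>2 \<le> k\<^sup>2 * k\<^sup>2" using k mult_mono[of 2 k 2 k] by (intro mult_right_mono) (auto simp: power2_eq_square)
    also have "\<dots> = k ^ 4" by simp
    finally have k4: "4 * k\<^sup>2 \<le> N / 600" using big by (simp add: k_def)
    have "(k * nr)\<^sup>2 = k\<^sup>2 * nr\<^sup>2" by (simp add: power_mult_distrib)
    also have "\<dots> \<le> k\<^sup>2 * (4 * N)" using nr by (intro mult_left_mono) auto
    also have "\<dots> \<le> (N / 600) * N" using mult_right_mono[OF k4, of N] N by simp
    also have "\<dots> \<le> (1 / 5 * (N / 2))\<^sup>2" using N by (simp add: power2_eq_square)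
    also have "\<dots> \<le> (1 / 5 * (N - 1))\<^sup>2" using N by (intro power_mono) auto
    finally have "k * nr \<le> 1 / 5 * (N - 1)" by (rule power2_le_imp_le) (use N in auto)
    thus ?thesis using N by (simp add: field_simps)
  qed
  moreover have "x \<le> 1 / 100 \<Longrightarrow> y \<le> 2 / 5 \<Longrightarrow> z \<le> 1 / 5 \<Longrightarrow> \<not> 1 \<le> y + x + z + x" for x y z :: real
    by linarith
  ultimately show False using main by blast
qed

end

section \<open>Self-correction and amplification\<close>

lemma exists_le_average:
  fixes h :: "'b \<Rightarrow> real"
  assumes "finite S" "S \<noteq> {}"
  shows "\<exists>x\<in>S. card S * h x \<le> sum h S"
proof (rule ccontr)
  assume "\<not> ?thesis"
  hence "card S * h x > sum h S" if "x \<in> S" for x using that by force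
  hence "(\<Sum>x\<in>S. sum h S) < (\<Sum>x\<in>S. card S * h x)"
    using assms by (intro sum_strict_mono) auto
  thus False by (simp add: sum_distrib_left[symmetric])
qed

locale orbit_code =
  fixes T :: "('k::{field,finite} ^ 'n::finite) set" and N g k :: real
  assumes N_def: "N = real CARD('k) ^ CARD('n)" and g_def: "g = real (card (GL :: ('k ^ 'n ^ 'n) set))"
    and k_def: "k = real (card T)" and k2: "card T \<ge> 2" and N_big: "600 * k ^ 4 \<le> N"
begin

definition syn :: "('k ^ 'n \<Rightarrow> 'a::ab_group_add) \<Rightarrow> 'k ^ 'n ^ 'n \<Rightarrow> 'k ^ 'n \<Rightarrow> 'a" where
  "syn c L y = (\<Sum>t\<in>T. c (y + L *v t))"

text \<open>Unnormalised: g N times the rejection probability, since every support arises from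
  equally many affine maps.\<close>

definition viol :: "('k ^ 'n \<Rightarrow> 'a::ab_group_add) \<Rightarrow> real" where
  "viol c = (\<Sum>L\<in>GL. \<Sum>y\<in>UNIV. of_bool (syn c L y \<noteq> 0))"

lemma k_ge: "k \<ge> 2"
  using k2 by (simp add: k_def)

lemma N_ge: "N \<ge> 9600" "k \<le> N"
proof -
  have "2 ^ 4 \<le> k ^ 4" using k_ge by (intro power_mono) auto
  thus "N \<ge> 9600" using N_big by simp
  have "k ^ 1 \<le> k ^ 4" using k_ge by (intro power_increasing) auto
  hence "k \<le> k ^ 4" by simp
  thus "k \<le> N" using N_big k_ge by linarith
qed

lemma g_pos: "g > 0"
  using card_GL_pos by (simp add: g_def)

lemma sum_shift: "(\<Sum>y\<in>UNIV. h (y + v)) = (\<Sum>y\<in>UNIV. h y)" for h :: "'k ^ 'n \<Rightarrow> real"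
  by (rule sum.reindex_bij_witness[of _ "\<lambda>y. y - v" "\<lambda>y. y + v"]) auto

lemma sum_GL_le:
  fixes h :: "'k ^ 'n \<Rightarrow> real"
  assumes "v \<noteq> 0" "\<And>y. h y \<ge> 0"
  shows "(N - 1) * (\<Sum>B\<in>GL. h (y + B *v v)) \<le> g * (\<Sum>y\<in>UNIV. h y)"
proof -
  have "(N - 1) * (\<Sum>B\<in>GL. h (y + B *v v)) = g * (\<Sum>w\<in>UNIV-{0}. h (y + w))"
    unfolding N_def g_def using sum_GL_vec[OF assms(1), of "\<lambda>w. h (y + w)"] .
  also have "(\<Sum>w\<in>UNIV-{0}. h (y + w)) \<le> (\<Sum>w\<in>UNIV. h (w + y))"
    by (subst add.commute, rule sum_mono2) (use assms in auto)
  finally show ?thesis using g_pos by (simp add: sum_shift)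
qed

section \<open>Decoding by the votes of the constraints through a point\<close>

context
  fixes a :: "'k ^ 'n" and c :: "'k ^ 'n \<Rightarrow> 'a::ab_group_add"
  assumes a: "a \<in> T"
begin

text \<open>The value at \<open>x\<close> predicted by the constraint with linear part \<open>A\<close> that carries \<open>a\<close> to \<open>x\<close>.\<close>

definition vote :: "'k ^ 'n \<Rightarrow> 'k ^ 'n ^ 'n \<Rightarrow> 'a" where
  "vote x A = - (\<Sum>t\<in>T-{a}. c (x + A *v (t - a)))"

lemma syn_vote: "syn c A (x - A *v a) = c x - vote x A"
proof -
  have "syn c A (x - A *v a) = (\<Sum>t\<in>T. c (x + A *v (t - a)))"
    unfolding syn_def by (intro sum.cong refl) (simp add: matrix_vector_mult_diff_distrib algebra_simps)
  also have "\<dots> = c x + (\<Sum>t\<in>T-{a}. c (x + A *v (t - a)))"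
    by (subst sum.remove[of _ a]) (use a in auto)
  finally show ?thesis by (simp add: vote_def)
qed

text \<open>Double counting in the grid of \<open>c (x + A *v (t - a) + B *v (z - a))\<close>: when
  all rows and columns except those of \<open>a\<close> sum to zero, both votes equal the sum over
  the block without row and column \<open>a\<close>.\<close>

lemma votes_agree:
  assumes "\<And>z. z \<in> T-{a} \<Longrightarrow> syn c A (x - A *v a + B *v (z - a)) = 0"
    and "\<And>t. t \<in> T-{a} \<Longrightarrow> syn c B (x - B *v a + A *v (t - a)) = 0"
  shows "vote x A = vote x B"
proof -
  define F where "F t z = c (x + A *v (t - a) + B *v (z - a))" for t z
  have 1: "(\<Sum>t\<in>T. F t z) = 0" if "z \<in> T-{a}" for z
    using assms(1)[OF that] by (simp add: syn_def F_def matrix_vector_mult_diff_distrib algebra_simps)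
  have 2: "(\<Sum>z\<in>T. F t z) = 0" if "t \<in> T-{a}" for t
    using assms(2)[OF that] by (simp add: syn_def F_def matrix_vector_mult_diff_distrib algebra_simps)
  have A: "(\<Sum>t\<in>T-{a}. F t a) = - vote x A" by (simp add: F_def vote_def)
  have B: "(\<Sum>z\<in>T-{a}. F a z) = - vote x B" by (simp add: F_def vote_def)
  let ?I = "\<Sum>t\<in>T-{a}. \<Sum>z\<in>T-{a}. F t z"
  have r: "(\<Sum>z\<in>T. F t z) = F t a + (\<Sum>z\<in>T-{a}. F t z)"
    and l: "(\<Sum>t\<in>T. F t z) = F a z + (\<Sum>t\<in>T-{a}. F t z)" for t z
    by (subst sum.remove[of _ a]; use a in simp)+
  have "0 = (\<Sum>t\<in>T-{a}. \<Sum>z\<in>T. F t z)" by (rule sum.neutral[symmetric]) (use 2 in blast)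
  also have "\<dots> = - vote x A + ?I" by (simp only: r sum.distrib A)
  finally have 3: "vote x A = ?I" by (simp add: eq_neg_iff_add_eq_0)
  have "0 = (\<Sum>z\<in>T-{a}. \<Sum>t\<in>T. F t z)" by (rule sum.neutral[symmetric]) (use 1 in blast)
  also have "\<dots> = - vote x B + (\<Sum>z\<in>T-{a}. \<Sum>t\<in>T-{a}. F t z)" by (simp only: l sum.distrib B)
  also have "(\<Sum>z\<in>T-{a}. \<Sum>t\<in>T-{a}. F t z) = ?I" by (rule sum.swap)
  finally have "vote x B = ?I" by (simp add: eq_neg_iff_add_eq_0)
  with 3 show ?thesis by simp
qed

lemma card_tau_minus: "real (card (T - {a})) = k - 1"
  using a k2 by (simp add: k_def of_nat_diff)

text \<open>A union bound over the 2(k - 1) constraints in \<open>votes_agree\<close>: with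
  \<open>A\<close> and \<open>z\<close> fixed, the translate is uniform off one point as
  \<open>B\<close> varies.\<close>

lemma vote_disagreement:
  "(N - 1) * (\<Sum>A\<in>GL. \<Sum>B\<in>GL. of_bool (vote x A \<noteq> vote x B)) \<le> 2 * (k - 1) * g * viol c"
proof -
  define r where "r A B z = (of_bool (syn c A (x - A *v a + B *v (z - a)) \<noteq> 0) :: real)" for A B z
  have one: "(N - 1) * (\<Sum>A\<in>GL. \<Sum>B\<in>GL. \<Sum>z\<in>T-{a}. r A B z) \<le> (k - 1) * g * viol c"
  proof -
    have "(N - 1) * (\<Sum>A\<in>GL. \<Sum>B\<in>GL. \<Sum>z\<in>T-{a}. r A B z) =
        (\<Sum>A\<in>GL. \<Sum>z\<in>T-{a}. (N - 1) * (\<Sum>B\<in>GL. r A B z))"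
      unfolding sum_distrib_left by (rule sum.cong[OF refl], rule sum.swap)
    also have "\<dots> \<le> (\<Sum>A\<in>GL. \<Sum>z\<in>T-{a}. g * (\<Sum>y\<in>UNIV. of_bool (syn c A y \<noteq> 0)))"
      unfolding r_def by (intro sum_mono sum_GL_le) auto
    also have "\<dots> = (k - 1) * g * viol c"
      by (simp add: viol_def card_tau_minus sum_distrib_left mult_ac)
    finally show ?thesis .
  qed
  have pt: "of_bool (vote x A \<noteq> vote x B) \<le> (\<Sum>z\<in>T-{a}. r A B z) + (\<Sum>z\<in>T-{a}. r B A z)" for A B
  proof (cases "\<exists>z\<in>T-{a}. r A B z = 1 \<or> r B A z = 1")
    case True
    then obtain z where b: "z \<in> T-{a}" "r A B z = 1 \<or> r B A z = 1" by blast
    have "r C D z \<le> (\<Sum>z\<in>T-{a}. r C D z)" for C D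
      by (rule member_le_sum) (use b in \<open>auto simp: r_def\<close>)
    from this[of A B] this[of B A]
    have "1 \<le> (\<Sum>z\<in>T-{a}. r A B z) + (\<Sum>z\<in>T-{a}. r B A z)"
      using b(2) sum_nonneg[of "T-{a}" "r A B"] sum_nonneg[of "T-{a}" "r B A"]
      by (auto simp: r_def)
    thus ?thesis by simp
  next
    case False
    hence "vote x A = vote x B" by (intro votes_agree) (auto simp: r_def)
    thus ?thesis by (simp add: sum_nonneg r_def)
  qed
  have "(N - 1) * (\<Sum>A\<in>GL. \<Sum>B\<in>GL. of_bool (vote x A \<noteq> vote x B)) \<le>
      (N - 1) * (\<Sum>A\<in>GL. \<Sum>B\<in>GL. (\<Sum>z\<in>T-{a}. r A B z) + (\<Sum>z\<in>T-{a}. r B A z))"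
    using N_ge by (intro mult_left_mono sum_mono pt) auto
  also have "(\<Sum>A\<in>GL. \<Sum>B\<in>GL. (\<Sum>z\<in>T-{a}. r A B z) + (\<Sum>z\<in>T-{a}. r B A z)) =
      (\<Sum>A\<in>GL. \<Sum>B\<in>GL. \<Sum>z\<in>T-{a}. r A B z) + (\<Sum>A\<in>GL. \<Sum>B\<in>GL. \<Sum>z\<in>T-{a}. r B A z)"
    by (simp only: sum.distrib)
  also have "(\<Sum>A\<in>GL. \<Sum>B\<in>GL. \<Sum>z\<in>T-{a}. r B A z) = (\<Sum>A\<in>GL. \<Sum>B\<in>GL. \<Sum>z\<in>T-{a}. r A B z)"
    by (rule sum.swap)
  finally show ?thesis using one by (simp add: algebra_simps)
qed

text \<open>Averaging replaces the majority: some single vote is contradicted by no more votes than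
  the average one.\<close>

lemma exists_consensus:
  "\<exists>v. (N - 1) * (\<Sum>B\<in>GL. of_bool (v \<noteq> vote x B)) \<le> 2 * (k - 1) * viol c"
proof -
  have "(GL :: ('k ^ 'n ^ 'n) set) \<noteq> {}" using mat_1_GL by blast
  from exists_le_average[OF finite_GL this, of "\<lambda>A. \<Sum>B\<in>GL. of_bool (vote x A \<noteq> vote x B)"]
  obtain A where A: "g * (\<Sum>B\<in>GL. of_bool (vote x A \<noteq> vote x B)) \<le>
      (\<Sum>A\<in>GL. \<Sum>B\<in>GL. of_bool (vote x A \<noteq> vote x B))"
    by (auto simp: g_def)
  have "(N - 1) * (g * (\<Sum>B\<in>GL. of_bool (vote x A \<noteq> vote x B))) \<le> 2 * (k - 1) * g * viol c"
    using mult_left_mono[OF A, of "N - 1"] vote_disagreement[of x] N_ge by linarith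
  hence "g * ((N - 1) * (\<Sum>B\<in>GL. of_bool (vote x A \<noteq> vote x B))) \<le> g * (2 * (k - 1) * viol c)"
    by (simp add: mult_ac)
  thus ?thesis using g_pos by (intro exI[of _ "vote x A"]) (simp only: mult_le_cancel_left_pos)
qed

text \<open>\<open>f\<close> takes at each point a vote that few others contradict. For a bad
  \<open>L\<close>, every \<open>B\<close> exposes either a contradicted value of \<open>f\<close>
  or a violation of \<open>c\<close> with linear part \<open>L\<close>; summing over bad
  \<open>L\<close> bounds their number. Where \<open>f\<close> differs from \<open>c\<close>, most
  constraints placing \<open>a\<close> at that point are violated.\<close>

lemma self_correction:
  assumes small: "1000 * k\<^sup>2 * viol c \<le> g * N"
  shows "\<exists>f. 100 * k * card {L \<in> GL. \<exists>y. syn f L y \<noteq> 0} \<le> g \<and> 2 * k * card {x. c x \<noteq> f x} \<le> N"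
proof -
  obtain f where f0: "\<And>x. (N - 1) * (\<Sum>B\<in>GL. of_bool (f x \<noteq> vote x B)) \<le> 2 * (k - 1) * viol c"
  proof -
    define f where "f x = (SOME v. (N - 1) * (\<Sum>B\<in>GL. of_bool (v \<noteq> vote x B)) \<le> 2 * (k - 1) * viol c)" for x
    show thesis
      by (rule that[of f]) (unfold f_def, rule someI_ex[OF exists_consensus])
  qed
  have viol0: "viol c \<ge> 0" unfolding viol_def by (intro sum_nonneg) auto
  \<comment> \<open>Holds because k <= N; it trades (k - 1)/(N - 1) for k/N.\<close>
  have kN: "(k - 1) * N \<le> k * (N - 1)" using N_ge by (simp add: algebra_simps)
  have f: "N * (\<Sum>B\<in>GL. of_bool (f x \<noteq> vote x B)) \<le> 2 * k * viol c" for x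
  proof -
    let ?T = "\<Sum>B\<in>GL. of_bool (f x \<noteq> vote x B) :: real"
    have "(N - 1) * (N * ?T) = N * ((N - 1) * ?T)" by simp
    also have "\<dots> \<le> N * (2 * (k - 1) * viol c)" using f0[of x] N_ge by (intro mult_left_mono) auto
    also have "\<dots> = 2 * ((k - 1) * N) * viol c" by simp
    also have "\<dots> \<le> 2 * (k * (N - 1)) * viol c" using kN viol0 by (intro mult_right_mono mult_left_mono) auto
    also have "\<dots> = (N - 1) * (2 * k * viol c)" by simp
    finally show ?thesis using N_ge by (simp only: mult_le_cancel_left_pos)
  qed
  define Bad where "Bad = {L \<in> GL. \<exists>y. syn f L y \<noteq> 0}"
  have bad: "N * g \<le> 2 * k\<^sup>2 * viol c + k * g * (\<Sum>y\<in>UNIV. of_bool (syn c L y \<noteq> 0))" if L: "L \<in> Bad" for L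
  proof -
    obtain y where y: "syn f L y \<noteq> 0" using L by (auto simp: Bad_def)
    define p where "p B t = (of_bool (f (y + L *v t) \<noteq> vote (y + L *v t) B) :: real)" for B t
    define r where "r B z = (of_bool (syn c L (y + B *v (z - a)) \<noteq> 0) :: real)" for B z
    have pt: "1 \<le> (\<Sum>t\<in>T. p B t) + (\<Sum>z\<in>T-{a}. r B z)" for B
    proof (rule ccontr)
      assume neg: "\<not> ?thesis"
      have nn: "0 \<le> (\<Sum>t\<in>T. p B t)" "0 \<le> (\<Sum>z\<in>T-{a}. r B z)"
        by (auto intro!: sum_nonneg simp: p_def r_def)
      have p0: "p B t = 0" if "t \<in> T" for t
      proof -
        have "p B t \<le> (\<Sum>t\<in>T. p B t)" by (rule member_le_sum) (use that in \<open>auto simp: p_def\<close>)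
        hence "p B t < 1" using neg nn by linarith
        thus ?thesis by (auto simp: p_def of_bool_def split: if_splits)
      qed
      have r0: "r B z = 0" if "z \<in> T-{a}" for z
      proof -
        have "r B z \<le> (\<Sum>z\<in>T-{a}. r B z)" by (rule member_le_sum) (use that in \<open>auto simp: r_def\<close>)
        hence "r B z < 1" using neg nn by linarith
        thus ?thesis by (auto simp: r_def of_bool_def split: if_splits)
      qed
      have "syn f L y = (\<Sum>t\<in>T. vote (y + L *v t) B)"
        unfolding syn_def by (intro sum.cong refl) (use p0 in \<open>auto simp: p_def\<close>)
      also have "\<dots> = - (\<Sum>t\<in>T. \<Sum>z\<in>T-{a}. c (y + L *v t + B *v (z - a)))"
        by (simp add: vote_def sum_negf)
      also have "(\<Sum>t\<in>T. \<Sum>z\<in>T-{a}. c (y + L *v t + B *v (z - a))) =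
          (\<Sum>z\<in>T-{a}. syn c L (y + B *v (z - a)))"
        unfolding syn_def by (subst sum.swap) (simp add: add_ac)
      also have "\<dots> = 0" by (rule sum.neutral) (use r0 in \<open>auto simp: r_def\<close>)
      finally show False using y by simp
    qed
    have "N * g = N * (\<Sum>B\<in>(GL :: ('k ^ 'n ^ 'n) set). 1)" by (simp add: g_def)
    also have "\<dots> \<le> N * (\<Sum>B\<in>GL. (\<Sum>t\<in>T. p B t) + (\<Sum>z\<in>T-{a}. r B z))"
      using N_ge by (intro mult_left_mono sum_mono pt) auto
    also have "\<dots> = N * (\<Sum>B\<in>GL. \<Sum>t\<in>T. p B t) + N * (\<Sum>B\<in>GL. \<Sum>z\<in>T-{a}. r B z)"
      by (simp only: sum.distrib distrib_left)
    also have "(\<Sum>B\<in>GL. \<Sum>t\<in>T. p B t) = (\<Sum>t\<in>T. \<Sum>B\<in>GL. p B t)" by (rule sum.swap)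
    also have "(\<Sum>B\<in>GL. \<Sum>z\<in>T-{a}. r B z) = (\<Sum>z\<in>T-{a}. \<Sum>B\<in>GL. r B z)" by (rule sum.swap)
    also have "N * (\<Sum>t\<in>T. \<Sum>B\<in>GL. p B t) \<le> 2 * k\<^sup>2 * viol c"
    proof -
      have "N * (\<Sum>t\<in>T. \<Sum>B\<in>GL. p B t) = (\<Sum>t\<in>T. N * (\<Sum>B\<in>GL. p B t))" by (rule sum_distrib_left)
      also have "\<dots> \<le> (\<Sum>t\<in>T. 2 * k * viol c)" unfolding p_def by (intro sum_mono f)
      also have "\<dots> = 2 * k\<^sup>2 * viol c" by (simp add: k_def power2_eq_square)
      finally show ?thesis .
    qed
    also have "N * (\<Sum>z\<in>T-{a}. \<Sum>B\<in>GL. r B z) \<le> k * g * (\<Sum>y\<in>UNIV. of_bool (syn c L y \<noteq> 0))"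
    proof -
      let ?D = "\<Sum>y\<in>UNIV. of_bool (syn c L y \<noteq> 0) :: real"
      have "(N - 1) * (\<Sum>z\<in>T-{a}. \<Sum>B\<in>GL. r B z) = (\<Sum>z\<in>T-{a}. (N - 1) * (\<Sum>B\<in>GL. r B z))"
        by (rule sum_distrib_left)
      also have "\<dots> \<le> (\<Sum>z\<in>T-{a}. g * ?D)" unfolding r_def by (intro sum_mono sum_GL_le) auto
      also have "\<dots> = (k - 1) * (g * ?D)" by (simp add: card_tau_minus)
      finally have 1: "(N - 1) * (\<Sum>z\<in>T-{a}. \<Sum>B\<in>GL. r B z) \<le> (k - 1) * (g * ?D)" .
      have "(N - 1) * (N * (\<Sum>z\<in>T-{a}. \<Sum>B\<in>GL. r B z)) = N * ((N - 1) * (\<Sum>z\<in>T-{a}. \<Sum>B\<in>GL. r B z))" by simp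
      also have "\<dots> \<le> N * ((k - 1) * (g * ?D))" using 1 N_ge by (intro mult_left_mono) auto
      also have "\<dots> = ((k - 1) * N) * (g * ?D)" by simp
      also have "\<dots> \<le> (k * (N - 1)) * (g * ?D)"
        using kN g_pos by (intro mult_right_mono mult_nonneg_nonneg sum_nonneg) auto
      also have "\<dots> = (N - 1) * (k * g * ?D)" by simp
      finally show ?thesis using N_ge by (simp only: mult_le_cancel_left_pos)
    qed
    finally show ?thesis by simp
  qed
  have "100 * k * card Bad \<le> g"
  proof -
    let ?B = "real (card Bad)"
    have "?B * (N * g) = (\<Sum>L\<in>Bad. N * g)" by simp
    also have "\<dots> \<le> (\<Sum>L\<in>Bad. 2 * k\<^sup>2 * viol c + k * g * (\<Sum>y\<in>UNIV. of_bool (syn c L y \<noteq> 0)))"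
      by (intro sum_mono bad)
    also have "\<dots> = ?B * (2 * k\<^sup>2 * viol c) + k * g * (\<Sum>L\<in>Bad. \<Sum>y\<in>UNIV. of_bool (syn c L y \<noteq> 0))"
      by (simp only: sum.distrib sum_distrib_left sum_constant)
    also have "(\<Sum>L\<in>Bad. \<Sum>y\<in>UNIV. of_bool (syn c L y \<noteq> 0)) \<le> viol c"
      unfolding viol_def by (rule sum_mono2) (auto simp: Bad_def intro!: sum_nonneg)
    finally have "?B * (N * g) \<le> ?B * (2 * k\<^sup>2 * viol c) + k * g * viol c"
      using k_ge g_pos by simp
    \<comment> \<open>This share of 1/500 is absorbed on the left and leaves the factor
      499/500.\<close>
    also have "?B * (2 * k\<^sup>2 * viol c) \<le> ?B * (1 / 500 * (N * g))"
      using small by (intro mult_left_mono) (auto simp: mult_ac)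
    finally have "499 / 500 * (?B * (N * g)) \<le> k * g * viol c" by simp
    hence "k * (499 / 500 * (?B * (N * g))) \<le> k * (k * g * viol c)" using k_ge by (intro mult_left_mono) auto
    also have "\<dots> = g * (k\<^sup>2 * viol c)" by (simp add: power2_eq_square)
    also have "\<dots> \<le> g * (1 / 1000 * (g * N))" using small g_pos by (intro mult_left_mono) auto
    finally have "(N * g) * (499 / 500 * (k * ?B)) \<le> (N * g) * (1 / 1000 * g)" by (simp add: mult_ac)
    hence "499 / 500 * (k * ?B) \<le> 1 / 1000 * g" using N_ge g_pos by (subst (asm) mult_le_cancel_left_pos) auto
    moreover have "k * ?B \<ge> 0" using k_ge by simp
    ultimately show ?thesis by linarith
  qed
  moreover have "2 * k * card {x. c x \<noteq> f x} \<le> N"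
  proof -
    let ?S = "{x. c x \<noteq> f x}"
    have pt: "N * g - 2 * k * viol c \<le> N * (\<Sum>B\<in>GL. of_bool (syn c B (x - B *v a) \<noteq> 0))" if x: "x \<in> ?S" for x
    proof -
      have "(\<Sum>B\<in>(GL :: ('k ^ 'n ^ 'n) set). 1) \<le> (\<Sum>B\<in>GL. of_bool (f x \<noteq> vote x B) + of_bool (syn c B (x - B *v a) \<noteq> 0) :: real)"
        using x by (intro sum_mono) (auto simp: syn_vote)
      hence "N * g \<le> N * (\<Sum>B\<in>GL. of_bool (f x \<noteq> vote x B)) + N * (\<Sum>B\<in>GL. of_bool (syn c B (x - B *v a) \<noteq> 0))"
        using N_ge unfolding distrib_left[symmetric] sum.distrib[symmetric]
        by (intro mult_left_mono) (auto simp: g_def)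
      thus ?thesis using f[of x] by linarith
    qed
    have "card ?S * (N * g - 2 * k * viol c) \<le> (\<Sum>x\<in>?S. N * (\<Sum>B\<in>GL. of_bool (syn c B (x - B *v a) \<noteq> 0)))"
      using sum_mono[of ?S "\<lambda>_. N * g - 2 * k * viol c", OF pt] by simp
    also have "\<dots> \<le> (\<Sum>x\<in>UNIV. N * (\<Sum>B\<in>GL. of_bool (syn c B (x - B *v a) \<noteq> 0)))"
      using N_ge by (intro sum_mono2) (auto intro!: mult_nonneg_nonneg sum_nonneg)
    also have "\<dots> = N * (\<Sum>B\<in>GL. \<Sum>x\<in>UNIV. of_bool (syn c B (x - B *v a) \<noteq> 0))"
      unfolding sum_distrib_left by (rule sum.swap)
    also have "\<dots> = N * viol c"
      unfolding viol_def using sum_shift[of "\<lambda>y. of_bool (syn c B y \<noteq> 0)" "- (B *v a)" for B] by simp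
    finally have 1: "card ?S * (N * g - 2 * k * viol c) \<le> N * viol c" .
    have kv: "500 * (2 * k * viol c) \<le> N * g"
    proof -
      have "1000 * k * viol c \<le> 1000 * k\<^sup>2 * viol c"
        using k_ge viol0 by (intro mult_right_mono) (auto simp: power2_eq_square)
      thus ?thesis using small by (simp add: mult_ac)
    qed
    have Ng: "N * g > 0" using N_ge g_pos by simp
    have "card ?S * (1 / 2 * (N * g)) \<le> card ?S * (N * g - 2 * k * viol c)"
      using kv Ng by (intro mult_left_mono) auto
    hence "card ?S * (1 / 2 * (N * g)) \<le> N * viol c" using 1 by linarith
    hence "k * (card ?S * (1 / 2 * (N * g))) \<le> k * (N * viol c)" using k_ge by (intro mult_left_mono) auto
    also have "\<dots> \<le> N * (1 / 1000 * (N * g))"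
    proof -
      have "1000 * (k * viol c) \<le> N * g" using kv viol0 k_ge by simp
      thus ?thesis using mult_left_mono[of "k * viol c" "1 / 1000 * (N * g)" N] N_ge by (simp add: mult_ac)
    qed
    finally have "(N * g) * (1 / 2 * (k * card ?S)) \<le> (N * g) * (1 / 1000 * N)" by (simp add: mult_ac)
    hence "1 / 2 * (k * card ?S) \<le> 1 / 1000 * N" using Ng by (subst (asm) mult_le_cancel_left_pos) auto
    thus ?thesis using N_ge by simp
  qed
  ultimately show ?thesis unfolding Bad_def by blast
qed

end

text \<open>With u errors in a constraint, u - u(u - 1) is at most 1 if u = 1 and at most 0
  otherwise, and a single error is always detected. Single errors contribute g k |S| and pairs at
  most half of that, because \<open>L *v (z - t)\<close> is uniform off 0 and |S| <= N/(2k).\<close>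

lemma amplification:
  fixes c f :: "'k ^ 'n \<Rightarrow> 'a::ab_group_add"
  assumes f: "\<And>L y. L \<in> GL \<Longrightarrow> syn f L y = 0" and close: "2 * k * card {x. c x \<noteq> f x} \<le> N"
  shows "viol c \<ge> g * k * card {x. c x \<noteq> f x} / 2"
proof -
  define S where "S = {x. c x \<noteq> f x}"
  define s where "s x = (of_bool (x \<in> S) :: real)" for x
  let ?S = "real (card S)"
  have pt: "(\<Sum>t\<in>T. s (y + L *v t)) - (\<Sum>t\<in>T. \<Sum>z\<in>T-{t}. s (y + L *v t) * s (y + L *v z))
      \<le> of_bool (syn c L y \<noteq> 0)" if L: "L \<in> GL" for L y
  proof -
    define U where "U = {t \<in> T. y + L *v t \<in> S}"
    define u where "u = real (card U)"
    have su: "(\<Sum>t\<in>T. s (y + L *v t)) = u"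
      by (simp add: s_def u_def U_def sum_of_bool_eq Collect_conj_eq)
    have "(\<Sum>z\<in>T-{t}. s (y + L *v t) * s (y + L *v z)) = s (y + L *v t) * (u - 1)" if "t \<in> T" for t
    proof -
      have "(\<Sum>z\<in>T-{t}. s (y + L *v z)) = u - s (y + L *v t)"
        using that su by (simp add: sum_diff1)
      thus ?thesis by (simp add: sum_distrib_left[symmetric]) (simp add: s_def)
    qed
    hence ss: "(\<Sum>t\<in>T. \<Sum>z\<in>T-{t}. s (y + L *v t) * s (y + L *v z)) = u * (u - 1)"
      by (simp add: su flip: sum_distrib_right)
    consider "card U = 0" | "card U = 1" | "card U \<ge> 2" by linarith
    thus ?thesis
    proof cases
      case 1
      thus ?thesis by (simp add: su ss u_def)
    next
      case 2
      then obtain t where t: "U = {t}" by (auto simp: card_1_singleton_iff)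
      hence tT: "t \<in> T" "c (y + L *v t) \<noteq> f (y + L *v t)" by (auto simp: U_def S_def)
      have "syn c L y = syn c L y - syn f L y" by (simp add: f[OF L])
      also have "\<dots> = (\<Sum>z\<in>T. c (y + L *v z) - f (y + L *v z))" by (simp add: syn_def sum_subtractf)
      also have "\<dots> = (\<Sum>z\<in>{t}. c (y + L *v z) - f (y + L *v z))"
        by (rule sum.mono_neutral_right) (use t tT in \<open>auto simp: U_def S_def\<close>)
      finally have "syn c L y \<noteq> 0" using tT by simp
      thus ?thesis using 2 by (simp add: su ss u_def)
    next
      case 3
      hence "u \<ge> 2" by (simp add: u_def)
      hence "u * 1 \<le> u * (u - 1)" by (intro mult_left_mono) auto
      hence "u - u * (u - 1) \<le> 0" by simp
      also have "0 \<le> (of_bool (syn c L y \<noteq> 0) :: real)" by simp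
      finally show ?thesis by (simp only: su ss)
    qed
  qed
  have sumS: "(\<Sum>y\<in>UNIV. s (y + v)) = ?S" for v
    using sum_shift[of s v] by (simp add: s_def sum_of_bool_eq)
  have single: "(\<Sum>L\<in>GL. \<Sum>y\<in>UNIV. s (y + L *v t)) = g * ?S" for t
    by (simp add: sumS g_def)
  have pair: "(N - 1) * (\<Sum>L\<in>GL. \<Sum>y\<in>UNIV. s (y + L *v t) * s (y + L *v z)) \<le> g * ?S * (?S - 1)"
    if "z \<noteq> t" for t z
  proof -
    have "(\<Sum>L\<in>GL. \<Sum>y\<in>UNIV. s (y + L *v t) * s (y + L *v z)) = (\<Sum>L\<in>GL. \<Sum>y\<in>UNIV. s y * s (y + L *v (z - t)))"
    proof (rule sum.cong[OF refl])
      fix L :: "'k ^ 'n ^ 'n"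
      show "(\<Sum>y\<in>UNIV. s (y + L *v t) * s (y + L *v z)) = (\<Sum>y\<in>UNIV. s y * s (y + L *v (z - t)))"
        using sum_shift[of "\<lambda>y. s y * s (y + L *v (z - t))" "L *v t"]
        by (simp add: matrix_vector_mult_diff_distrib algebra_simps)
    qed
    also have "\<dots> = (\<Sum>y\<in>UNIV. s y * (\<Sum>L\<in>GL. s (y + L *v (z - t))))"
      by (subst sum.swap) (simp add: sum_distrib_left)
    finally have "(N - 1) * (\<Sum>L\<in>GL. \<Sum>y\<in>UNIV. s (y + L *v t) * s (y + L *v z)) =
        (\<Sum>y\<in>UNIV. s y * ((N - 1) * (\<Sum>L\<in>GL. s (y + L *v (z - t)))))"
      by (simp add: sum_distrib_left mult_ac)
    also have "\<dots> = (\<Sum>y\<in>UNIV. s y * (g * (?S - 1)))"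
    proof (rule sum.cong[OF refl])
      fix y
      have "(N - 1) * (\<Sum>L\<in>GL. s (y + L *v (z - t))) = g * (\<Sum>w\<in>UNIV-{0}. s (y + w))"
        unfolding N_def g_def by (rule sum_GL_vec) (use that in auto)
      also have "(\<Sum>w\<in>UNIV-{0}. s (y + w)) = ?S - s y"
        using sumS[of y] by (simp add: sum_diff1 add.commute)
      finally show "s y * ((N - 1) * (\<Sum>L\<in>GL. s (y + L *v (z - t)))) = s y * (g * (?S - 1))"
        by (simp add: s_def)
    qed
    also have "\<dots> = g * ?S * (?S - 1)" using sumS[of 0] by (simp add: sum_distrib_right[symmetric])
    finally show ?thesis by simp
  qed
  define P where "P = (\<Sum>L\<in>GL. \<Sum>y\<in>UNIV. \<Sum>t\<in>T. \<Sum>z\<in>T-{t}. s (y + L *v t) * s (y + L *v z))"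
  have "(N - 1) * P = (\<Sum>t\<in>T. \<Sum>z\<in>T-{t}. (N - 1) * (\<Sum>L\<in>GL. \<Sum>y\<in>UNIV. s (y + L *v t) * s (y + L *v z)))"
  proof -
    have "P = (\<Sum>L\<in>GL. \<Sum>t\<in>T. \<Sum>y\<in>UNIV. \<Sum>z\<in>T-{t}. s (y + L *v t) * s (y + L *v z))"
      unfolding P_def by (rule sum.cong[OF refl], rule sum.swap)
    also have "\<dots> = (\<Sum>L\<in>GL. \<Sum>t\<in>T. \<Sum>z\<in>T-{t}. \<Sum>y\<in>UNIV. s (y + L *v t) * s (y + L *v z))"
      by (rule sum.cong[OF refl], rule sum.cong[OF refl], rule sum.swap)
    also have "\<dots> = (\<Sum>t\<in>T. \<Sum>L\<in>GL. \<Sum>z\<in>T-{t}. \<Sum>y\<in>UNIV. s (y + L *v t) * s (y + L *v z))"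
      by (rule sum.swap)
    also have "\<dots> = (\<Sum>t\<in>T. \<Sum>z\<in>T-{t}. \<Sum>L\<in>GL. \<Sum>y\<in>UNIV. s (y + L *v t) * s (y + L *v z))"
      by (rule sum.cong[OF refl], rule sum.swap)
    finally show ?thesis by (simp only: sum_distrib_left)
  qed
  also have "\<dots> \<le> (\<Sum>t\<in>T. \<Sum>z\<in>T-{t}. g * ?S * (?S - 1))" by (intro sum_mono pair) auto
  also have "\<dots> = k * ((k - 1) * (g * ?S * (?S - 1)))"
    using k2 by (simp add: k_def of_nat_diff)
  finally have NP: "(N - 1) * P \<le> k * (k - 1) * g * ?S * (?S - 1)" by (simp add: mult_ac)
  have P: "P \<le> g * k * ?S / 2"
  proof (cases "card S = 0")
    case True
    thus ?thesis using NP N_ge by (simp add: mult_le_0_iff)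
  next
    case False
    hence "1 \<le> card S" by linarith
    hence "real 1 \<le> ?S" by (simp only: of_nat_le_iff)
    hence S1: "?S \<ge> 1" by (simp only: of_nat_1)
    have "(k - 1) * (?S - 1) \<le> k * ?S - k - ?S + 1" by (simp add: algebra_simps)
    also have "\<dots> \<le> (N - 1) / 2" using close S1 k_ge by (simp add: S_def)
    finally have "(g * k * ?S) * ((k - 1) * (?S - 1)) \<le> (g * k * ?S) * ((N - 1) / 2)"
      using g_pos k_ge by (intro mult_left_mono) auto
    moreover have "k * (k - 1) * g * ?S * (?S - 1) = (g * k * ?S) * ((k - 1) * (?S - 1))" by simp
    moreover have "(g * k * ?S) * ((N - 1) / 2) = (N - 1) * (g * k * ?S / 2)" by simp
    ultimately have "(N - 1) * P \<le> (N - 1) * (g * k * ?S / 2)" using NP by linarith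
    thus ?thesis using N_ge by (subst (asm) mult_le_cancel_left_pos) auto
  qed
  have "(\<Sum>L\<in>GL. \<Sum>y\<in>UNIV. \<Sum>t\<in>T. s (y + L *v t)) = (\<Sum>t\<in>T. \<Sum>L\<in>GL. \<Sum>y\<in>UNIV. s (y + L *v t))"
    by (rule trans[OF sum.cong[OF refl sum.swap] sum.swap])
  also have "\<dots> = k * (g * ?S)" by (simp only: single) (simp add: k_def)
  finally have first: "(\<Sum>L\<in>GL. \<Sum>y\<in>UNIV. \<Sum>t\<in>T. s (y + L *v t)) = k * (g * ?S)" .
  have "(\<Sum>L\<in>GL. \<Sum>y\<in>UNIV. (\<Sum>t\<in>T. s (y + L *v t)) - (\<Sum>t\<in>T. \<Sum>z\<in>T-{t}. s (y + L *v t) * s (y + L *v z))) \<le> viol c"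
    unfolding viol_def by (intro sum_mono pt)
  hence "k * (g * ?S) - P \<le> viol c" unfolding sum_subtractf first P_def .
  thus ?thesis using P by (simp add: S_def mult_ac)
qed

end

section \<open>Orbits of constraints\<close>

lemma aff_inv_act_eq:
  assumes "snd h \<in> GL"
  shows "aff_inv_act h (aff_act h x) = x" "aff_act h (aff_inv_act h x) = x"
  using GL_matrix_inv[OF assms]
  by (simp_all add: aff_inv_act_def aff_act_def matrix_vector_mul_assoc)

lemma aff_group_iff: "h \<in> aff_group \<longleftrightarrow> snd h \<in> GL"
  by (cases h) (simp add: aff_group_def GL_def)

lemma supp_fun_act:
  assumes "h \<in> aff_group"
  shows "supp (fun_act h e0) = aff_act h ` supp e0"
proof -
  note h = aff_inv_act_eq[of h, OF assms[unfolded aff_group_iff]]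
  show ?thesis
  proof
    show "supp (fun_act h e0) \<subseteq> aff_act h ` supp e0"
    proof
      fix x assume "x \<in> supp (fun_act h e0)"
      hence "aff_inv_act h x \<in> supp e0" by (simp add: supp_def fun_act_def)
      thus "x \<in> aff_act h ` supp e0" using h(2)[of x] by (metis imageI)
    qed
    show "aff_act h ` supp e0 \<subseteq> supp (fun_act h e0)"
      by (auto simp: supp_def fun_act_def h)
  qed
qed

lemma inj_aff_act: "h \<in> aff_group \<Longrightarrow> inj (aff_act h)"
  by (metis aff_group_iff aff_inv_act_eq(1) injI)

lemma sum_supp_fun_act:
  assumes "h \<in> aff_group"
  shows "(\<Sum>x\<in>supp (fun_act h e0). c x) = (\<Sum>t\<in>supp e0. c (fst h + snd h *v t))"
  unfolding supp_fun_act[OF assms]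
  by (subst sum.reindex) (auto intro: inj_on_subset[OF inj_aff_act[OF assms]] simp: aff_act_def add.commute)

lemma dotp_fun_act:
  assumes h: "h \<in> aff_group" and e0: "\<forall>x. e0 x \<in> {0, 1}"
  shows "dotp (fun_act h e0) c = (\<Sum>t\<in>supp e0. c (fst h + snd h *v t))"
proof -
  have "dotp (fun_act h e0) c = (\<Sum>x\<in>supp (fun_act h e0). fun_act h e0 x * c x)"
    unfolding dotp_def by (rule sum.mono_neutral_right) (auto simp: supp_def)
  also have "\<dots> = (\<Sum>x\<in>supp (fun_act h e0). c x)"
  proof (rule sum.cong[OF refl])
    fix x assume "x \<in> supp (fun_act h e0)"
    hence "fun_act h e0 x = 1" using e0 by (auto simp: supp_def fun_act_def)
    thus "fun_act h e0 x * c x = c x" by simp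
  qed
  finally show ?thesis by (simp add: sum_supp_fun_act[OF h])
qed

section \<open>From distinct supports to affine maps\<close>

definition aff_mult :: "('k::field ^ 'n) \<times> ('k ^ 'n ^ 'n) \<Rightarrow> ('k ^ 'n) \<times> ('k ^ 'n ^ 'n) \<Rightarrow> ('k ^ 'n) \<times> ('k ^ 'n ^ 'n)" where
  "aff_mult h h' = (fst h + snd h *v fst h', snd h ** snd h')"

lemma aff_act_mult: "aff_act (aff_mult h h') x = aff_act h (aff_act h' x)"
  by (simp add: aff_act_def aff_mult_def matrix_vector_right_distrib matrix_vector_mul_assoc add_ac)

lemma aff_mult_group: "h \<in> aff_group \<Longrightarrow> h' \<in> aff_group \<Longrightarrow> aff_mult h h' \<in> aff_group"
  by (simp add: aff_group_iff aff_mult_def GL_mult)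

lemma inj_aff_mult:
  assumes "h \<in> aff_group"
  shows "inj (aff_mult h)"
proof (rule injI)
  fix x y assume eq: "aff_mult h x = aff_mult h y"
  have h: "snd h \<in> GL" using assms by (simp add: aff_group_iff)
  have "snd h *v fst x = snd h *v fst y" "snd h ** snd x = snd h ** snd y"
    using eq by (auto simp: aff_mult_def)
  hence "fst x = fst y" "snd x = snd y"
    using GL_vec_inj[OF h] GL_matrix_inv(2)[OF h] by (blast, metis matrix_mul_assoc matrix_mul_lid)
  thus "x = y" by (simp add: prod_eq_iff)
qed

lemma aff_inverse:
  fixes h :: "('k::field ^ 'n::finite) \<times> ('k ^ 'n ^ 'n)"
  assumes "h \<in> aff_group"
  shows "\<exists>h'\<in>aff_group. \<forall>x. aff_act h' (aff_act h x) = x"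
proof -
  have h: "snd h \<in> GL" using assms by (simp add: aff_group_iff)
  let ?A = "matrix_inv (snd h)"
  have "aff_act (- (?A *v fst h), ?A) (aff_act h x) = x" for x
    using GL_matrix_inv[OF h]
    by (simp add: aff_act_def matrix_vector_right_distrib matrix_vector_mul_assoc)
  moreover have "(- (?A *v fst h), ?A) \<in> aff_group" using GL_matrix_inv[OF h] by (simp add: aff_group_iff)
  ultimately show ?thesis by blast
qed

text \<open>Left multiplication by h1 composed with the inverse of h0 injects one fibre into the
  other; applied both ways, all fibres have equal size.\<close>

lemma orbit_fibre_card:
  fixes h0 h1 :: "('k::{field,finite} ^ 'n::finite) \<times> ('k ^ 'n ^ 'n)"
  assumes "h0 \<in> aff_group" "h1 \<in> aff_group"
  shows "card {h \<in> aff_group. aff_act h ` S = aff_act h0 ` S} \<le> card {h \<in> aff_group. aff_act h ` S = aff_act h1 ` S}"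
proof -
  obtain h0' where h0': "h0' \<in> aff_group" "\<And>x. aff_act h0' (aff_act h0 x) = x"
    using aff_inverse[OF assms(1)] by blast
  let ?t = "aff_mult h1 h0'"
  have t: "?t \<in> aff_group" by (rule aff_mult_group[OF assms(2) h0'(1)])
  show ?thesis
  proof (rule card_inj_on_le[of "aff_mult ?t"])
    show "inj_on (aff_mult ?t) {h \<in> aff_group. aff_act h ` S = aff_act h0 ` S}"
      by (rule inj_on_subset[OF inj_aff_mult[OF t]]) simp
    show "aff_mult ?t ` {h \<in> aff_group. aff_act h ` S = aff_act h0 ` S} \<subseteq> {h \<in> aff_group. aff_act h ` S = aff_act h1 ` S}"
    proof (rule image_subsetI)
      fix h assume "h \<in> {h \<in> aff_group. aff_act h ` S = aff_act h0 ` S}"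
      hence h: "h \<in> aff_group" "aff_act h ` S = aff_act h0 ` S" by auto
      have "aff_act (aff_mult ?t h) ` S = aff_act ?t ` (aff_act h ` S)" by (simp add: image_image aff_act_mult)
      also have "\<dots> = aff_act h1 ` S" unfolding h(2) by (simp add: image_image aff_act_mult h0'(2))
      finally show "aff_mult ?t h \<in> {h \<in> aff_group. aff_act h ` S = aff_act h1 ` S}"
        using aff_mult_group[OF t h(1)] by simp
    qed
  qed simp
qed

text \<open>Equal fibres convert the fraction of distinct supports into a fraction of group
  elements, over which averaging is possible.\<close>

lemma rej_eq:
  fixes e0 :: "'k::{field,finite} ^ 'n::finite \<Rightarrow> 'a::comm_ring_1"
  shows "rej e0 c * card (aff_group :: (('k ^ 'n) \<times> ('k ^ 'n ^ 'n)) set) =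
    card {h \<in> aff_group. (\<Sum>t\<in>supp e0. c (fst h + snd h *v t)) \<noteq> 0}"
proof -
  let ?A = "aff_group :: (('k ^ 'n) \<times> ('k ^ 'n ^ 'n)) set"
  define F where "F \<sigma> = {h \<in> ?A. supp (fun_act h e0) = \<sigma>}" for \<sigma>
  define u where "u = card (F (supp (fun_act (0, mat 1) e0)))"
  have one: "(0, mat 1) \<in> ?A" by (simp add: aff_group_iff mat_1_GL)
  have F: "card (F \<sigma>) = u" if \<sigma>: "\<sigma> \<in> constraint_supports e0" for \<sigma>
  proof -
    obtain h0 where h0: "h0 \<in> ?A" "\<sigma> = supp (fun_act h0 e0)" using \<sigma> by (auto simp: constraint_supports_def)
    have F_eq: "F (supp (fun_act h1 e0)) = {h \<in> ?A. aff_act h ` supp e0 = aff_act h1 ` supp e0}" if "h1 \<in> ?A" for h1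
      using that by (auto simp: F_def supp_fun_act)
    show ?thesis unfolding h0(2) u_def F_eq[OF h0(1)] F_eq[OF one]
      by (intro antisym orbit_fibre_card h0(1) one)
  qed
  have group: "card {h \<in> ?A. supp (fun_act h e0) \<in> E} = card E * u" if "E \<subseteq> constraint_supports e0" for E
  proof -
    have "card {h \<in> ?A. supp (fun_act h e0) \<in> E} = card (\<Union>\<sigma>\<in>E. F \<sigma>)"
      by (rule arg_cong[where f = card]) (auto simp: F_def)
    also have "\<dots> = (\<Sum>\<sigma>\<in>E. card (F \<sigma>))"
      by (rule card_UN_disjoint) (auto simp: F_def)
    also have "\<dots> = (\<Sum>\<sigma>\<in>E. u)" by (rule sum.cong) (use F that in auto)
    finally show ?thesis by simp
  qed
  define E where "E = constraint_supports e0"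
  define E' where "E' = {\<sigma> \<in> E. (\<Sum>x\<in>\<sigma>. c x) \<noteq> 0}"
  have A: "card ?A = card E * u"
  proof -
    have "{h \<in> ?A. supp (fun_act h e0) \<in> E} = ?A" by (auto simp: E_def constraint_supports_def)
    thus ?thesis using group[of E] by (simp add: E_def)
  qed
  have E': "card {h \<in> ?A. (\<Sum>t\<in>supp e0. c (fst h + snd h *v t)) \<noteq> 0} = card E' * u"
  proof -
    have "{h \<in> ?A. supp (fun_act h e0) \<in> E'} = {h \<in> ?A. (\<Sum>t\<in>supp e0. c (fst h + snd h *v t)) \<noteq> 0}"
      by (auto simp: E'_def E_def constraint_supports_def sum_supp_fun_act)
    moreover have "E' \<subseteq> constraint_supports e0" by (auto simp: E'_def E_def)
    ultimately show ?thesis using group[of E'] by simp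
  qed
  have "E \<noteq> {}" using one by (auto simp: E_def constraint_supports_def)
  hence "card E \<noteq> 0" by simp
  thus ?thesis unfolding rej_def A E' E_def[symmetric] E'_def[symmetric] by simp
qed

text \<open>From p >= 2 one gets \<open>\<delta>\<close> > 1/2. The size factor grows with
  \<open>\<delta>\<close> and is about 621.7 at 1/2, whence 600; in r the numerator is at most 7/16
  and the denominator at least 512 times 8.5.\<close>

lemma test_radius_bounds:
  fixes \<delta> :: real and p :: nat
  assumes p: "p \<ge> 2" and \<delta>: "(real p - 1) / real p < \<delta>" "\<delta> < 1"
  defines "r \<equiv> 7 * (1 - \<delta>)^3 * (\<delta> - (real p - 1) / real p) / (512 * (1 + 15 * \<delta>))"
  shows "0 \<le> r" "r \<le> 1 / 1000" "600 \<le> 128 * (1 + 15 * \<delta>) / (7 * (1 - \<delta>)^2)"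
proof -
  have "1 / 2 \<le> (real p - 1) / real p" using p by (simp add: field_simps)
  hence d: "1 / 2 < \<delta>" "\<delta> - (real p - 1) / real p \<le> 1 / 2" using \<delta> by linarith+
  let ?u = "\<delta> - (real p - 1) / real p"
  have c: "(1 - \<delta>) ^ 3 \<le> (1 / 2) ^ 3" "0 \<le> (1 - \<delta>) ^ 3" "(1 - \<delta>)\<^sup>2 \<le> (1 / 2)\<^sup>2"
    using d \<delta>(2) by (auto intro!: power_mono)
  show "0 \<le> r" unfolding r_def using c d \<delta> by (intro divide_nonneg_nonneg mult_nonneg_nonneg) auto
  have "(1 - \<delta>) ^ 3 * ?u \<le> (1 / 2) ^ 3 * (1 / 2)" using c d \<delta> by (intro mult_mono) auto
  hence "7 * (1 - \<delta>) ^ 3 * ?u \<le> 1 / 1000 * (512 * (1 + 15 * \<delta>))" using d by (simp add: power3_eq_cube)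
  thus "r \<le> 1 / 1000" unfolding r_def using d by (subst divide_le_eq) auto
  have "(1 - \<delta>)\<^sup>2 > 0" using \<delta>(2) by simp
  moreover have "600 * (7 * (1 - \<delta>)\<^sup>2) \<le> 128 * (1 + 15 * \<delta>)" using c(3) d by (simp add: power2_eq_square[of "1/2"])
  ultimately show "600 \<le> 128 * (1 + 15 * \<delta>) / (7 * (1 - \<delta>)^2)" by (subst le_divide_eq) auto
qed

theorem theorem6p16:
  fixes e0 :: "('k::{field,finite}) ^ ('n::finite) \<Rightarrow> ('p::prime_card) mod_ring"
    and \<delta> :: real and k :: nat
  assumes "(real CARD('p) - 1) / real CARD('p) < \<delta>" and "\<delta> < 1"
    and "\<forall>x. e0 x \<in> {0, 1}"
    and "k = card (supp e0)" and "k \<ge> 2"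
    and "real CARD('k) ^ CARD('n) \<ge> real k ^ 4 * (128 * (1 + 15 * \<delta>) / (7 * (1 - \<delta>)^2))"
  shows "\<forall>c :: 'k ^ 'n \<Rightarrow> 'p mod_ring.
           rej e0 c \<ge> real k * (7 * (1 - \<delta>)^3 * (\<delta> - (real CARD('p) - 1) / real CARD('p))
                                 / (512 * (1 + 15 * \<delta>)))
             * min (Min ((\<lambda>c'. hdist c c') ` aff_code e0)) (1 / real k ^ 3)"
proof
  fix c :: "'k ^ 'n \<Rightarrow> 'p mod_ring"
  define r where "r = 7 * (1 - \<delta>)^3 * (\<delta> - (real CARD('p) - 1) / real CARD('p)) / (512 * (1 + 15 * \<delta>))"
  have "CARD('p) \<ge> 2" by (rule prime_ge_2_nat) (rule prime_card)
  note rb = test_radius_bounds[OF this assms(1,2), folded r_def]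
  define N where "N = real CARD('k) ^ CARD('n)"
  define g where "g = real (card (GL :: ('k ^ 'n ^ 'n) set))"
  have "600 * real k ^ 4 \<le> real k ^ 4 * (128 * (1 + 15 * \<delta>) / (7 * (1 - \<delta>)^2))"
    using mult_left_mono[OF rb(3), of "real k ^ 4"] by (simp add: mult.commute)
  hence big: "600 * real k ^ 4 \<le> N" using assms(6) by (simp add: N_def)
  interpret orbit_code "supp e0" N g "real k"
    by standard (use assms(4,5) big in \<open>auto simp: N_def g_def\<close>)
  obtain m :: "'k ^ 'n \<Rightarrow> 'k ^ 'n ^ 'n" and e R where m:
    "\<And>u v. m (u + v) = m u + m v" "\<And>u v. m u *v v = m v *v u"
    "\<And>u. u \<noteq> 0 \<Longrightarrow> invertible (m u)" "m e = mat 1" "0 \<notin> R"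
    "card (- R) \<le> 2 * CARD('k) ^ (CARD('n) div 2)"
    "\<And>Z :: 'k ^ 'n ^ 'n. card {(P, u). invertible P \<and> u \<in> R \<and> m u ** P = P ** Z} \<le> CARD('n) * (CARD('k) ^ CARD('n) - 1)"
    "\<And>c. (CARD('k) - 1) * card {u. det (m u) = c} \<le> CARD('k) ^ CARD('n) - 1"
    by (rule singer_structure) blast
  interpret singer m e R N g
  proof unfold_locales
    show "N = real CARD('k) ^ CARD('n)" by (rule N_def)
    show "g = real (card (GL :: ('k ^ 'n ^ 'n) set))" by (rule g_def)
    show "m (u + v) = m u + m v" "m u *v v = m v *v u" for u v by (rule m)+
    show "m u \<in> GL" if "u \<noteq> 0" for u using m(3)[OF that] by (simp add: GL_def)
    show "m e = mat 1" "0 \<notin> R" "card (- R) \<le> 2 * CARD('k) ^ (CARD('n) div 2)" by (rule m)+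
    show "card {(P, u). P \<in> GL \<and> u \<in> R \<and> m u ** P = P ** Z} \<le> CARD('n) * (CARD('k) ^ CARD('n) - 1)" for Z
      using m(7)[of Z] by (simp only: GL_def mem_Collect_eq)
    show "(CARD('k) - 1) * card {u. det (m u) = c} \<le> CARD('k) ^ CARD('n) - 1" for c
      by (rule m(8))
  qed
  have A: "aff_group = (UNIV :: ('k ^ 'n) set) \<times> (GL :: ('k ^ 'n ^ 'n) set)"
    by (auto simp: aff_group_iff)
  have code: "f \<in> aff_code e0 \<longleftrightarrow> (\<forall>L\<in>GL. \<forall>y. syn f L y = 0)" for f :: "'k ^ 'n \<Rightarrow> 'p mod_ring"
  proof -
    have "f \<in> aff_code e0 \<longleftrightarrow> (\<forall>h\<in>aff_group. (\<Sum>t\<in>supp e0. f (fst h + snd h *v t)) = 0)"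
      unfolding aff_code_def mem_Collect_eq by (intro ball_cong refl) (simp only: dotp_fun_act[OF _ assms(3)])
    also have "\<dots> \<longleftrightarrow> (\<forall>L\<in>GL. \<forall>y. syn f L y = 0)"
      unfolding A by (auto simp: syn_def)
    finally show ?thesis .
  qed
  have rejN: "rej e0 c * (g * N) = viol c"
  proof -
    have "card {h \<in> aff_group. (\<Sum>t\<in>supp e0. c (fst h + snd h *v t)) \<noteq> 0} =
        (\<Sum>h\<in>(UNIV :: ('k ^ 'n) set) \<times> GL. of_bool (syn c (snd h) (fst h) \<noteq> 0) :: real)"
      unfolding A by (subst sum_of_bool_eq) (auto simp: syn_def intro!: arg_cong[where f = card])
    also have "\<dots> = (\<Sum>y\<in>UNIV. \<Sum>L\<in>GL. of_bool (syn c L y \<noteq> 0))"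
      by (subst sum.cartesian_product) (simp add: case_prod_unfold)
    also have "\<dots> = viol c" unfolding viol_def by (rule sum.swap)
    finally have "rej e0 c * card (aff_group :: (('k ^ 'n) \<times> ('k ^ 'n ^ 'n)) set) = viol c"
      using rej_eq[of e0 c] by simp
    moreover have "real (card (aff_group :: (('k ^ 'n) \<times> ('k ^ 'n ^ 'n)) set)) = g * N"
      unfolding A by (simp add: card_cartesian_product g_def N_def)
    ultimately show ?thesis by simp
  qed
  have gN: "g * N > 0" using g_pos N_ge by simp
  let ?d = "Min ((\<lambda>c'. hdist c c') ` aff_code e0)"
  \<comment> \<open>The threshold is that of \<open>self_correction\<close>. Above it the rejection
    probability exceeds 1/(1000 k^2), hence r/k^2, which is the claim with 1/k^3 as the minimum.
    Below it \<open>f\<close> is a codeword and \<open>amplification\<close> yields k/2 times the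
    distance, with r at most 1/2.\<close>
  have "real k * r * min ?d (1 / real k ^ 3) \<le> rej e0 c"
  proof (cases "1000 * (real k)\<^sup>2 * viol c \<le> g * N")
    case False
    hence "g * N \<le> 1000 * (real k)\<^sup>2 * (rej e0 c * (g * N))" by (simp add: rejN)
    hence "(g * N) * 1 \<le> (g * N) * (1000 * (real k)\<^sup>2 * rej e0 c)" by (simp add: mult_ac)
    hence rj: "1 \<le> 1000 * (real k)\<^sup>2 * rej e0 c" using gN by (simp only: mult_le_cancel_left_pos)
    have "real k * r * min ?d (1 / real k ^ 3) \<le> real k * r * (1 / real k ^ 3)"
      using rb(1) by (intro mult_left_mono) auto
    also have "\<dots> = r / (real k)\<^sup>2" using k_ge by (simp add: power2_eq_square power3_eq_cube)
    also have "\<dots> \<le> 1 / 1000 / (real k)\<^sup>2" using rb(2) by (intro divide_right_mono) auto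
    also have "\<dots> \<le> rej e0 c" using rj k_ge by (simp add: field_simps)
    finally show ?thesis .
  next
    case True
    have "supp e0 \<noteq> {}" using k2 by auto
    then obtain a where a: "a \<in> supp e0" by blast
    from self_correction[OF a True] obtain f where
      f: "100 * real k * card {L \<in> GL. \<exists>y. syn f L y \<noteq> 0} \<le> g" "2 * real k * card {x. c x \<noteq> f x} \<le> N" by blast
    have "{L \<in> GL. \<exists>y. (\<Sum>t\<in>supp e0. f (y + L *v t)) \<noteq> 0} = {}"
      by (rule no_bad_linear_parts) (use k2 N_big f(1) in \<open>simp_all add: k_def syn_def\<close>)
    hence f0: "syn f L y = 0" if "L \<in> GL" for L y using that by (auto simp: syn_def)
    have fC: "f \<in> aff_code e0" using f0 by (simp add: code)
    let ?S = "real (card {x. c x \<noteq> f x})"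
    have "?d \<le> hdist c f" by (rule Min_le) (use fC in auto)
    also have "\<dots> = ?S / N" by (simp add: hdist_def N_def)
    finally have d: "?d \<le> ?S / N" .
    have "g * real k * ?S / 2 \<le> rej e0 c * (g * N)" using amplification[OF f0 f(2)] by (simp add: rejN)
    hence "(g * N) * (real k * (?S / N) / 2) \<le> (g * N) * rej e0 c" using N_ge by (simp add: mult_ac)
    hence amp: "real k * (?S / N) / 2 \<le> rej e0 c" using gN by (simp only: mult_le_cancel_left_pos)
    have "real k * r * min ?d (1 / real k ^ 3) \<le> real k * r * (?S / N)"
      using rb(1) d by (intro mult_left_mono) auto
    also have "\<dots> \<le> real k * (1 / 2) * (?S / N)"
      using rb(2) N_ge by (intro mult_right_mono mult_left_mono) auto
    finally show ?thesis using amp by simp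
  qed
  thus "rej e0 c \<ge> real k * (7 * (1 - \<delta>)^3 * (\<delta> - (real CARD('p) - 1) / real CARD('p)) / (512 * (1 + 15 * \<delta>)))
             * min ?d (1 / real k ^ 3)"
    by (simp only: r_def)
qed

end
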